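(* Let $m,n\ge 1$ be integers. Let $S_m$ act on $\otimes^m\mathbf{C}^n$ by permuting the tensor factors, and let $\mathrm{GL}_n(\mathbf{C})$ act on each tensor factor (diagonally, via the defining representation on $\mathbf{C}^n$). Then, as a representation of $S_m\times\mathrm{GL}_n(\mathbf{C})$, $$\otimes^m\mathbf{C}^n\cong\bigoplus_{\lambda\in\Lambda^m_n}V_\lambda\otimes W^n_\lambda,$$ where $\Lambda^m_n$ is the set of partitions of $m$ with at most $n$ nonzero parts.
   Context: A polynomial representation of $\mathrm{GL}_n(\mathbf{C})$ is a finite dimensional complex representation whose matrix entries are polynomials in the entries of the group element. For a polynomial representation $(\rho,W)$, its character is $\mathrm{ch}_W(x_1,\dots,x_n)=\mathrm{tr}(\rho(\mathrm{diag}(x_1,\dots,x_n)))$. A semistandard Young tableau of shape $\lambda$ in $n$ letters is a filling of the Young diagram of $\lambda$ (with $\lambda_i$ boxes in row $i$) by numbers in $\{1,\dots,n\}$, weakly increasing along rows and strictly increasing down columns; the Schur polynomial $s_\lambda(x_1,\dots,x_n)$ is the sum over all such tableaux of $x_1^{\mu_1}\cdots x_n^{\mu_n}$, where $\mu_i$ is the number of occurrences of $i$. For a partition $\lambda$ with at most $n$ nonzero parts, $W^n_\lambda$ denotes the irreducible polynomial representation of $\mathrm{GL}_n(\mathbf{C})$ (unique up to isomorphism) with character $s_\lambda(x_1,\dots,x_n)$. For a partition $\lambda=(\lambda_1,\dots,\lambda_l)$ of $m$, let $X_\lambda$ be the set of ordered set partitions $(S_1,\dots,S_l)$ of $\{1,\dots,m\}$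 with $|S_i|=\lambda_i$, with the natural action of $S_m$, and let $\mathbf{C}[X_\lambda]$ be the corresponding permutation representation. Let $\epsilon$ be the sign character of $S_m$ and $\lambda'$ the conjugate partition, $\lambda'_i=\#\{j\mid\lambda_j\ge i\}$. $V_\lambda$ denotes the unique irreducible complex representation of $S_m$ which occurs in both $\mathbf{C}[X_\lambda]$ and $\mathbf{C}[X_{\lambda'}]\otimes\epsilon$; as $\lambda$ runs over partitions of $m$, the $V_\lambda$ form a set of representatives of isomorphism classes of irreducible complex representations of $S_m$. *)

theory Defs
  imports
    "Jordan_Normal_Form.VS_Connect"
    "HOL-Algebra.Sym_Groups"
    "HOL-Library.Countable_Set"
    "HOL-Library.FuncSet"
    "HOL-Library.Disjoint_Sets"
begin

section \<open>Finite dimensional complex representations\<close>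

text \<open>
  A representation of a group \<open>G\<close> on the column vectors \<open>carrier_vec d\<close> is a homomorphism from \<open>G\<close>
  to the group of invertible \<open>d \<times> d\<close> matrices. Its degree is determined by the matrices themselves,
  so a representation is just a matrix-valued function on the type of \<open>G\<close>; its values outside the
  carrier of \<open>G\<close> are irrelevant.
\<close>

definition GL :: "nat \<Rightarrow> complex mat monoid" where
  "GL n = units_of (ring_mat TYPE(complex) n ())"

definition is_rep :: "('g, 'b) monoid_scheme \<Rightarrow> nat \<Rightarrow> ('g \<Rightarrow> complex mat) \<Rightarrow> bool" where
  "is_rep G d \<rho> \<longleftrightarrow> group G \<and> \<rho> \<in> hom G (GL d)"

text \<open>
  In \<open>rep_iso\<close> the change of basis \<open>P\<close> does not depend on \<open>g\<close>; \<^const>\<open>similar_mat_wit\<close> also says that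
  all the matrices involved are square of the same size, so the degrees agree.
\<close>

definition rep_iso ::
    "('g, 'b) monoid_scheme \<Rightarrow> ('g \<Rightarrow> complex mat) \<Rightarrow> ('g \<Rightarrow> complex mat) \<Rightarrow> bool" where
  "rep_iso G \<rho> \<sigma> \<longleftrightarrow> (\<exists>P Q. \<forall>g\<in>carrier G. similar_mat_wit (\<rho> g) (\<sigma> g) P Q)"

definition irreducible_rep :: "('g, 'b) monoid_scheme \<Rightarrow> ('g \<Rightarrow> complex mat) \<Rightarrow> bool" where
  "irreducible_rep G \<rho> \<longleftrightarrow>
     (\<exists>d>0. is_rep G d \<rho> \<and>
        (\<forall>U. subspace class_ring U (module_vec TYPE(complex) d) \<and>
             (\<forall>g\<in>carrier G. \<forall>u\<in>U. \<rho> g *\<^sub>v u \<in> U)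
           \<longrightarrow> U = {0\<^sub>v d} \<or> U = carrier_vec d))"

text \<open>\<open>\<rho>\<close> occurs in \<open>\<sigma>\<close> if it embeds equivariantly, i.e. if it is isomorphic to a subrepresentation.\<close>

definition occurs_in ::
    "('g, 'b) monoid_scheme \<Rightarrow> ('g \<Rightarrow> complex mat) \<Rightarrow> ('g \<Rightarrow> complex mat) \<Rightarrow> bool" where
  "occurs_in G \<rho> \<sigma> \<longleftrightarrow>
     (\<exists>d e. is_rep G d \<rho> \<and> is_rep G e \<sigma> \<and>
        (\<exists>A\<in>carrier_mat e d. inj_on ((*\<^sub>v) A) (carrier_vec d) \<and>
           (\<forall>g\<in>carrier G. A * \<rho> g = \<sigma> g * A)))"

definition trace_mat :: "'a::comm_monoid_add mat \<Rightarrow> 'a" where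
  "trace_mat A = (\<Sum>i<dim_row A. A $$ (i, i))"

definition kronecker :: "'a::times mat \<Rightarrow> 'a mat \<Rightarrow> 'a mat" where
  "kronecker A B = mat (dim_row A * dim_row B) (dim_col A * dim_col B)
     (\<lambda>(i, j). A $$ (i div dim_row B, j div dim_col B) * B $$ (i mod dim_row B, j mod dim_col B))"

definition tensor_rep :: "('g \<Rightarrow> complex mat) \<Rightarrow> ('g \<Rightarrow> complex mat) \<Rightarrow> 'g \<Rightarrow> complex mat" where
  "tensor_rep \<rho> \<sigma> g = kronecker (\<rho> g) (\<sigma> g)"

definition ext_tensor_rep ::
    "('g \<Rightarrow> complex mat) \<Rightarrow> ('h \<Rightarrow> complex mat) \<Rightarrow> 'g \<times> 'h \<Rightarrow> complex mat" where
  "ext_tensor_rep \<rho> \<sigma> = (\<lambda>(g, h). kronecker (\<rho> g) (\<sigma> h))"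

text \<open>
  For a finite set \<open>X\<close>, \<open>from_nat_into X\<close> enumerates \<open>X\<close> bijectively by \<open>{..<card X}\<close>. It is used to
  form direct sums over finite sets, and to turn \<open>X \<times> X\<close>-indexed families into matrices. The choice
  of enumeration only affects the results up to simultaneous reordering of bases.
\<close>

definition direct_sum_rep :: "'i set \<Rightarrow> ('i \<Rightarrow> 'g \<Rightarrow> complex mat) \<Rightarrow> 'g \<Rightarrow> complex mat" where
  "direct_sum_rep I \<rho> g = diag_block_mat (map (\<lambda>k. \<rho> (from_nat_into I k) g) [0..<card I])"

definition mat_on :: "'x set \<Rightarrow> ('x \<Rightarrow> 'x \<Rightarrow> 'a) \<Rightarrow> 'a mat" where
  "mat_on X f = mat (card X) (card X) (\<lambda>(i, j). f (from_nat_into X i) (from_nat_into X j))"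

text \<open>The permutation representation on \<open>C[X]\<close> of a left action \<open>act\<close>: it sends the basis vector
  of \<open>y\<close> to that of \<open>act g y\<close>.\<close>

definition perm_rep :: "'x set \<Rightarrow> ('g \<Rightarrow> 'x \<Rightarrow> 'x) \<Rightarrow> 'g \<Rightarrow> complex mat" where
  "perm_rep X act g = mat_on X (\<lambda>x y. if act g y = x then 1 else 0)"


section \<open>Partitions and Schur polynomials\<close>

definition partitions :: "nat \<Rightarrow> nat list set" where
  "partitions m = {\<mu>. sorted_wrt (\<ge>) \<mu> \<and> 0 \<notin> set \<mu> \<and> sum_list \<mu> = m}"

definition partitions_at_most :: "nat \<Rightarrow> nat \<Rightarrow> nat list set" where
  "partitions_at_most m n = {\<mu> \<in> partitions m. length \<mu> \<le> n}"

definition conjugate_partition :: "nat list \<Rightarrow> nat list" where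
  "conjugate_partition \<mu> =
     map (\<lambda>i. card {j. j < length \<mu> \<and> \<mu> ! j \<ge> i}) [1..<Suc (Max (insert 0 (set \<mu>)))]"

definition young_diagram :: "nat list \<Rightarrow> (nat \<times> nat) set" where
  "young_diagram \<mu> = {(i, j). i < length \<mu> \<and> j < \<mu> ! i}"

definition ssyt :: "nat list \<Rightarrow> nat \<Rightarrow> (nat \<times> nat \<Rightarrow> nat) set" where
  "ssyt \<mu> n = {T \<in> young_diagram \<mu> \<rightarrow>\<^sub>E {1..n}.
     (\<forall>i j j'. (i, j) \<in> young_diagram \<mu> \<and> (i, j') \<in> young_diagram \<mu> \<and> j < j'
        \<longrightarrow> T (i, j) \<le> T (i, j')) \<and>
     (\<forall>i i' j. (i, j) \<in> young_diagram \<mu> \<and> (i', j) \<in> young_diagram \<mu> \<and> i < i'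
        \<longrightarrow> T (i, j) < T (i', j))}"

definition schur :: "nat list \<Rightarrow> nat \<Rightarrow> (nat \<Rightarrow> complex) \<Rightarrow> complex" where
  "schur \<mu> n x = (\<Sum>T\<in>ssyt \<mu> n. \<Prod>k\<in>{1..n}. x k ^ card {c \<in> young_diagram \<mu>. T c = k})"


section \<open>The representations \<open>W\<^sub>\<mu>\<close> of the general linear group\<close>

definition polynomial_on_GL :: "nat \<Rightarrow> (complex mat \<Rightarrow> complex) \<Rightarrow> bool" where
  "polynomial_on_GL n f \<longleftrightarrow>
     (\<exists>(E :: (nat \<Rightarrow> nat \<Rightarrow> nat) set) c. finite E \<and>
        (\<forall>g\<in>carrier (GL n). f g = (\<Sum>e\<in>E. c e * (\<Prod>i<n. \<Prod>j<n. g $$ (i, j) ^ e i j))))"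

definition polynomial_rep :: "nat \<Rightarrow> (complex mat \<Rightarrow> complex mat) \<Rightarrow> bool" where
  "polynomial_rep n \<rho> \<longleftrightarrow>
     (\<exists>d. is_rep (GL n) d \<rho> \<and> (\<forall>i<d. \<forall>j<d. polynomial_on_GL n (\<lambda>g. \<rho> g $$ (i, j))))"

text \<open>
  Variables are numbered from 1, matrix rows from 0. The diagonal matrix lies in \<open>GL n\<close> only for
  nonzero entries; two polynomials that agree at all such points are equal.
\<close>

definition has_character :: "nat \<Rightarrow> (complex mat \<Rightarrow> complex mat) \<Rightarrow> ((nat \<Rightarrow> complex) \<Rightarrow> complex) \<Rightarrow> bool" where
  "has_character n \<rho> ch \<longleftrightarrow>
     (\<forall>x. (\<forall>k\<in>{1..n}. x k \<noteq> 0) \<longrightarrow> trace_mat (\<rho> (mat_diag n (\<lambda>i. x (Suc i)))) = ch x)"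

definition is_W :: "nat \<Rightarrow> nat list \<Rightarrow> (complex mat \<Rightarrow> complex mat) \<Rightarrow> bool" where
  "is_W n \<mu> \<rho> \<longleftrightarrow>
     polynomial_rep n \<rho> \<and> irreducible_rep (GL n) \<rho> \<and> has_character n \<rho> (schur \<mu> n)"


section \<open>The representations \<open>V\<^sub>\<mu>\<close> of the symmetric group\<close>

definition ordered_set_partitions :: "nat \<Rightarrow> nat list \<Rightarrow> nat set list set" where
  "ordered_set_partitions m \<mu> =
     {S. length S = length \<mu> \<and> (\<forall>i<length \<mu>. card (S ! i) = \<mu> ! i) \<and>
         disjoint_family_on ((!) S) {..<length \<mu>} \<and> \<Union>(set S) = {1..m}}"

definition young_perm_rep :: "nat \<Rightarrow> nat list \<Rightarrow> (nat \<Rightarrow> nat) \<Rightarrow> complex mat" where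
  "young_perm_rep m \<mu> = perm_rep (ordered_set_partitions m \<mu>) (\<lambda>\<sigma>. map ((`) \<sigma>))"

definition sign_rep :: "(nat \<Rightarrow> nat) \<Rightarrow> complex mat" where
  "sign_rep \<sigma> = mat 1 1 (\<lambda>_. of_int (sign \<sigma>))"

definition is_V :: "nat \<Rightarrow> nat list \<Rightarrow> ((nat \<Rightarrow> nat) \<Rightarrow> complex mat) \<Rightarrow> bool" where
  "is_V m \<mu> \<rho> \<longleftrightarrow>
     irreducible_rep (sym_group m) \<rho> \<and>
     occurs_in (sym_group m) \<rho> (young_perm_rep m \<mu>) \<and>
     occurs_in (sym_group m) \<rho> (tensor_rep (young_perm_rep m (conjugate_partition \<mu>)) sign_rep)"


section \<open>The tensor power\<close>

text \<open>
  The \<open>m\<close>-th tensor power of \<open>C\<^sup>n\<close> has the basis \<open>e\<^sub>J = e\<^bsub>J 1\<^esub> \<otimes> \<dots> \<otimes> e\<^bsub>J m\<^esub>\<close> indexed by the maps \<open>J\<close> from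
  \<open>{1..m}\<close> to \<open>{..<n}\<close>. A permutation \<open>\<sigma>\<close> moves the factor in position \<open>k\<close> to position \<open>\<sigma> k\<close>, so it
  sends \<open>e\<^sub>J\<close> to \<open>e\<^bsub>J \<circ> \<sigma>'\<^esub>\<close> with \<open>\<sigma>'\<close> the inverse of \<open>\<sigma>\<close>. A matrix \<open>g\<close> sends \<open>e\<^sub>J\<close> to the tensor product
  of the columns \<open>J 1, \<dots>, J m\<close> of \<open>g\<close>.
\<close>

definition tensor_basis :: "nat \<Rightarrow> nat \<Rightarrow> (nat \<Rightarrow> nat) set" where
  "tensor_basis m n = {1..m} \<rightarrow>\<^sub>E {..<n}"

definition tensor_power_sym :: "nat \<Rightarrow> nat \<Rightarrow> (nat \<Rightarrow> nat) \<Rightarrow> complex mat" where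
  "tensor_power_sym m n = perm_rep (tensor_basis m n) (\<lambda>\<sigma> J. J \<circ> Hilbert_Choice.inv \<sigma>)"

definition tensor_power_GL :: "nat \<Rightarrow> nat \<Rightarrow> complex mat \<Rightarrow> complex mat" where
  "tensor_power_GL m n g = mat_on (tensor_basis m n) (\<lambda>I J. \<Prod>k\<in>{1..m}. g $$ (I k, J k))"

definition tensor_power_rep :: "nat \<Rightarrow> nat \<Rightarrow> (nat \<Rightarrow> nat) \<times> complex mat \<Rightarrow> complex mat" where
  "tensor_power_rep m n = (\<lambda>(\<sigma>, g). tensor_power_sym m n \<sigma> * tensor_power_GL m n g)"

end

theory Submission
  imports Defs
    "Jordan_Normal_Form.Schur_Decomposition"
    "Jordan_Normal_Form.Matrix_Kernel"
    "HOL-Combinatorics.Permutations"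
begin

text \<open>
  Let \<open>A\<close> be the commutant of \<open>S\<^sub>m\<close> on the tensor power. Schur's lemma and averaging split off the
  \<open>V\<^sub>\<mu>\<close>-isotypic component for every \<open>\<mu>\<close> with at most \<open>n\<close> parts. The weight space of weight \<open>\<alpha>\<close> is
  the permutation module of \<open>X\<^sub>\<alpha>\<close>; it meets the \<open>V\<^sub>\<mu>\<close>-component only if \<open>\<alpha>\<close> is dominated by \<open>\<mu>\<close>,
  since \<open>V\<^sub>\<mu>\<close> occurs in the sign-twisted module of the conjugate partition, and it does so if \<open>\<alpha> = \<mu>\<close>.

  By polarization \<open>A\<close> is spanned by the image of \<open>GL\<^sub>n\<close>, so a class function on \<open>A\<close> is determined by its
  values on the projections to the weight spaces of dominant weight. This triangularity therefore leaves no
  room for further components. Finally \<open>W\<^sub>\<mu>\<close> is homogeneous of degree \<open>m\<close>, hence extends to an irreducible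
  representation of the algebra \<open>A\<close>, so that it is one of the multiplicity spaces; comparing weight
  multiplicities with Kostka numbers, which are triangular too, shows that it is the one of \<open>V\<^sub>\<mu>\<close>.
\<close>

section \<open>Matrices\<close>

text \<open>Nothing is known beforehand about irreducible representations of \<open>S_m\<close>
  other than the given \<open>V \<mu>\<close>, nor about those of the commutant. That the components
  of the \<open>V \<mu>\<close> exhaust the tensor power, and that \<open>W \<mu>\<close> belongs to
  \<open>V \<mu>\<close>, must therefore be forced by numbers, and the numbers are traces of
  commuting projections. The trace of an idempotent is its rank, so trace zero means zero; this
  replaces dimension counts. Dominance enters from two independent sides: from the two permutation
  modules that single out \<open>V \<mu>\<close>, and from tableaux through the Schur character of
  \<open>W \<mu>\<close>. Each time only the vanishing off the dominance order and the non-vanishing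
  at the shape itself are used; no Kostka number is evaluated, and antisymmetry of dominance
  identifies the indices. Letters count from 0 in the tensor basis but from 1 in tableaux and
  variables, which is the origin of the recurring \<open>Suc\<close>.\<close>

definition mat_sum :: "nat \<Rightarrow> nat \<Rightarrow> 'i set \<Rightarrow> ('i \<Rightarrow> complex mat) \<Rightarrow> complex mat" where
  "mat_sum nr nc I F = mat nr nc (\<lambda>(p, q). \<Sum>i\<in>I. F i $$ (p, q))"

lemma mat_sum_carrier [simp]: "mat_sum nr nc I F \<in> carrier_mat nr nc"
  and mat_sum_dim [simp]: "dim_row (mat_sum nr nc I F) = nr" "dim_col (mat_sum nr nc I F) = nc"
  and mat_sum_index [simp]:
    "p < nr \<Longrightarrow> q < nc \<Longrightarrow> mat_sum nr nc I F $$ (p, q) = (\<Sum>i\<in>I. F i $$ (p, q))"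
  by (auto simp: mat_sum_def)

lemma mat_mult_index:
  "A \<in> carrier_mat nr n \<Longrightarrow> B \<in> carrier_mat n nc \<Longrightarrow> p < nr \<Longrightarrow> q < nc \<Longrightarrow>
    (A * B) $$ (p, q) = (\<Sum>r<n. A $$ (p, r) * B $$ (r, q))"
  by (auto simp: scalar_prod_def lessThan_atLeast0 intro!: sum.cong)

lemma mat_assoc:
  fixes A B C :: "'a :: semiring_0 mat"
  assumes "dim_col A = dim_row B" "dim_col B = dim_row C"
  shows "A * B * C = A * (B * C)"
  by (rule assoc_mult_mat[of A "dim_row A" "dim_row B" B "dim_row C" C "dim_col C"])
    (use assms in auto)

lemma mult_mat_sum:
  assumes "A \<in> carrier_mat n nr" "\<And>i. i \<in> I \<Longrightarrow> F i \<in> carrier_mat nr nc"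
  shows "A * mat_sum nr nc I F = mat_sum n nc I (\<lambda>i. A * F i)"
proof (rule eq_matI)
  fix p q assume "p < dim_row (mat_sum n nc I (\<lambda>i. A * F i))" "q < dim_col (mat_sum n nc I (\<lambda>i. A * F i))"
  then have pq: "p < n" "q < nc" by auto
  have "(A * mat_sum nr nc I F) $$ (p, q) = (\<Sum>r<nr. A $$ (p, r) * mat_sum nr nc I F $$ (r, q))"
    by (rule mat_mult_index[OF assms(1) _ pq]) simp
  also have "\<dots> = (\<Sum>r<nr. \<Sum>i\<in>I. A $$ (p, r) * F i $$ (r, q))"
    using pq by (intro sum.cong) (auto simp: sum_distrib_left)
  also have "\<dots> = (\<Sum>i\<in>I. \<Sum>r<nr. A $$ (p, r) * F i $$ (r, q))" by (rule sum.swap)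
  also have "\<dots> = (\<Sum>i\<in>I. (A * F i) $$ (p, q))"
    using mat_mult_index[OF assms(1) assms(2) pq] by (intro sum.cong) auto
  finally show "(A * mat_sum nr nc I F) $$ (p, q) = mat_sum n nc I (\<lambda>i. A * F i) $$ (p, q)"
    using pq by simp
qed (use assms in auto)

lemma mat_sum_mult:
  assumes "A \<in> carrier_mat nc n" "\<And>i. i \<in> I \<Longrightarrow> F i \<in> carrier_mat nr nc"
  shows "mat_sum nr nc I F * A = mat_sum nr n I (\<lambda>i. F i * A)"
proof (rule eq_matI)
  fix p q assume "p < dim_row (mat_sum nr n I (\<lambda>i. F i * A))" "q < dim_col (mat_sum nr n I (\<lambda>i. F i * A))"
  then have pq: "p < nr" "q < n" by auto
  have "(mat_sum nr nc I F * A) $$ (p, q) = (\<Sum>r<nc. mat_sum nr nc I F $$ (p, r) * A $$ (r, q))"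
    by (rule mat_mult_index[OF _ assms(1) pq]) simp
  also have "\<dots> = (\<Sum>r<nc. \<Sum>i\<in>I. F i $$ (p, r) * A $$ (r, q))"
    using pq by (intro sum.cong) (auto simp: sum_distrib_right)
  also have "\<dots> = (\<Sum>i\<in>I. \<Sum>r<nc. F i $$ (p, r) * A $$ (r, q))" by (rule sum.swap)
  also have "\<dots> = (\<Sum>i\<in>I. (F i * A) $$ (p, q))"
    using mat_mult_index[OF assms(2) assms(1) pq] by (intro sum.cong) auto
  finally show "(mat_sum nr nc I F * A) $$ (p, q) = mat_sum nr n I (\<lambda>i. F i * A) $$ (p, q)"
    using pq by simp
qed (use assms in auto)

lemma mat_sum_cong:
  "I = J \<Longrightarrow> (\<And>i. i \<in> J \<Longrightarrow> F i = G i) \<Longrightarrow> mat_sum nr nc I F = mat_sum nr nc J G"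
  unfolding mat_sum_def by (auto intro!: cong_mat sum.cong)

text \<open>Matrices of all sizes share one type without a common zero; the explicit dimensions in
  \<open>mat_sum\<close> are what gives the empty sum a size.\<close>

lemma mat_sum_empty [simp]: "mat_sum nr nc {} F = 0\<^sub>m nr nc"
  by (rule eq_matI) auto

lemma mat_sum_insert:
  "finite I \<Longrightarrow> i \<notin> I \<Longrightarrow> F i \<in> carrier_mat nr nc \<Longrightarrow>
    mat_sum nr nc (insert i I) F = F i + mat_sum nr nc I F"
  by (rule eq_matI) auto

lemma mat_sum_single:
  assumes "finite I" "i \<in> I" "F i \<in> carrier_mat nr nc"
    and "\<And>j. j \<in> I \<Longrightarrow> j \<noteq> i \<Longrightarrow> F j = 0\<^sub>m nr nc"
  shows "mat_sum nr nc I F = F i"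
proof (rule eq_matI)
  fix p q assume pq: "p < dim_row (F i)" "q < dim_col (F i)"
  have "(\<Sum>j\<in>I. F j $$ (p, q)) = (\<Sum>j\<in>{i}. F j $$ (p, q))"
    using assms pq by (intro sum.mono_neutral_right) auto
  then show "mat_sum nr nc I F $$ (p, q) = F i $$ (p, q)" using pq assms by simp
qed (use assms in auto)

lemma trace_mat_sum:
  assumes "\<And>i. i \<in> I \<Longrightarrow> F i \<in> carrier_mat n n"
  shows "trace_mat (mat_sum n n I F) = (\<Sum>i\<in>I. trace_mat (F i))"
proof -
  have "trace_mat (mat_sum n n I F) = (\<Sum>p<n. \<Sum>i\<in>I. F i $$ (p, p))"
    by (simp add: trace_mat_def)
  also have "\<dots> = (\<Sum>i\<in>I. \<Sum>p<n. F i $$ (p, p))" by (rule sum.swap)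
  also have "\<dots> = (\<Sum>i\<in>I. trace_mat (F i))"
    using assms by (intro sum.cong) (auto simp: trace_mat_def)
  finally show ?thesis .
qed

lemma trace_mat_mult_comm:
  fixes A B :: "complex mat"
  assumes "A \<in> carrier_mat n k" "B \<in> carrier_mat k n"
  shows "trace_mat (A * B) = trace_mat (B * A)"
proof -
  have "trace_mat (A * B) = (\<Sum>p<n. \<Sum>q<k. A $$ (p, q) * B $$ (q, p))"
    using mat_mult_index[OF assms] assms by (auto simp: trace_mat_def)
  also have "\<dots> = (\<Sum>q<k. \<Sum>p<n. B $$ (q, p) * A $$ (p, q))"
    by (subst sum.swap) (simp add: mult.commute)
  also have "\<dots> = trace_mat (B * A)"
    using mat_mult_index[OF assms(2,1)] assms by (auto simp: trace_mat_def)
  finally show ?thesis .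
qed

lemma trace_mat_minus:
  "A \<in> carrier_mat n n \<Longrightarrow> B \<in> carrier_mat n n \<Longrightarrow> trace_mat (A - B) = trace_mat A - trace_mat (B :: complex mat)"
  by (auto simp: trace_mat_def sum_subtractf)

lemma trace_mat_smult: "trace_mat (c \<cdot>\<^sub>m A) = c * trace_mat (A :: complex mat)"
  if "A \<in> carrier_mat n n"
  using that by (auto simp: trace_mat_def sum_distrib_left)

lemma trace_mat_one [simp]: "trace_mat (1\<^sub>m n :: complex mat) = of_nat n"
  by (simp add: trace_mat_def)

lemma mat_eq_zero_if_vanishes:
  fixes A :: "complex mat"
  assumes A: "A \<in> carrier_mat n k" and v: "\<And>v. v \<in> carrier_vec k \<Longrightarrow> A *\<^sub>v v = 0\<^sub>v n"
  shows "A = 0\<^sub>m n k"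
proof (rule eq_matI)
  fix p q assume pq: "p < dim_row (0\<^sub>m n k)" "q < dim_col (0\<^sub>m n k)"
  have "col A q = A *\<^sub>v unit_vec k q" using A pq by (intro eq_vecI) auto
  then have "col A q = 0\<^sub>v n" using v by simp
  moreover have "A $$ (p, q) = col A q $ p" using A pq by simp
  ultimately show "A $$ (p, q) = 0\<^sub>m n k $$ (p, q)" using pq by simp
qed (use A in auto)

text \<open>The number \<open>k\<close> is the rank. In triangular form the diagonal of an
  idempotent consists of zeros and ones, so the trace counts the ones; without any one the matrix is
  nilpotent as well as idempotent.\<close>

lemma idempotent_trace:
  fixes P :: "complex mat"
  assumes P: "P \<in> carrier_mat n n" and idem: "P * P = P"
  obtains k :: nat where "trace_mat P = of_nat k" "k = 0 \<Longrightarrow> P = 0\<^sub>m n n"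
proof -
  obtain es where es: "char_poly P = (\<Prod>a\<leftarrow>es. [:- a, 1:])"
    using char_poly_factorized[OF P] by blast
  obtain B where B: "B \<in> carrier_mat n n" "upper_triangular B" "similar_mat P B"
    using schur_decomposition_exists[OF P es] by blast
  obtain S S' where wit: "similar_mat_wit P B S S'" using B(3) unfolding similar_mat_def by blast
  then have S: "S \<in> carrier_mat n n" "S' \<in> carrier_mat n n" "S * S' = 1\<^sub>m n" "S' * S = 1\<^sub>m n"
      "P = S * B * S'"
    using P unfolding similar_mat_wit_def Let_def by auto
  have "S' * (P * P) * S = S' * P * S" using idem by simp
  have BP: "B = S' * P * S"
  proof -
    have "S' * P * S = (S' * S) * B * (S' * S)" unfolding S(5)
      using S(1,2) B(1) by (simp add: assoc_mult_mat[of _ n n _ n _ n])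
    then show ?thesis using S B by simp
  qed
  have "B * B = S' * P * (S * S') * P * S" unfolding BP
    using S(1,2) P by (simp add: assoc_mult_mat[of _ n n _ n _ n])
  also have "\<dots> = S' * (P * P) * S" using S P
    by (simp add: assoc_mult_mat[of _ n n _ n _ n])
  finally have BB: "B * B = B" using idem BP by simp
  have low: "B $$ (i, j) = 0" if "j < i" "i < n" for i j
    using B(1,2) that by (auto simp: upper_triangular_def)
  have Bij: "B $$ (i, j) = (\<Sum>r<n. B $$ (i, r) * B $$ (r, j))" if "i < n" "j < n" for i j
    using mat_mult_index[OF B(1) B(1) that] BB by simp
  have diag: "B $$ (i, i) = 0 \<or> B $$ (i, i) = 1" if "i < n" for i
  proof -
    have "B $$ (i, i) = (\<Sum>r<n. B $$ (i, r) * B $$ (r, i))" by (rule Bij[OF that that])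
    also have "\<dots> = (\<Sum>r\<in>{i}. B $$ (i, r) * B $$ (r, i))"
      using that low by (intro sum.mono_neutral_right) (auto, metis linorder_neqE_nat)
    finally show ?thesis by auto
  qed
  let ?D = "{i. i < n \<and> B $$ (i, i) = 1}"
  have "trace_mat P = trace_mat B"
  proof -
    have "trace_mat P = trace_mat (S * (B * S'))" using S B by (simp add: assoc_mult_mat[of _ n n _ n _ n])
    also have "\<dots> = trace_mat (B * S' * S)" using S B by (intro trace_mat_mult_comm) auto
    also have "\<dots> = trace_mat B" using S B by (simp add: assoc_mult_mat[of _ n n _ n _ n])
    finally show ?thesis .
  qed
  also have "\<dots> = (\<Sum>i<n. if B $$ (i, i) = 1 then 1 else 0)"
    unfolding trace_mat_def using B(1) by (intro sum.cong) (auto dest: diag)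
  also have "\<dots> = of_nat (card ?D)"
    by (simp add: sum.If_cases lessThan_def Int_def conj_commute)
  finally have tr: "trace_mat P = of_nat (card ?D)" .
  show thesis
  proof (rule that[OF tr])
    assume "card ?D = 0"
    then have d0: "B $$ (i, i) = 0" if "i < n" for i using diag[OF that] that by auto
    \<comment> \<open>Induction on the distance from the diagonal: in \<open>B = B * B\<close> every
      summand has a factor on the diagonal, below it, or strictly nearer to it than
      \<open>(i, j)\<close>. Truncated subtraction lets \<open>t = 0\<close> cover the entries below
      the diagonal too.\<close>
    have "\<forall>i j. i < n \<longrightarrow> j < n \<longrightarrow> j - i = t \<longrightarrow> B $$ (i, j) = 0" for t
    proof (induction t rule: less_induct)
      case (less t)
      show ?case
      proof (intro allI impI)
        fix i j assume ij: "i < n" "j < n" "j - i = t"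
        have "B $$ (i, r) * B $$ (r, j) = 0" if "r < n" for r
        proof (cases "i < r \<and> r < j")
          case True
          then have "r - i < t" using ij by auto
          then show ?thesis using less[of "r - i"] ij that by auto
        next
          case False
          then show ?thesis using low[of r i] low[of j r] d0 ij that
            by (metis linorder_neqE_nat mult_eq_0_iff)
        qed
        then show "B $$ (i, j) = 0" using Bij[OF ij(1,2)] by (simp add: sum.neutral)
      qed
    qed
    then have "B = 0\<^sub>m n n" using B by (intro eq_matI) auto
    then show "P = 0\<^sub>m n n" using S by simp
  qed
qed

lemma idempotent_trace_zero:
  fixes P :: "complex mat"
  assumes "P \<in> carrier_mat n n" "P * P = P" "trace_mat P = 0"
  shows "P = 0\<^sub>m n n"
  by (rule idempotent_trace[OF assms(1,2)]) (use assms(3) in simp)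

section \<open>Representations and intertwiners\<close>

lemma GL_carrierD: "g \<in> carrier (GL n) \<Longrightarrow> g \<in> carrier_mat n n"
  and GL_mult [simp]: "g \<otimes>\<^bsub>GL n\<^esub> h = g * h"
  and GL_one [simp]: "\<one>\<^bsub>GL n\<^esub> = 1\<^sub>m n"
  by (auto simp: GL_def units_of_def Units_def ring_mat_def)

lemma GL_carrier_iff:
  "g \<in> carrier (GL n) \<longleftrightarrow> g \<in> carrier_mat n n \<and> (\<exists>h\<in>carrier_mat n n. h * g = 1\<^sub>m n \<and> g * h = 1\<^sub>m n)"
  by (auto simp: GL_def units_of_def Units_def ring_mat_def)

lemma GL_group: "group (GL n)"
proof -
  interpret ring "ring_mat TYPE(complex) n ()" by (rule ring_mat)
  show ?thesis unfolding GL_def by (rule units_group)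
qed

lemma is_rep_group: "is_rep G d \<rho> \<Longrightarrow> group G"
  by (simp add: is_rep_def)

lemma is_rep_GL: "is_rep G d \<rho> \<Longrightarrow> g \<in> carrier G \<Longrightarrow> \<rho> g \<in> carrier (GL d)"
  by (auto simp: is_rep_def hom_def)

lemma is_rep_carrier: "is_rep G d \<rho> \<Longrightarrow> g \<in> carrier G \<Longrightarrow> \<rho> g \<in> carrier_mat d d"
  by (auto dest: is_rep_GL GL_carrierD)

lemma is_rep_mult:
  "is_rep G d \<rho> \<Longrightarrow> g \<in> carrier G \<Longrightarrow> h \<in> carrier G \<Longrightarrow> \<rho> (g \<otimes>\<^bsub>G\<^esub> h) = \<rho> g * \<rho> h"
  by (auto simp: is_rep_def hom_def)

lemma is_rep_one:
  assumes "is_rep G d \<rho>" shows "\<rho> \<one>\<^bsub>G\<^esub> = 1\<^sub>m d"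
proof -
  interpret group_hom G "GL d" \<rho>
    using assms GL_group by (simp add: is_rep_def group_hom_def group_hom_axioms_def)
  show ?thesis using hom_one by simp
qed

lemma is_rep_inv:
  assumes "is_rep G d \<rho>" "g \<in> carrier G"
  shows "\<rho> g * \<rho> (inv\<^bsub>G\<^esub> g) = 1\<^sub>m d" "\<rho> (inv\<^bsub>G\<^esub> g) * \<rho> g = 1\<^sub>m d"
proof -
  interpret group G using assms is_rep_group by auto
  show "\<rho> g * \<rho> (inv\<^bsub>G\<^esub> g) = 1\<^sub>m d" "\<rho> (inv\<^bsub>G\<^esub> g) * \<rho> g = 1\<^sub>m d"
    using is_rep_mult[OF assms(1), of g "inv\<^bsub>G\<^esub> g"] is_rep_mult[OF assms(1), of "inv\<^bsub>G\<^esub> g" g]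
      is_rep_one[OF assms(1)] assms(2) by auto
qed

text \<open>Exposes the degree, which \<open>irreducible_rep\<close> hides behind an existential
  quantifier; the sizes of intertwiners depend on it.\<close>

definition irrep :: "('g, 'b) monoid_scheme \<Rightarrow> nat \<Rightarrow> ('g \<Rightarrow> complex mat) \<Rightarrow> bool" where
  "irrep G d \<rho> \<longleftrightarrow> d > 0 \<and> is_rep G d \<rho> \<and>
     (\<forall>U. VectorSpace.subspace class_ring U (module_vec TYPE(complex) d) \<and>
          (\<forall>g\<in>carrier G. \<forall>u\<in>U. \<rho> g *\<^sub>v u \<in> U)
        \<longrightarrow> U = {0\<^sub>v d} \<or> U = carrier_vec d)"

lemma irreducible_rep_iff: "irreducible_rep G \<rho> \<longleftrightarrow> (\<exists>d. irrep G d \<rho>)"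
  by (auto simp: irreducible_rep_def irrep_def)

lemma irrep_rep: "irrep G d \<rho> \<Longrightarrow> is_rep G d \<rho>"
  and irrep_pos: "irrep G d \<rho> \<Longrightarrow> d > 0"
  by (auto simp: irrep_def)

lemma subspaceI:
  assumes "U \<subseteq> carrier_vec d" "0\<^sub>v d \<in> U" "\<And>u v. u \<in> U \<Longrightarrow> v \<in> U \<Longrightarrow> u + v \<in> U"
    "\<And>c u. u \<in> U \<Longrightarrow> (c :: complex) \<cdot>\<^sub>v u \<in> U"
  shows "VectorSpace.subspace class_ring U (module_vec TYPE(complex) d)"
proof -
  interpret vec_space "TYPE(complex)" d .
  show ?thesis unfolding VectorSpace.subspace_def
    using assms vec_vs[of d] vec_module[of d] by (auto simp: submodule_def module_vec_simps)
qed

lemma irrep_cases: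
  assumes "irrep G d \<rho>" "U \<subseteq> carrier_vec d" "0\<^sub>v d \<in> U" "\<And>u v. u \<in> U \<Longrightarrow> v \<in> U \<Longrightarrow> u + v \<in> U"
    "\<And>c u. u \<in> U \<Longrightarrow> (c :: complex) \<cdot>\<^sub>v u \<in> U"
    "\<And>g u. g \<in> carrier G \<Longrightarrow> u \<in> U \<Longrightarrow> \<rho> g *\<^sub>v u \<in> U"
  shows "U = {0\<^sub>v d} \<or> U = carrier_vec d"
  using assms(1,6) subspaceI[OF assms(2-5)] unfolding irrep_def by blast

section \<open>Intertwiners and Schur's lemma\<close>

definition intertwiner ::
    "('g, 'b) monoid_scheme \<Rightarrow> nat \<Rightarrow> ('g \<Rightarrow> complex mat) \<Rightarrow> nat \<Rightarrow> ('g \<Rightarrow> complex mat) \<Rightarrow> complex mat \<Rightarrow> bool" where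
  "intertwiner G d \<rho> e \<sigma> A \<longleftrightarrow> A \<in> carrier_mat e d \<and> (\<forall>g\<in>carrier G. A * \<rho> g = \<sigma> g * A)"

lemma intertwinerD:
  "intertwiner G d \<rho> e \<sigma> A \<Longrightarrow> A \<in> carrier_mat e d"
  "intertwiner G d \<rho> e \<sigma> A \<Longrightarrow> g \<in> carrier G \<Longrightarrow> A * \<rho> g = \<sigma> g * A"
  by (auto simp: intertwiner_def)

lemma intertwiner_mult:
  assumes A: "intertwiner G d \<rho> e \<sigma> A" and B: "intertwiner G e \<sigma> f \<tau> B"
    and "\<And>g. g \<in> carrier G \<Longrightarrow> \<rho> g \<in> carrier_mat d d"
    and "\<And>g. g \<in> carrier G \<Longrightarrow> \<sigma> g \<in> carrier_mat e e"
    and "\<And>g. g \<in> carrier G \<Longrightarrow> \<tau> g \<in> carrier_mat f f"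
  shows "intertwiner G d \<rho> f \<tau> (B * A)"
  unfolding intertwiner_def
proof (intro conjI ballI)
  note c = intertwinerD(1)[OF A] intertwinerD(1)[OF B]
  show "B * A \<in> carrier_mat f d" using c by simp
  fix g assume g: "g \<in> carrier G"
  have "B * A * \<rho> g = B * (\<sigma> g * A)"
    using c assms(3)[OF g] intertwinerD(2)[OF A g] by (simp add: assoc_mult_mat)
  also have "\<dots> = \<tau> g * B * A"
    using c assms(4)[OF g] intertwinerD(2)[OF B g] by (simp add: assoc_mult_mat[symmetric])
  also have "\<dots> = \<tau> g * (B * A)" using c assms(5)[OF g] by (simp add: assoc_mult_mat)
  finally show "B * A * \<rho> g = \<tau> g * (B * A)" .
qed

lemma intertwiner_smult:
  assumes A: "intertwiner G d \<rho> e \<sigma> A"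
    and "\<And>g. g \<in> carrier G \<Longrightarrow> \<rho> g \<in> carrier_mat d d"
    and "\<And>g. g \<in> carrier G \<Longrightarrow> \<sigma> g \<in> carrier_mat e e"
  shows "intertwiner G d \<rho> e \<sigma> (c \<cdot>\<^sub>m A)"
  unfolding intertwiner_def
proof (intro conjI ballI)
  note c = intertwinerD(1)[OF A]
  show "c \<cdot>\<^sub>m A \<in> carrier_mat e d" using c by simp
  fix g assume g: "g \<in> carrier G"
  show "(c \<cdot>\<^sub>m A) * \<rho> g = \<sigma> g * (c \<cdot>\<^sub>m A)"
    using mult_smult_assoc_mat[OF c assms(2)[OF g]] mult_smult_distrib[OF assms(3)[OF g] c]
      intertwinerD(2)[OF A g] by simp
qed

lemma intertwiner_minus:
  assumes A: "intertwiner G d \<rho> e \<sigma> A" and B: "intertwiner G d \<rho> e \<sigma> B"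
    and r: "\<And>g. g \<in> carrier G \<Longrightarrow> \<rho> g \<in> carrier_mat d d"
    and s: "\<And>g. g \<in> carrier G \<Longrightarrow> \<sigma> g \<in> carrier_mat e e"
  shows "intertwiner G d \<rho> e \<sigma> (A - B)"
  unfolding intertwiner_def
proof (intro conjI ballI)
  note c = intertwinerD(1)[OF A] intertwinerD(1)[OF B]
  show "A - B \<in> carrier_mat e d" using c by (intro minus_carrier_mat)
  fix g assume g: "g \<in> carrier G"
  show "(A - B) * \<rho> g = \<sigma> g * (A - B)"
    using minus_mult_distrib_mat[OF c r[OF g]] mult_minus_distrib_mat[OF s[OF g] c]
      intertwinerD(2)[OF A g] intertwinerD(2)[OF B g] by simp
qed

text \<open>First half of Schur's lemma: the kernel of \<open>A\<close> is an invariant subspace,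
  and it is not everything because \<open>A\<close> is not zero.\<close>

lemma irrep_intertwiner_injective:
  assumes V: "irrep G d \<rho>" and A: "intertwiner G d \<rho> e \<sigma> A"
    and s: "\<And>g. g \<in> carrier G \<Longrightarrow> \<sigma> g \<in> carrier_mat e e"
    and nz: "A \<noteq> 0\<^sub>m e d" and v: "v \<in> carrier_vec d" "A *\<^sub>v v = 0\<^sub>v e"
  shows "v = 0\<^sub>v d"
proof -
  let ?U = "mat_kernel A"
  note Ac = intertwinerD(1)[OF A]
  note U = mat_kernel[OF Ac]
  have "?U = {0\<^sub>v d} \<or> ?U = carrier_vec d"
  proof (rule irrep_cases[OF V])
    show "0\<^sub>v d \<in> ?U" using Ac by (auto simp: U)
    show "u + w \<in> ?U" if "u \<in> ?U" "w \<in> ?U" for u w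
      using that Ac by (auto simp: U mult_add_distrib_mat_vec)
    show "c \<cdot>\<^sub>v u \<in> ?U" if "u \<in> ?U" for c u using mat_kernel_smult[OF Ac that] .
    show "\<rho> g *\<^sub>v u \<in> ?U" if g: "g \<in> carrier G" and u: "u \<in> ?U" for g u
    proof -
      note rc = is_rep_carrier[OF irrep_rep[OF V] g]
      have uc: "u \<in> carrier_vec d" and u0: "A *\<^sub>v u = 0\<^sub>v e" using u by (auto simp: U)
      have "A *\<^sub>v (\<rho> g *\<^sub>v u) = (A * \<rho> g) *\<^sub>v u"
        using assoc_mult_mat_vec[OF Ac rc uc] by simp
      also have "\<dots> = \<sigma> g *\<^sub>v (A *\<^sub>v u)"
        using assoc_mult_mat_vec[OF s[OF g] Ac uc] intertwinerD(2)[OF A g] by simp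
      also have "\<dots> = 0\<^sub>v e" using u0 s[OF g] by auto
      finally show ?thesis using rc uc by (auto simp: U)
    qed
  qed (use U in auto)
  moreover have "?U \<noteq> carrier_vec d"
    using nz mat_eq_zero_if_vanishes[OF Ac] U by auto
  ultimately show ?thesis using v U by auto
qed

text \<open>Second half of Schur's lemma: \<open>A\<close> has an eigenvalue since the degree is
  positive, and subtracting it gives an intertwiner that kills an eigenvector, hence is
  zero.\<close>

lemma irrep_self_intertwiner_scalar:
  assumes V: "irrep G d \<rho>" and A: "intertwiner G d \<rho> d \<rho> A"
  obtains c where "A = c \<cdot>\<^sub>m 1\<^sub>m d"
proof -
  note Ac = intertwinerD(1)[OF A]
  note r = is_rep_carrier[OF irrep_rep[OF V]]
  obtain es where es: "char_poly A = (\<Prod>a\<leftarrow>es. [:- a, 1:])" "length es = d"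
    using char_poly_factorized[OF Ac] by blast
  with irrep_pos[OF V] obtain c where "c \<in> set es" by (cases es) auto
  then have "poly (char_poly A) c = 0" unfolding es(1) by (auto simp: poly_prod_list prod_list_zero_iff)
  then have "eigenvalue A c" using eigenvalue_root_char_poly[OF Ac] by simp
  then obtain v where v: "v \<in> carrier_vec d" "v \<noteq> 0\<^sub>v d" "A *\<^sub>v v = c \<cdot>\<^sub>v v"
    using Ac unfolding eigenvalue_def eigenvector_def by auto
  have one: "intertwiner G d \<rho> d \<rho> (c \<cdot>\<^sub>m 1\<^sub>m d)"
  proof (rule intertwiner_smult)
    show "intertwiner G d \<rho> d \<rho> (1\<^sub>m d)"
      using r by (auto simp: intertwiner_def left_mult_one_mat[OF r] right_mult_one_mat[OF r])
  qed (use r in auto)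
  have int: "intertwiner G d \<rho> d \<rho> (A - c \<cdot>\<^sub>m 1\<^sub>m d)"
    by (rule intertwiner_minus[OF A one r r])
  have "(A - c \<cdot>\<^sub>m 1\<^sub>m d) *\<^sub>v v = A *\<^sub>v v - (c \<cdot>\<^sub>m 1\<^sub>m d) *\<^sub>v v"
    using Ac v(1) by (simp add: minus_mult_distrib_mat_vec)
  also have "(c \<cdot>\<^sub>m 1\<^sub>m d) *\<^sub>v v = c \<cdot>\<^sub>v v"
    using v(1) by (intro eq_vecI) auto
  finally have "(A - c \<cdot>\<^sub>m 1\<^sub>m d) *\<^sub>v v = 0\<^sub>v d" using v by auto
  then have "A - c \<cdot>\<^sub>m 1\<^sub>m d = 0\<^sub>m d d"
    using irrep_intertwiner_injective[OF V int r _ v(1)] v(2) by auto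
  then have "A = c \<cdot>\<^sub>m 1\<^sub>m d"
  proof -
    assume eq: "A - c \<cdot>\<^sub>m 1\<^sub>m d = 0\<^sub>m d d"
    show ?thesis
    proof (rule eq_matI)
      fix i j assume ij: "i < dim_row (c \<cdot>\<^sub>m 1\<^sub>m d)" "j < dim_col (c \<cdot>\<^sub>m 1\<^sub>m d)"
      have "(A - c \<cdot>\<^sub>m 1\<^sub>m d) $$ (i, j) = 0" using ij eq by simp
      then show "A $$ (i, j) = (c \<cdot>\<^sub>m 1\<^sub>m d) $$ (i, j)" using ij Ac by auto
    qed (use Ac in auto)
  qed
  then show ?thesis by (rule that)
qed

text \<open>Left translation by \<open>h\<close> only permutes the summands, and the factor
  \<open>\<rho> h\<close> on the right cancels the one that translation creates.\<close>

lemma average_intertwiner: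
  assumes R: "is_rep G d \<rho>" and S: "is_rep G e \<sigma>" and X: "X \<in> carrier_mat e d"
  shows "intertwiner G d \<rho> e \<sigma> (mat_sum e d (carrier G) (\<lambda>g. \<sigma> g * X * \<rho> (inv\<^bsub>G\<^esub> g)))"
    (is "intertwiner G d \<rho> e \<sigma> ?A")
  unfolding intertwiner_def
proof (intro conjI ballI)
  interpret group G using R is_rep_group by auto
  note r = is_rep_carrier[OF R] and s = is_rep_carrier[OF S]
  fix h assume h: "h \<in> carrier G"
  have c: "\<sigma> g * X * \<rho> (inv\<^bsub>G\<^esub> g) \<in> carrier_mat e d" if "g \<in> carrier G" for g
    using that r[of "inv\<^bsub>G\<^esub> g"] s[OF that] X by auto
  have "?A * \<rho> h = mat_sum e d (carrier G) (\<lambda>g. \<sigma> g * X * \<rho> (inv\<^bsub>G\<^esub> g) * \<rho> h)"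
    by (rule mat_sum_mult[OF r[OF h] c])
  also have "\<dots> = mat_sum e d (carrier G) (\<lambda>g. \<sigma> h * (\<sigma> g * X * \<rho> (inv\<^bsub>G\<^esub> g)))"
  proof (rule eq_matI)
    fix p q assume "p < dim_row (mat_sum e d (carrier G) (\<lambda>g. \<sigma> h * (\<sigma> g * X * \<rho> (inv\<^bsub>G\<^esub> g))))"
      "q < dim_col (mat_sum e d (carrier G) (\<lambda>g. \<sigma> h * (\<sigma> g * X * \<rho> (inv\<^bsub>G\<^esub> g))))"
    then have pq: "p < e" "q < d" by auto
    have "(\<Sum>g\<in>carrier G. (\<sigma> g * X * \<rho> (inv\<^bsub>G\<^esub> g) * \<rho> h) $$ (p, q))
      = (\<Sum>g\<in>carrier G. (\<sigma> (h \<otimes>\<^bsub>G\<^esub> g) * X * \<rho> (inv\<^bsub>G\<^esub> (h \<otimes>\<^bsub>G\<^esub> g)) * \<rho> h) $$ (p, q))"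
    proof (rule sum.reindex_bij_witness[of _ "\<lambda>g. h \<otimes>\<^bsub>G\<^esub> g" "\<lambda>g. inv\<^bsub>G\<^esub> h \<otimes>\<^bsub>G\<^esub> g"])
      fix g assume "g \<in> carrier G"
      then show "h \<otimes>\<^bsub>G\<^esub> (inv\<^bsub>G\<^esub> h \<otimes>\<^bsub>G\<^esub> g) = g" "inv\<^bsub>G\<^esub> h \<otimes>\<^bsub>G\<^esub> (h \<otimes>\<^bsub>G\<^esub> g) = g"
        using h by (simp_all add: m_assoc[symmetric])
      then show "(\<sigma> (h \<otimes>\<^bsub>G\<^esub> (inv\<^bsub>G\<^esub> h \<otimes>\<^bsub>G\<^esub> g)) * X * \<rho> (inv\<^bsub>G\<^esub> (h \<otimes>\<^bsub>G\<^esub> (inv\<^bsub>G\<^esub> h \<otimes>\<^bsub>G\<^esub> g))) * \<rho> h) $$ (p, q)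
        = (\<sigma> g * X * \<rho> (inv\<^bsub>G\<^esub> g) * \<rho> h) $$ (p, q)" by simp
    qed (use h in auto)
    also have "\<dots> = (\<Sum>g\<in>carrier G. (\<sigma> h * (\<sigma> g * X * \<rho> (inv\<^bsub>G\<^esub> g))) $$ (p, q))"
    proof (intro sum.cong refl)
      fix g assume g: "g \<in> carrier G"
      have "\<sigma> (h \<otimes>\<^bsub>G\<^esub> g) * X * \<rho> (inv\<^bsub>G\<^esub> (h \<otimes>\<^bsub>G\<^esub> g)) * \<rho> h
        = \<sigma> h * \<sigma> g * X * (\<rho> (inv\<^bsub>G\<^esub> g) * (\<rho> (inv\<^bsub>G\<^esub> h) * \<rho> h))"
        using g h X by (simp add: inv_mult_group is_rep_mult[OF R] is_rep_mult[OF S]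
            carrier_matD[OF r] carrier_matD[OF s] mat_assoc)
      also have "\<dots> = \<sigma> h * (\<sigma> g * X * \<rho> (inv\<^bsub>G\<^esub> g))"
        using g h X is_rep_inv(2)[OF R h] r[of "inv\<^bsub>G\<^esub> g"]
        by (simp add: carrier_matD[OF r] carrier_matD[OF s] mat_assoc)
      finally show "(\<sigma> (h \<otimes>\<^bsub>G\<^esub> g) * X * \<rho> (inv\<^bsub>G\<^esub> (h \<otimes>\<^bsub>G\<^esub> g)) * \<rho> h) $$ (p, q)
        = (\<sigma> h * (\<sigma> g * X * \<rho> (inv\<^bsub>G\<^esub> g))) $$ (p, q)" by simp
    qed
    finally show "mat_sum e d (carrier G) (\<lambda>g. \<sigma> g * X * \<rho> (inv\<^bsub>G\<^esub> g) * \<rho> h) $$ (p, q)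
      = mat_sum e d (carrier G) (\<lambda>g. \<sigma> h * (\<sigma> g * X * \<rho> (inv\<^bsub>G\<^esub> g))) $$ (p, q)" using pq by simp
  qed auto
  also have "\<dots> = \<sigma> h * ?A"
    by (rule mult_mat_sum[OF s[OF h] c, symmetric])
  finally show "?A * \<rho> h = \<sigma> h * ?A" .
qed simp

lemma trace_conjugate_rep:
  assumes R: "is_rep G d \<rho>" and g: "g \<in> carrier G" and Y: "Y \<in> carrier_mat d d"
  shows "trace_mat (\<rho> g * Y * \<rho> (inv\<^bsub>G\<^esub> g)) = trace_mat Y"
proof -
  interpret group G using R is_rep_group by auto
  note r = is_rep_carrier[OF R g] is_rep_carrier[OF R inv_closed[OF g]]
  have "trace_mat (\<rho> g * (Y * \<rho> (inv\<^bsub>G\<^esub> g))) = trace_mat (Y * \<rho> (inv\<^bsub>G\<^esub> g) * \<rho> g)"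
    using r Y by (intro trace_mat_mult_comm) auto
  then show ?thesis using r Y is_rep_inv[OF R g] by (simp add: mat_assoc)
qed

text \<open>The matrix unit \<open>X\<close> makes the trace read off one chosen entry of
  \<open>f\<close>; averaging \<open>X\<close> then yields an intertwiner whose product with
  \<open>f\<close> has a known nonzero trace.\<close>

lemma unit_mat_trace:
  fixes f :: "complex mat"
  assumes f: "f \<in> carrier_mat e d" and pq: "p < e" "q < d"
  defines "X \<equiv> mat d e (\<lambda>(i, j). if i = q \<and> j = p then 1 else 0)"
  shows "trace_mat (X * f) = f $$ (p, q)"
proof -
  have X: "X \<in> carrier_mat d e" by (simp add: X_def)
  have "trace_mat (X * f) = (\<Sum>i<d. \<Sum>r<e. X $$ (i, r) * f $$ (r, i))"
    unfolding trace_mat_def using X f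
    by (intro sum.cong) (simp_all add: mat_mult_index[OF X f] del: index_mult_mat(1))
  also have "\<dots> = (\<Sum>i<d. \<Sum>r<e. if r = p then (if i = q then f $$ (r, i) else 0) else 0)"
    by (intro sum.cong refl) (simp add: X_def)
  also have "\<dots> = f $$ (p, q)" using pq by simp
  finally show ?thesis .
qed

lemma nonzero_matE:
  assumes "A \<in> carrier_mat n k" "A \<noteq> 0\<^sub>m n k"
  obtains p q where "p < n" "q < k" "A $$ (p, q) \<noteq> 0"
proof -
  have "\<exists>p q. p < n \<and> q < k \<and> A $$ (p, q) \<noteq> 0"
  proof (rule ccontr)
    assume "\<not> ?thesis"
    then have "A = 0\<^sub>m n k" using assms(1) by (intro eq_matI) auto
    with assms(2) show False by simp
  qed
  then show thesis using that by blast
qed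

text \<open>Averaging a matrix unit and taking the trace shows that the resulting scalar does not vanish.\<close>

lemma irrep_retraction:
  assumes fin: "finite (carrier G)" and V: "irrep G d \<rho>" and T: "is_rep G e \<sigma>"
    and f: "intertwiner G d \<rho> e \<sigma> f" and nz: "f \<noteq> 0\<^sub>m e d"
  obtains h where "intertwiner G e \<sigma> d \<rho> h" "h * f = 1\<^sub>m d"
proof -
  note R = irrep_rep[OF V]
  interpret group G using R is_rep_group by auto
  note r = is_rep_carrier[OF R] and s = is_rep_carrier[OF T] and fc = intertwinerD(1)[OF f]
  obtain p q where pq: "p < e" "q < d" "f $$ (p, q) \<noteq> 0" using nonzero_matE[OF fc nz] .
  define X :: "complex mat" where "X = mat d e (\<lambda>(i, j). if i = q \<and> j = p then 1 else 0)"
  have X: "X \<in> carrier_mat d e" by (simp add: X_def)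
  have tr: "trace_mat (X * f) = f $$ (p, q)" unfolding X_def by (rule unit_mat_trace[OF fc pq(1,2)])
  define h where "h = mat_sum d e (carrier G) (\<lambda>g. \<rho> g * X * \<sigma> (inv\<^bsub>G\<^esub> g))"
  have h: "intertwiner G e \<sigma> d \<rho> h" unfolding h_def by (rule average_intertwiner[OF T R X])
  have hf: "intertwiner G d \<rho> d \<rho> (h * f)" by (rule intertwiner_mult[OF f h r s r])
  obtain c where c: "h * f = c \<cdot>\<^sub>m 1\<^sub>m d" using irrep_self_intertwiner_scalar[OF V hf] .
  have "h * f = mat_sum d d (carrier G) (\<lambda>g. \<rho> g * X * \<sigma> (inv\<^bsub>G\<^esub> g) * f)"
    unfolding h_def by (rule mat_sum_mult[OF fc mult_carrier_mat[OF mult_carrier_mat[OF r X] s]]) auto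
  also have "\<dots> = mat_sum d d (carrier G) (\<lambda>g. \<rho> g * (X * f) * \<rho> (inv\<^bsub>G\<^esub> g))"
    using X fc by (intro mat_sum_cong refl)
      (simp add: carrier_matD[OF r] carrier_matD[OF s] mat_assoc intertwinerD(2)[OF f])
  finally have "trace_mat (h * f) = (\<Sum>g\<in>carrier G. trace_mat (\<rho> g * (X * f) * \<rho> (inv\<^bsub>G\<^esub> g)))"
    by (simp add: trace_mat_sum mult_carrier_mat[OF mult_carrier_mat[OF r mult_carrier_mat[OF X fc]] r])
  also have "\<dots> = of_nat (card (carrier G)) * f $$ (p, q)"
    using X fc tr by (simp add: trace_conjugate_rep[OF R])
  finally have "c * of_nat d = of_nat (card (carrier G)) * f $$ (p, q)"
    unfolding c by (simp add: trace_mat_smult[OF one_carrier_mat])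
  moreover have "card (carrier G) \<noteq> 0" using fin by auto
  ultimately have c0: "c \<noteq> 0" using pq(3) by auto
  show thesis
  proof (rule that)
    show "intertwiner G e \<sigma> d \<rho> ((1 / c) \<cdot>\<^sub>m h)" by (rule intertwiner_smult[OF h s r])
    show "(1 / c) \<cdot>\<^sub>m h * f = 1\<^sub>m d"
      unfolding mult_smult_assoc_mat[OF intertwinerD(1)[OF h] fc] c
      by (rule eq_matI) (use c0 in auto)
  qed
qed

text \<open>The mirror image of \<open>irrep_retraction\<close>: the averaged matrix unit now stands
  to the right of the given map.\<close>

lemma irrep_section:
  assumes fin: "finite (carrier G)" and V: "irrep G d \<rho>" and T: "is_rep G e \<sigma>"
    and h: "intertwiner G e \<sigma> d \<rho> h" and nz: "h \<noteq> 0\<^sub>m d e"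
  obtains f where "intertwiner G d \<rho> e \<sigma> f" "h * f = 1\<^sub>m d"
proof -
  note R = irrep_rep[OF V]
  interpret group G using R is_rep_group by auto
  note r = is_rep_carrier[OF R] and s = is_rep_carrier[OF T] and hc = intertwinerD(1)[OF h]
  obtain p q where pq: "p < d" "q < e" "h $$ (p, q) \<noteq> 0" using nonzero_matE[OF hc nz] .
  define X :: "complex mat" where "X = mat e d (\<lambda>(i, j). if i = q \<and> j = p then 1 else 0)"
  have X: "X \<in> carrier_mat e d" by (simp add: X_def)
  have tr: "trace_mat (h * X) = h $$ (p, q)"
    using trace_mat_mult_comm[OF hc X] unit_mat_trace[OF hc pq(1,2)] by (simp add: X_def)
  define f where "f = mat_sum e d (carrier G) (\<lambda>g. \<sigma> g * X * \<rho> (inv\<^bsub>G\<^esub> g))"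
  have f: "intertwiner G d \<rho> e \<sigma> f" unfolding f_def by (rule average_intertwiner[OF R T X])
  have hf: "intertwiner G d \<rho> d \<rho> (h * f)" by (rule intertwiner_mult[OF f h r s r])
  obtain c where c: "h * f = c \<cdot>\<^sub>m 1\<^sub>m d" using irrep_self_intertwiner_scalar[OF V hf] .
  have "h * f = mat_sum d d (carrier G) (\<lambda>g. h * (\<sigma> g * X * \<rho> (inv\<^bsub>G\<^esub> g)))"
    unfolding f_def by (rule mult_mat_sum[OF hc mult_carrier_mat[OF mult_carrier_mat[OF s X] r]]) auto
  also have "\<dots> = mat_sum d d (carrier G) (\<lambda>g. \<rho> g * (h * X) * \<rho> (inv\<^bsub>G\<^esub> g))"
    using X hc by (intro mat_sum_cong refl)
      (simp add: carrier_matD[OF r] carrier_matD[OF s] mat_assoc[symmetric] intertwinerD(2)[OF h])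
  finally have "trace_mat (h * f) = (\<Sum>g\<in>carrier G. trace_mat (\<rho> g * (h * X) * \<rho> (inv\<^bsub>G\<^esub> g)))"
    by (simp add: trace_mat_sum mult_carrier_mat[OF mult_carrier_mat[OF r mult_carrier_mat[OF hc X]] r])
  also have "\<dots> = of_nat (card (carrier G)) * h $$ (p, q)"
    using X hc tr by (simp add: trace_conjugate_rep[OF R])
  finally have "c * of_nat d = of_nat (card (carrier G)) * h $$ (p, q)"
    unfolding c by (simp add: trace_mat_smult[OF one_carrier_mat])
  moreover have "card (carrier G) \<noteq> 0" using fin by auto
  ultimately have c0: "c \<noteq> 0" using pq(3) by auto
  show thesis
  proof (rule that)
    show "intertwiner G d \<rho> e \<sigma> ((1 / c) \<cdot>\<^sub>m f)" by (rule intertwiner_smult[OF f r s])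
    show "h * ((1 / c) \<cdot>\<^sub>m f) = 1\<^sub>m d"
      unfolding mult_smult_distrib[OF hc intertwinerD(1)[OF f]] c
      by (rule eq_matI) (use c0 in auto)
  qed
qed

section \<open>Isotypic components\<close>

definition isotypic_proj :: "nat \<Rightarrow> nat \<Rightarrow> (nat \<Rightarrow> complex mat) \<Rightarrow> (nat \<Rightarrow> complex mat) \<Rightarrow> complex mat" where
  "isotypic_proj e k f h = mat_sum e e {..<k} (\<lambda>i. f i * h i)"

lemma isotypic_proj_carrier [simp]: "isotypic_proj e k f h \<in> carrier_mat e e"
  and isotypic_proj_dim [simp]: "dim_row (isotypic_proj e k f h) = e" "dim_col (isotypic_proj e k f h) = e"
  by (auto simp: isotypic_proj_def)

text \<open>The \<open>f i\<close> and \<open>h i\<close> are dual bases of the two multiplicity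
  spaces, the intertwiners into and out of \<open>\<sigma>\<close>, and \<open>k\<close> is the
  multiplicity. That they span is expressed by the last two clauses: the idempotent built from them
  fixes every intertwiner.\<close>

definition isotypic ::
    "('g, 'b) monoid_scheme \<Rightarrow> nat \<Rightarrow> ('g \<Rightarrow> complex mat) \<Rightarrow> nat \<Rightarrow> ('g \<Rightarrow> complex mat) \<Rightarrow>
      nat \<Rightarrow> (nat \<Rightarrow> complex mat) \<Rightarrow> (nat \<Rightarrow> complex mat) \<Rightarrow> bool" where
  "isotypic G d \<rho> e \<sigma> k f h \<longleftrightarrow>
     (\<forall>i<k. intertwiner G d \<rho> e \<sigma> (f i) \<and> intertwiner G e \<sigma> d \<rho> (h i)) \<and>
     (\<forall>i<k. \<forall>j<k. h i * f j = (if i = j then 1\<^sub>m d else 0\<^sub>m d d)) \<and>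
     (\<forall>\<phi>. intertwiner G d \<rho> e \<sigma> \<phi> \<longrightarrow> isotypic_proj e k f h * \<phi> = \<phi>) \<and>
     (\<forall>\<psi>. intertwiner G e \<sigma> d \<rho> \<psi> \<longrightarrow> \<psi> * isotypic_proj e k f h = \<psi>)"

text \<open>Induction on the rank \<open>t\<close> of \<open>P\<close>. As long as the image of
  \<open>P\<close> contains a copy of the irreducible representation, a retraction splits it off and
  the rank drops by \<open>d\<close>. Subrepresentations are represented by idempotents throughout,
  so that all matrices keep their size.\<close>

lemma isotypic_below_idempotent:
  assumes fin: "finite (carrier G)" and V: "irrep G d \<rho>" and T: "is_rep G e \<sigma>"
    and "intertwiner G e \<sigma> e \<sigma> P" "P * P = P" "trace_mat P = of_nat t"
  shows "\<exists>k f h. (\<forall>i<k. intertwiner G d \<rho> e \<sigma> (f i) \<and> intertwiner G e \<sigma> d \<rho> (h i) \<and>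
        P * f i = f i \<and> h i * P = h i) \<and>
      (\<forall>i<k. \<forall>j<k. h i * f j = (if i = j then 1\<^sub>m d else 0\<^sub>m d d)) \<and>
      (\<forall>\<phi>. intertwiner G d \<rho> e \<sigma> \<phi> \<longrightarrow> P * \<phi> = \<phi> \<longrightarrow> isotypic_proj e k f h * \<phi> = \<phi>)"
  using assms(4-6)
proof (induction t arbitrary: P rule: less_induct)
  case (less t)
  note R = irrep_rep[OF V]
  note r = is_rep_carrier[OF R] and s = is_rep_carrier[OF T]
  note P = less.prems(1) and Pc = intertwinerD(1)[OF less.prems(1)]
  show ?case
  proof (cases "\<exists>\<phi>. intertwiner G d \<rho> e \<sigma> \<phi> \<and> P * \<phi> = \<phi> \<and> \<phi> \<noteq> 0\<^sub>m e d")
    case False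
    show ?thesis
      by (rule exI[of _ 0]) (use False in \<open>auto simp: isotypic_proj_def intertwiner_def\<close>)
  next
    case True
    then obtain \<phi> where \<phi>: "intertwiner G d \<rho> e \<sigma> \<phi>" "P * \<phi> = \<phi>" "\<phi> \<noteq> 0\<^sub>m e d" by blast
    obtain h0 where h0: "intertwiner G e \<sigma> d \<rho> h0" "h0 * \<phi> = 1\<^sub>m d"
      using irrep_retraction[OF fin V T \<phi>(1,3)] .
    \<comment> \<open>Composing with \<open>P\<close> makes the retraction ignore the complement of
      \<open>P\<close>, so that \<open>E\<close> below satisfies both \<open>P * E = E\<close> and
      \<open>E * P = E\<close> and can be subtracted from \<open>P\<close>.\<close>
    define \<eta> where "\<eta> = h0 * P"
    have \<eta>: "intertwiner G e \<sigma> d \<rho> \<eta>" unfolding \<eta>_def by (rule intertwiner_mult[OF P h0(1) s s r])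
    note fc = intertwinerD(1)[OF \<phi>(1)] and hc0 = intertwinerD(1)[OF h0(1)] and hc = intertwinerD(1)[OF \<eta>]
    note [simp] = carrier_matD[OF fc] carrier_matD[OF hc0] carrier_matD[OF hc] carrier_matD[OF Pc]
    have \<eta>\<phi>: "\<eta> * \<phi> = 1\<^sub>m d" unfolding \<eta>_def by (simp add: mat_assoc \<phi>(2) h0(2))
    have \<eta>P: "\<eta> * P = \<eta>" unfolding \<eta>_def by (simp add: mat_assoc less.prems(2))
    define E where "E = \<phi> * \<eta>"
    have E: "intertwiner G e \<sigma> e \<sigma> E" unfolding E_def by (rule intertwiner_mult[OF \<eta> \<phi>(1) s r s])
    note Ec = intertwinerD(1)[OF E]
    note [simp] = carrier_matD[OF Ec]
    have PE: "P * E = E" unfolding E_def by (simp add: mat_assoc[symmetric] \<phi>(2))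
    have EP: "E * P = E" unfolding E_def by (simp add: mat_assoc \<eta>P)
    have E\<phi>: "E * \<phi> = \<phi>" unfolding E_def using fc by (simp add: mat_assoc \<eta>\<phi>)
    have \<eta>E: "\<eta> * E = \<eta>" unfolding E_def using hc by (simp add: mat_assoc[symmetric] \<eta>\<phi>)
    have EE: "E * E = E" unfolding E_def
      using \<eta>E unfolding E_def by (simp add: mat_assoc)
    define P' where "P' = P - E"
    have P': "intertwiner G e \<sigma> e \<sigma> P'" unfolding P'_def by (rule intertwiner_minus[OF P E s s])
    note Pc' = intertwinerD(1)[OF P']
    note [simp] = carrier_matD[OF Pc']
    have zero: "A - A = 0\<^sub>m n k" if "A \<in> carrier_mat n k" for A :: "complex mat" and n k
      using that by (rule minus_r_inv_mat)
    have mz: "A - 0\<^sub>m n k = A" if "A \<in> carrier_mat n k" for A :: "complex mat" and n k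
      using that by (intro eq_matI) auto
    have PP': "P * P' = P'" unfolding P'_def
      using mult_minus_distrib_mat[OF Pc Pc Ec] by (simp add: less.prems(2) PE)
    have P'P: "P' * P = P'" unfolding P'_def
      using minus_mult_distrib_mat[OF Pc Ec Pc] by (simp add: less.prems(2) EP)
    have P'E: "P' * E = 0\<^sub>m e e" unfolding P'_def
      using minus_mult_distrib_mat[OF Pc Ec Ec] Ec by (simp add: PE EE zero)
    have idem: "P' * P' = P'"
    proof -
      have "P' * P' = P' * P - P' * E"
        using mult_minus_distrib_mat[OF Pc' Pc Ec] by (simp add: P'_def)
      then show ?thesis using P'P P'E Pc' mz by simp
    qed
    have P'\<phi>: "P' * \<phi> = 0\<^sub>m e d" unfolding P'_def
      using minus_mult_distrib_mat[OF Pc Ec fc] fc by (simp add: \<phi>(2) E\<phi> zero)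
    have \<eta>P': "\<eta> * P' = 0\<^sub>m d e" unfolding P'_def
      using mult_minus_distrib_mat[OF hc Pc Ec] hc by (simp add: \<eta>P \<eta>E zero)
    obtain t' :: nat where t': "trace_mat P' = of_nat t'" using idempotent_trace[OF Pc' idem] .
    have "trace_mat E = of_nat d" unfolding E_def
      using trace_mat_mult_comm[OF fc hc] by (simp add: \<eta>\<phi>)
    then have "(of_nat t :: complex) - of_nat d = of_nat t'"
      using t' less.prems(3) trace_mat_minus[OF Pc Ec] by (simp add: P'_def)
    then have "of_nat t = (of_nat (t' + d) :: complex)" by (simp add: algebra_simps)
    then have "t = t' + d" by (simp only: of_nat_eq_iff)
    then have "t' < t" using irrep_pos[OF V] by simp
    from less.IH[OF this P' idem t'] obtain k f h where
      fh: "\<And>i. i < k \<Longrightarrow> intertwiner G d \<rho> e \<sigma> (f i)" "\<And>i. i < k \<Longrightarrow> intertwiner G e \<sigma> d \<rho> (h i)"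
        "\<And>i. i < k \<Longrightarrow> P' * f i = f i" "\<And>i. i < k \<Longrightarrow> h i * P' = h i"
      and orth: "\<And>i j. i < k \<Longrightarrow> j < k \<Longrightarrow> h i * f j = (if i = j then 1\<^sub>m d else 0\<^sub>m d d)"
      and compl: "\<And>\<phi>. intertwiner G d \<rho> e \<sigma> \<phi> \<Longrightarrow> P' * \<phi> = \<phi> \<Longrightarrow> isotypic_proj e k f h * \<phi> = \<phi>"
      by blast
    have fic: "f i \<in> carrier_mat e d" and hic: "h i \<in> carrier_mat d e" if "i < k" for i
      using intertwinerD(1)[OF fh(1)[OF that]] intertwinerD(1)[OF fh(2)[OF that]] .
    define f' where "f' = f(k := \<phi>)"
    define h' where "h' = h(k := \<eta>)"
    have f'i: "f' i = f i" and h'i: "h' i = h i" if "i < k" for i using that by (auto simp: f'_def h'_def)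
    have f'k: "f' k = \<phi>" "h' k = \<eta>" by (auto simp: f'_def h'_def)
    have h\<phi>: "h i * \<phi> = 0\<^sub>m d d" if "i < k" for i
    proof -
      have "h i * \<phi> = h i * P' * \<phi>" using fh(4)[OF that] by simp
      also have "\<dots> = h i * 0\<^sub>m e d" using P'\<phi> carrier_matD[OF hic[OF that]] by (simp add: mat_assoc)
      finally show ?thesis using hic[OF that] by simp
    qed
    have \<eta>f: "\<eta> * f i = 0\<^sub>m d d" if "i < k" for i
    proof -
      have "\<eta> * f i = \<eta> * (P' * f i)" using fh(3)[OF that] by simp
      also have "\<dots> = 0\<^sub>m d e * f i" using \<eta>P' carrier_matD[OF fic[OF that]] by (simp add: mat_assoc[symmetric])
      finally show ?thesis using fic[OF that] by simp
    qed
    have Pf: "P * f i = f i" and hP: "h i * P = h i" if "i < k" for i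
    proof -
      note [simp] = carrier_matD[OF hic[OF that]] carrier_matD[OF fic[OF that]]
      have "P * f i = P * P' * f i" using fh(3)[OF that] by (simp add: mat_assoc)
      then show "P * f i = f i" using PP' fh(3)[OF that] by simp
      have "h i * P = h i * (P' * P)" using fh(4)[OF that] by (simp add: mat_assoc[symmetric])
      then show "h i * P = h i" using P'P fh(4)[OF that] by simp
    qed
    have proj: "isotypic_proj e (Suc k) f' h' = E + isotypic_proj e k f h"
    proof -
      have "isotypic_proj e (Suc k) f' h' = mat_sum e e (insert k {..<k}) (\<lambda>i. f' i * h' i)"
        by (simp add: isotypic_proj_def lessThan_Suc)
      also have "\<dots> = f' k * h' k + mat_sum e e {..<k} (\<lambda>i. f' i * h' i)"
        by (rule mat_sum_insert) (use fc hc in \<open>auto simp: f'k\<close>)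
      also have "mat_sum e e {..<k} (\<lambda>i. f' i * h' i) = isotypic_proj e k f h"
        unfolding isotypic_proj_def by (rule mat_sum_cong) (auto simp: f'i h'i)
      finally show ?thesis by (simp add: f'k E_def)
    qed
    have proj\<phi>: "isotypic_proj e k f h * \<phi> = 0\<^sub>m e d"
    proof -
      have "isotypic_proj e k f h * \<phi> = mat_sum e d {..<k} (\<lambda>i. f i * h i * \<phi>)"
        unfolding isotypic_proj_def by (rule mat_sum_mult[OF fc]) (use fic hic in \<open>auto intro: mult_carrier_mat\<close>)
      also have "\<dots> = mat_sum e d {..<k} (\<lambda>i. 0\<^sub>m e d)"
      proof (rule mat_sum_cong[OF refl])
        fix i assume "i \<in> {..<k}"
        then have i: "i < k" by simp
        show "f i * h i * \<phi> = 0\<^sub>m e d"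
          using carrier_matD[OF fic[OF i]] carrier_matD[OF hic[OF i]] h\<phi>[OF i] right_mult_zero_mat[OF fic[OF i]]
          by (simp add: mat_assoc)
      qed
      also have "\<dots> = 0\<^sub>m e d" by (rule eq_matI) auto
      finally show ?thesis .
    qed
    have fh': "intertwiner G d \<rho> e \<sigma> (f' i) \<and> intertwiner G e \<sigma> d \<rho> (h' i) \<and>
        P * f' i = f' i \<and> h' i * P = h' i" if "i < Suc k" for i
      using that fh(1,2) Pf hP \<phi>(1,2) \<eta> \<eta>P f'k f'i h'i by (cases "i = k") auto
    have orth': "h' i * f' j = (if i = j then 1\<^sub>m d else 0\<^sub>m d d)" if "i < Suc k" "j < Suc k" for i j
      using that orth h\<phi> \<eta>f \<eta>\<phi> f'k f'i h'i
      by (cases "i = k"; cases "j = k") (auto simp: less_Suc_eq)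
    \<comment> \<open>\<open>\<psi>\<close> is split into its part on the new copy and the rest; the
      rest is fixed by \<open>P'\<close>, so the induction hypothesis covers it.\<close>
    have compl': "isotypic_proj e (Suc k) f' h' * \<psi> = \<psi>"
      if \<psi>: "intertwiner G d \<rho> e \<sigma> \<psi>" "P * \<psi> = \<psi>" for \<psi>
    proof -
      note \<psi>c = intertwinerD(1)[OF \<psi>(1)]
      note [simp] = carrier_matD[OF \<psi>c]
      have Epsi: "intertwiner G d \<rho> e \<sigma> (E * \<psi>)" by (rule intertwiner_mult[OF \<psi>(1) E r s s])
      have \<psi>': "intertwiner G d \<rho> e \<sigma> (\<psi> - E * \<psi>)" by (rule intertwiner_minus[OF \<psi>(1) Epsi r s])
      have P'\<psi>: "P' * \<psi> = \<psi> - E * \<psi>" unfolding P'_def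
        using minus_mult_distrib_mat[OF Pc Ec \<psi>c] by (simp add: \<psi>(2))
      have "P' * (P' * \<psi>) = P' * \<psi>" using idem by (simp add: mat_assoc[symmetric])
      then have fix': "isotypic_proj e k f h * (\<psi> - E * \<psi>) = \<psi> - E * \<psi>"
        using compl[OF \<psi>'] P'\<psi> by simp
      have "isotypic_proj e k f h * (E * \<psi>) = isotypic_proj e k f h * \<phi> * (\<eta> * \<psi>)"
        unfolding E_def by (simp add: mat_assoc)
      also have "\<dots> = 0\<^sub>m e d" unfolding proj\<phi> using hc \<psi>c by simp
      finally have "isotypic_proj e k f h * \<psi> - 0\<^sub>m e d = \<psi> - E * \<psi>"
        using mult_minus_distrib_mat[OF isotypic_proj_carrier[of e k f h] \<psi>c mult_carrier_mat[OF Ec \<psi>c]] Ec \<psi>c fix' by simp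
      moreover have "isotypic_proj e k f h * \<psi> \<in> carrier_mat e d"
        using isotypic_proj_carrier \<psi>c by (rule mult_carrier_mat)
      ultimately have "isotypic_proj e k f h * \<psi> = \<psi> - E * \<psi>" using mz by simp
      then have "isotypic_proj e (Suc k) f' h' * \<psi> = E * \<psi> + (\<psi> - E * \<psi>)"
        unfolding proj using add_mult_distrib_mat[OF Ec isotypic_proj_carrier[of e k f h] \<psi>c] by simp
      also have "\<dots> = \<psi>" using Ec \<psi>c by (intro eq_matI) auto
      finally show ?thesis .
    qed
    show ?thesis using fh' orth' compl' by blast
  qed
qed

text \<open>Splitting the identity gives all clauses except the one for maps out of
  \<open>\<sigma>\<close>. If such a \<open>\<psi>\<close> had a nonzero defect
  \<open>\<psi> - \<psi> * ?Q\<close>, the defect would have a section; but \<open>?Q\<close> fixes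
  that section, so the defect kills it.\<close>

lemma isotypic_exists:
  assumes fin: "finite (carrier G)" and V: "irrep G d \<rho>" and T: "is_rep G e \<sigma>"
  shows "\<exists>k f h. isotypic G d \<rho> e \<sigma> k f h"
proof -
  note R = irrep_rep[OF V]
  note r = is_rep_carrier[OF R] and s = is_rep_carrier[OF T]
  have one: "intertwiner G e \<sigma> e \<sigma> (1\<^sub>m e)"
    by (auto simp: intertwiner_def left_mult_one_mat[OF s] right_mult_one_mat[OF s])
  have "1\<^sub>m e * 1\<^sub>m e = (1\<^sub>m e :: complex mat)" by simp
  from isotypic_below_idempotent[OF fin V T one this trace_mat_one] obtain k f h where
    fh: "\<And>i. i < k \<Longrightarrow> intertwiner G d \<rho> e \<sigma> (f i)" "\<And>i. i < k \<Longrightarrow> intertwiner G e \<sigma> d \<rho> (h i)"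
    and orth: "\<And>i j. i < k \<Longrightarrow> j < k \<Longrightarrow> h i * f j = (if i = j then 1\<^sub>m d else 0\<^sub>m d d)"
    and compl: "\<And>\<phi>. intertwiner G d \<rho> e \<sigma> \<phi> \<Longrightarrow> 1\<^sub>m e * \<phi> = \<phi> \<Longrightarrow> isotypic_proj e k f h * \<phi> = \<phi>"
    by blast
  let ?Q = "isotypic_proj e k f h"
  have compl': "?Q * \<phi> = \<phi>" if "intertwiner G d \<rho> e \<sigma> \<phi>" for \<phi>
    using compl[OF that] left_mult_one_mat[OF intertwinerD(1)[OF that]] by simp
  have dual: "\<psi> * ?Q = \<psi>" if \<psi>: "intertwiner G e \<sigma> d \<rho> \<psi>" for \<psi>
  proof (rule ccontr)
    assume neq: "\<psi> * ?Q \<noteq> \<psi>"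
    note \<psi>c = intertwinerD(1)[OF \<psi>]
    have fi: "f i * h i \<in> carrier_mat e e" if "i < k" for i
      using intertwinerD(1)[OF fh(1)[OF that]] intertwinerD(1)[OF fh(2)[OF that]] by (rule mult_carrier_mat)
    have Q: "intertwiner G e \<sigma> e \<sigma> ?Q"
      unfolding intertwiner_def
    proof (intro conjI ballI)
      fix g assume g: "g \<in> carrier G"
      have "?Q * \<sigma> g = mat_sum e e {..<k} (\<lambda>i. f i * h i * \<sigma> g)"
        unfolding isotypic_proj_def by (rule mat_sum_mult[OF s[OF g]]) (use fi in auto)
      also have "\<dots> = mat_sum e e {..<k} (\<lambda>i. \<sigma> g * (f i * h i))"
      proof (rule mat_sum_cong[OF refl])
        fix i assume "i \<in> {..<k}"
        then have i: "i < k" by simp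
        have "intertwiner G e \<sigma> e \<sigma> (f i * h i)" by (rule intertwiner_mult[OF fh(2)[OF i] fh(1)[OF i] s r s])
        from intertwinerD(2)[OF this g] show "f i * h i * \<sigma> g = \<sigma> g * (f i * h i)" .
      qed
      also have "\<dots> = \<sigma> g * ?Q"
        unfolding isotypic_proj_def by (rule mult_mat_sum[OF s[OF g], symmetric]) (use fi in auto)
      finally show "?Q * \<sigma> g = \<sigma> g * ?Q" .
    qed simp
    have Qc: "?Q \<in> carrier_mat e e" by simp
    have \<psi>Q: "intertwiner G e \<sigma> d \<rho> (\<psi> * ?Q)" by (rule intertwiner_mult[OF Q \<psi> s s r])
    define \<eta> where "\<eta> = \<psi> - \<psi> * ?Q"
    have \<eta>: "intertwiner G e \<sigma> d \<rho> \<eta>" unfolding \<eta>_def by (rule intertwiner_minus[OF \<psi> \<psi>Q s r])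
    have "\<eta> \<noteq> 0\<^sub>m d e"
    proof
      assume eq: "\<eta> = 0\<^sub>m d e"
      have "\<psi> * ?Q = \<psi>"
      proof (rule eq_matI)
        fix p q assume pq: "p < dim_row \<psi>" "q < dim_col \<psi>"
        have "\<eta> $$ (p, q) = 0" using eq pq \<psi>c by simp
        then show "(\<psi> * ?Q) $$ (p, q) = \<psi> $$ (p, q)" using pq \<psi>c by (simp add: \<eta>_def del: index_mult_mat(1))
      qed (use \<psi>c in auto)
      with neq show False by simp
    qed
    then obtain \<phi> where \<phi>: "intertwiner G d \<rho> e \<sigma> \<phi>" "\<eta> * \<phi> = 1\<^sub>m d"
      using irrep_section[OF fin V T \<eta>] by blast
    note \<phi>c = intertwinerD(1)[OF \<phi>(1)]
    have "\<eta> * \<phi> = \<psi> * \<phi> - \<psi> * (?Q * \<phi>)"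
      unfolding \<eta>_def using minus_mult_distrib_mat[OF \<psi>c _ \<phi>c, of "\<psi> * ?Q"] \<psi>c \<phi>c
      by (simp add: mat_assoc)
    also have "\<dots> = 0\<^sub>m d d" using \<psi>c \<phi>c by (simp add: compl'[OF \<phi>(1)] minus_r_inv_mat)
    finally have "(1\<^sub>m d :: complex mat) = 0\<^sub>m d d" using \<phi>(2) by simp
    then have "(1\<^sub>m d :: complex mat) $$ (0, 0) = 0\<^sub>m d d $$ (0, 0)" by simp
    then show False using irrep_pos[OF V] by simp
  qed
  show ?thesis using fh orth compl' dual unfolding isotypic_def by blast
qed

section \<open>Calculus with one isotypic component\<close>

locale isotypic_component =
  fixes G :: "('g, 'b) monoid_scheme" and d \<rho> e \<sigma> k f h
  assumes V: "irrep G d \<rho>" and T: "is_rep G e \<sigma>" and iso: "isotypic G d \<rho> e \<sigma> k f h"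
begin

lemmas rep_carrier = is_rep_carrier[OF irrep_rep[OF V]] is_rep_carrier[OF T]

lemma f_int: "i < k \<Longrightarrow> intertwiner G d \<rho> e \<sigma> (f i)"
  and h_int: "i < k \<Longrightarrow> intertwiner G e \<sigma> d \<rho> (h i)"
  and orth: "i < k \<Longrightarrow> j < k \<Longrightarrow> h i * f j = (if i = j then 1\<^sub>m d else 0\<^sub>m d d)"
  and proj_left: "intertwiner G d \<rho> e \<sigma> \<phi> \<Longrightarrow> isotypic_proj e k f h * \<phi> = \<phi>"
  and proj_right: "intertwiner G e \<sigma> d \<rho> \<psi> \<Longrightarrow> \<psi> * isotypic_proj e k f h = \<psi>"
  using iso unfolding isotypic_def by blast+

lemma f_carrier: "i < k \<Longrightarrow> f i \<in> carrier_mat e d"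
  and h_carrier: "i < k \<Longrightarrow> h i \<in> carrier_mat d e"
  using f_int h_int intertwinerD(1) by blast+

lemmas fh_carrier = mult_carrier_mat[OF f_carrier h_carrier]

lemma fh_int: "i < k \<Longrightarrow> j < k \<Longrightarrow> intertwiner G e \<sigma> e \<sigma> (f i * h j)"
  by (rule intertwiner_mult[OF h_int f_int]) (auto intro: rep_carrier)

lemma proj_int: "intertwiner G e \<sigma> e \<sigma> (isotypic_proj e k f h)"
  unfolding intertwiner_def
proof (intro conjI ballI)
  fix g assume g: "g \<in> carrier G"
  have "isotypic_proj e k f h * \<sigma> g = mat_sum e e {..<k} (\<lambda>i. f i * h i * \<sigma> g)"
    unfolding isotypic_proj_def by (rule mat_sum_mult[OF rep_carrier(2)[OF g] fh_carrier]) auto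
  also have "\<dots> = mat_sum e e {..<k} (\<lambda>i. \<sigma> g * (f i * h i))"
    by (rule mat_sum_cong[OF refl]) (use intertwinerD(2)[OF fh_int g] in auto)
  also have "\<dots> = \<sigma> g * isotypic_proj e k f h"
    unfolding isotypic_proj_def by (rule mult_mat_sum[OF rep_carrier(2)[OF g] fh_carrier, symmetric]) auto
  finally show "isotypic_proj e k f h * \<sigma> g = \<sigma> g * isotypic_proj e k f h" .
qed simp

text \<open>Both products equal the projection followed by \<open>a\<close> and the projection again.\<close>

lemma proj_commutes:
  assumes a: "intertwiner G e \<sigma> e \<sigma> a"
  shows "isotypic_proj e k f h * a = a * isotypic_proj e k f h"
proof -
  let ?Q = "isotypic_proj e k f h"
  note ac = intertwinerD(1)[OF a]
  have ha: "h i * a * ?Q = h i * a" if "i < k" for i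
    by (rule proj_right, rule intertwiner_mult[OF a h_int[OF that]]) (auto intro: rep_carrier)
  have af: "?Q * (a * f i) = a * f i" if "i < k" for i
    by (rule proj_left, rule intertwiner_mult[OF f_int[OF that] a]) (auto intro: rep_carrier)
  have "?Q * a = mat_sum e e {..<k} (\<lambda>i. f i * h i * a)"
    unfolding isotypic_proj_def by (rule mat_sum_mult[OF ac fh_carrier]) auto
  also have "\<dots> = mat_sum e e {..<k} (\<lambda>i. f i * h i * (a * ?Q))"
  proof (rule mat_sum_cong[OF refl])
    fix i assume "i \<in> {..<k}"
    then have i: "i < k" by simp
    show "f i * h i * a = f i * h i * (a * ?Q)"
      using ha[OF i] carrier_matD[OF f_carrier[OF i]] carrier_matD[OF h_carrier[OF i]] carrier_matD[OF ac]
      by (simp add: mat_assoc)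
  qed
  also have "\<dots> = ?Q * (a * ?Q)"
    unfolding isotypic_proj_def[of e k f h]
    by (rule mat_sum_mult[OF mult_carrier_mat[OF ac mat_sum_carrier] fh_carrier, symmetric]) auto
  also have "\<dots> = ?Q * a * ?Q" using ac by (simp add: mat_assoc)
  finally have 1: "?Q * a = ?Q * a * ?Q" .
  have "a * ?Q = mat_sum e e {..<k} (\<lambda>i. a * (f i * h i))"
    unfolding isotypic_proj_def by (rule mult_mat_sum[OF ac fh_carrier]) auto
  also have "\<dots> = mat_sum e e {..<k} (\<lambda>i. ?Q * a * (f i * h i))"
  proof (rule mat_sum_cong[OF refl])
    fix i assume "i \<in> {..<k}"
    then have i: "i < k" by simp
    have "a * (f i * h i) = ?Q * (a * f i) * h i"
      using af[OF i] carrier_matD[OF f_carrier[OF i]] carrier_matD[OF h_carrier[OF i]] carrier_matD[OF ac]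
      by (simp add: mat_assoc)
    then show "a * (f i * h i) = ?Q * a * (f i * h i)"
      using carrier_matD[OF f_carrier[OF i]] carrier_matD[OF h_carrier[OF i]] carrier_matD[OF ac]
      by (simp add: mat_assoc)
  qed
  also have "\<dots> = ?Q * a * ?Q"
    unfolding isotypic_proj_def[of e k f h]
    by (rule mult_mat_sum[OF mult_carrier_mat[OF mat_sum_carrier ac] fh_carrier, symmetric]) auto
  finally show ?thesis using 1 by simp
qed

lemma proj_f: "i < k \<Longrightarrow> isotypic_proj e k f h * f i = f i"
  by (rule proj_left[OF f_int])

lemma proj_idem: "isotypic_proj e k f h * isotypic_proj e k f h = isotypic_proj e k f h"
proof -
  have "isotypic_proj e k f h * isotypic_proj e k f h
    = mat_sum e e {..<k} (\<lambda>i. isotypic_proj e k f h * (f i * h i))"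
    by (subst (2) isotypic_proj_def, rule mult_mat_sum[OF isotypic_proj_carrier fh_carrier]) auto
  also have "\<dots> = mat_sum e e {..<k} (\<lambda>i. f i * h i)"
  proof (rule mat_sum_cong[OF refl])
    fix i assume "i \<in> {..<k}"
    then have i: "i < k" by simp
    have "isotypic_proj e k f h * (f i * h i) = isotypic_proj e k f h * f i * h i"
      using f_carrier[OF i] h_carrier[OF i] by (simp add: mat_assoc)
    then show "isotypic_proj e k f h * (f i * h i) = f i * h i" using proj_f[OF i] by simp
  qed
  finally show ?thesis by (simp add: isotypic_proj_def)
qed

text \<open>For equivariant \<open>a\<close> the block \<open>h i * a * f j\<close> is a scalar
  matrix by Schur's lemma, so its corner entry, which exists because the degree is positive, carries
  all of it.\<close>

definition mult_entry :: "complex mat \<Rightarrow> nat \<Rightarrow> nat \<Rightarrow> complex" where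
  "mult_entry a i j = (h i * a * f j) $$ (0, 0)"

lemma block_scalar:
  assumes a: "intertwiner G e \<sigma> e \<sigma> a" and ij: "i < k" "j < k"
  shows "h i * a * f j = mult_entry a i j \<cdot>\<^sub>m 1\<^sub>m d"
proof -
  have ha: "intertwiner G e \<sigma> d \<rho> (h i * a)"
    by (rule intertwiner_mult[OF a h_int[OF ij(1)]]) (auto intro: rep_carrier)
  have "intertwiner G d \<rho> d \<rho> (h i * a * f j)"
    by (rule intertwiner_mult[OF f_int[OF ij(2)] ha]) (auto intro: rep_carrier)
  then obtain c where c: "h i * a * f j = c \<cdot>\<^sub>m 1\<^sub>m d" using irrep_self_intertwiner_scalar[OF V] by blast
  then have "mult_entry a i j = c" unfolding mult_entry_def c using irrep_pos[OF V] by simp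
  then show ?thesis using c by simp
qed

text \<open>An equivariant \<open>a\<close> acts on the multiplicity space by composition, and
  \<open>mult_entry a\<close> is its matrix in the basis \<open>f\<close>.\<close>

lemma act_f:
  assumes a: "intertwiner G e \<sigma> e \<sigma> a" and j: "j < k"
  shows "a * f j = mat_sum e d {..<k} (\<lambda>i. mult_entry a i j \<cdot>\<^sub>m f i)"
proof -
  note ac = intertwinerD(1)[OF a]
  have "a * f j = isotypic_proj e k f h * (a * f j)"
    by (rule proj_left[symmetric], rule intertwiner_mult[OF f_int[OF j] a]) (auto intro: rep_carrier)
  also have "\<dots> = mat_sum e d {..<k} (\<lambda>i. f i * h i * (a * f j))"
    unfolding isotypic_proj_def by (rule mat_sum_mult[OF mult_carrier_mat[OF ac f_carrier[OF j]] fh_carrier]) auto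
  also have "\<dots> = mat_sum e d {..<k} (\<lambda>i. mult_entry a i j \<cdot>\<^sub>m f i)"
  proof (rule mat_sum_cong[OF refl])
    fix i assume "i \<in> {..<k}"
    then have i: "i < k" by simp
    have "f i * h i * (a * f j) = f i * (h i * a * f j)"
      using carrier_matD[OF f_carrier[OF i]] carrier_matD[OF h_carrier[OF i]] carrier_matD[OF ac]
        carrier_matD[OF f_carrier[OF j]] by (simp add: mat_assoc)
    also have "\<dots> = mult_entry a i j \<cdot>\<^sub>m f i"
      unfolding block_scalar[OF a i j] using mult_smult_distrib[OF f_carrier[OF i] one_carrier_mat] f_carrier[OF i]
      by simp
    finally show "f i * h i * (a * f j) = mult_entry a i j \<cdot>\<^sub>m f i" .
  qed
  finally show ?thesis .
qed

lemma trace_proj: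
  assumes a: "intertwiner G e \<sigma> e \<sigma> a"
  shows "trace_mat (a * isotypic_proj e k f h) = of_nat d * (\<Sum>i<k. mult_entry a i i)"
proof -
  note ac = intertwinerD(1)[OF a]
  have "a * isotypic_proj e k f h = mat_sum e e {..<k} (\<lambda>i. a * (f i * h i))"
    unfolding isotypic_proj_def by (rule mult_mat_sum[OF ac fh_carrier]) auto
  then have "trace_mat (a * isotypic_proj e k f h) = (\<Sum>i<k. trace_mat (a * (f i * h i)))"
    using trace_mat_sum[of "{..<k}" "\<lambda>i. a * (f i * h i)" e] mult_carrier_mat[OF ac fh_carrier] by simp
  also have "\<dots> = (\<Sum>i<k. of_nat d * mult_entry a i i)"
  proof (rule sum.cong[OF refl])
    fix i assume "i \<in> {..<k}"
    then have i: "i < k" by simp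
    have "trace_mat (a * (f i * h i)) = trace_mat (a * f i * h i)"
      using carrier_matD[OF f_carrier[OF i]] carrier_matD[OF h_carrier[OF i]] carrier_matD[OF ac]
      by (simp add: mat_assoc)
    also have "\<dots> = trace_mat (h i * (a * f i))"
      by (rule trace_mat_mult_comm[OF mult_carrier_mat[OF ac f_carrier[OF i]] h_carrier[OF i]])
    also have "\<dots> = trace_mat (h i * a * f i)"
      using carrier_matD[OF f_carrier[OF i]] carrier_matD[OF h_carrier[OF i]] carrier_matD[OF ac]
      by (simp add: mat_assoc)
    also have "\<dots> = of_nat d * mult_entry a i i"
      unfolding block_scalar[OF a i i] by (simp add: trace_mat_smult[OF one_carrier_mat])
    finally show "trace_mat (a * (f i * h i)) = of_nat d * mult_entry a i i" .
  qed
  finally show ?thesis by (simp add: sum_distrib_left)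
qed

end

section \<open>Polynomials\<close>

text \<open>A polynomial with infinitely many zeros vanishes. Exponents may repeat within the
  family, so only coefficients collected over one exponent are zero. The point 0 is left out because
  characters are known at invertible diagonal matrices only.\<close>

lemma univariate_coeffs_zero:
  fixes b :: "'a \<Rightarrow> complex"
  assumes fin: "finite A" and z: "\<And>z. z \<noteq> 0 \<Longrightarrow> (\<Sum>a\<in>A. b a * z ^ n a) = 0"
  shows "(\<Sum>a\<in>{a \<in> A. n a = k}. b a) = 0"
proof -
  define p where "p = (\<Sum>a\<in>A. monom (b a) (n a))"
  have "poly p z = 0" if "z \<noteq> 0" for z
    using z[OF that] by (simp add: p_def poly_sum poly_monom)
  then have "UNIV - {0} \<subseteq> {z. poly p z = 0}" by auto
  moreover have "infinite (UNIV - {0 :: complex})" by (simp add: infinite_UNIV_char_0)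
  ultimately have "p = 0" using poly_roots_finite[of p] finite_subset by blast
  then have "coeff p k = 0" by simp
  then show ?thesis using fin by (simp add: p_def coeff_sum sum.If_cases Int_def conj_commute)
qed

text \<open>Monomials are encoded as multisets of variables. Induction on the set of variables: with
  the others fixed, the identity is univariate in \<open>y\<close> and splits according to the
  exponent of \<open>y\<close>.\<close>

lemma multivariate_coeffs_zero:
  fixes c :: "'a multiset \<Rightarrow> complex"
  assumes "finite Y" "finite \<M>" "\<And>M. M \<in> \<M> \<Longrightarrow> set_mset M \<subseteq> Y"
    and "\<And>x. (\<And>y. y \<in> Y \<Longrightarrow> x y \<noteq> 0) \<Longrightarrow> (\<Sum>M\<in>\<M>. c M * (\<Prod>y\<in>#M. x y)) = 0"
    and "M \<in> \<M>"
  shows "c M = 0"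
  using assms
proof (induction Y arbitrary: \<M> c M rule: finite_induct)
  case empty
  then have "\<M> = {{#}}" "M = {#}" by auto
  then show ?case using empty(3)[of "\<lambda>_. 1"] by simp
next
  case (insert y Y)
  define red where "red = filter_mset (\<lambda>z. z \<noteq> (y :: 'a))"
  define k where "k = count M y"
  define \<M>k where "\<M>k = {N \<in> \<M>. count N y = k}"
  have dec: "N = red N + replicate_mset (count N y) y" for N
    by (rule multiset_eqI) (auto simp: red_def)
  \<comment> \<open>Once the exponent of \<open>y\<close> is fixed, a monomial is recovered from
    what remains after deleting \<open>y\<close>.\<close>
  have inj: "inj_on red \<M>k"
    by (rule inj_onI) (metis (mono_tags, lifting) \<M>k_def dec mem_Collect_eq)
  have "c (red M + replicate_mset k y) = 0"
  proof (rule insert.IH[of "red ` \<M>k" "\<lambda>N. c (N + replicate_mset k y)"])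
    show "finite (red ` \<M>k)" using insert.prems(1) by (simp add: \<M>k_def)
    show "set_mset N \<subseteq> Y" if "N \<in> red ` \<M>k" for N
      using that insert.prems(2) by (force simp: red_def \<M>k_def)
    show "red M \<in> red ` \<M>k" using insert.prems(4) by (simp add: \<M>k_def k_def)
    fix x :: "'a \<Rightarrow> complex" assume x: "\<And>u. u \<in> Y \<Longrightarrow> x u \<noteq> 0"
    have "(\<Sum>N\<in>\<M>. (c N * (\<Prod>u\<in>#red N. x u)) * z ^ count N y) = 0" if z: "z \<noteq> 0" for z
    proof -
      have "(\<Prod>u\<in>#N. (x(y := z)) u) = (\<Prod>u\<in>#red N. x u) * z ^ count N y" for N
      proof -
        have "(\<Prod>u\<in>#N. (x(y := z)) u) = (\<Prod>u\<in>#red N. (x(y := z)) u) * z ^ count N y"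
          by (subst dec) (simp add: image_replicate_mset)
        also have "image_mset (x(y := z)) (red N) = image_mset x (red N)"
          by (rule image_mset_cong) (auto simp: red_def)
        finally show ?thesis .
      qed
      then have "(\<Sum>N\<in>\<M>. (c N * (\<Prod>u\<in>#red N. x u)) * z ^ count N y)
        = (\<Sum>N\<in>\<M>. c N * (\<Prod>u\<in>#N. (x(y := z)) u))" by (simp add: mult.assoc)
      also have "\<dots> = 0" by (rule insert.prems(3)) (use x z insert.hyps in auto)
      finally show ?thesis .
    qed
    from univariate_coeffs_zero[OF insert.prems(1) this, of k]
    have "(\<Sum>N\<in>\<M>k. c N * (\<Prod>u\<in>#red N. x u)) = 0" by (simp add: \<M>k_def)
    moreover have "c N = c (red N + replicate_mset k y)" if "N \<in> \<M>k" for N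
      using that dec[of N] by (simp add: \<M>k_def)
    ultimately have "(\<Sum>N\<in>\<M>k. c (red N + replicate_mset k y) * (\<Prod>u\<in>#red N. x u)) = 0"
      by (simp cong: sum.cong)
    then show "(\<Sum>N\<in>red ` \<M>k. c (N + replicate_mset k y) * (\<Prod>u\<in>#N. x u)) = 0"
      by (subst sum.reindex[OF inj]) simp
  qed
  then show ?case using dec[of M] by (simp add: k_def)
qed

text \<open>Back substitution starting from an index of largest rank: at that index only its own
  unknown contributes, which fixes it, and its contribution is subtracted from the remaining
  right-hand sides.\<close>

lemma triangular_system:
  fixes K :: "'a \<Rightarrow> 'a \<Rightarrow> 'b :: field" and r :: "'a \<Rightarrow> nat"
  assumes "finite L" "\<And>\<mu>. \<mu> \<in> L \<Longrightarrow> K \<mu> \<mu> \<noteq> 0"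
    and "\<And>\<mu> \<alpha>. \<mu> \<in> L \<Longrightarrow> \<alpha> \<in> L \<Longrightarrow> K \<mu> \<alpha> \<noteq> 0 \<Longrightarrow> \<alpha> = \<mu> \<or> r \<alpha> < r \<mu>"
  shows "\<exists>c. \<forall>\<alpha>\<in>L. (\<Sum>\<mu>\<in>L. c \<mu> * K \<mu> \<alpha>) = v \<alpha>"
  using assms
proof (induction L arbitrary: v rule: finite_ranking_induct[where f = r])
  case empty
  then show ?case by simp
next
  case (insert \<mu>0 L)
  show ?case
  proof (cases "\<mu>0 \<in> L")
    case True
    then have "insert \<mu>0 L = L" by blast
    then show ?thesis using insert.IH[of v] insert.prems by simp
  next
    case False
    define c0 where "c0 = v \<mu>0 / K \<mu>0 \<mu>0"
    have "\<exists>c. \<forall>\<alpha>\<in>L. (\<Sum>\<mu>\<in>L. c \<mu> * K \<mu> \<alpha>) = v \<alpha> - c0 * K \<mu>0 \<alpha>"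
      by (rule insert.IH) (use insert.prems in blast)+
    then obtain c where c: "\<And>\<alpha>. \<alpha> \<in> L \<Longrightarrow> (\<Sum>\<mu>\<in>L. c \<mu> * K \<mu> \<alpha>) = v \<alpha> - c0 * K \<mu>0 \<alpha>" by blast
    have sum: "(\<Sum>\<mu>\<in>insert \<mu>0 L. (c(\<mu>0 := c0)) \<mu> * K \<mu> \<alpha>) = c0 * K \<mu>0 \<alpha> + (\<Sum>\<mu>\<in>L. c \<mu> * K \<mu> \<alpha>)" for \<alpha>
      using insert.hyps(1) False by (auto intro!: sum.cong)
    have "K \<mu> \<mu>0 = 0" if "\<mu> \<in> L" for \<mu>
      using insert.prems(2)[of \<mu> \<mu>0] insert.hyps(2) False that by (metis insertCI not_less)
    then have "(\<Sum>\<mu>\<in>L. c \<mu> * K \<mu> \<mu>0) = 0" by simp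
    then have "(\<Sum>\<mu>\<in>insert \<mu>0 L. (c(\<mu>0 := c0)) \<mu> * K \<mu> \<mu>0) = v \<mu>0"
      unfolding sum using insert.prems(1)[of \<mu>0] by (simp add: c0_def)
    moreover have "(\<Sum>\<mu>\<in>insert \<mu>0 L. (c(\<mu>0 := c0)) \<mu> * K \<mu> \<alpha>) = v \<alpha>" if "\<alpha> \<in> L" for \<alpha>
      unfolding sum using c[OF that] by simp
    ultimately show ?thesis by (intro exI[of _ "c(\<mu>0 := c0)"]) auto
  qed
qed

section \<open>Matrices indexed by finite sets\<close>

text \<open>Undoes the numbering by \<open>from_nat_into\<close>, so that products and traces become
  sums over the index sets themselves.\<close>

definition entry :: "'x set \<Rightarrow> 'y set \<Rightarrow> 'a mat \<Rightarrow> 'x \<Rightarrow> 'y \<Rightarrow> 'a" where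
  "entry X Y A x y = A $$ (to_nat_on X x, to_nat_on Y y)"

lemma to_nat_on_less: "finite X \<Longrightarrow> x \<in> X \<Longrightarrow> to_nat_on X x < card X"
  using to_nat_on_finite[of X] by (auto simp: bij_betw_def)

lemma from_to_nat_on: "finite X \<Longrightarrow> x \<in> X \<Longrightarrow> from_nat_into X (to_nat_on X x) = x"
  by (simp add: countable_finite)

lemma from_nat_into_mem: "finite X \<Longrightarrow> i < card X \<Longrightarrow> from_nat_into X i \<in> X"
  using bij_betw_from_nat_into_finite[of X] by (auto simp: bij_betw_def)

lemma to_from_nat_into: "finite X \<Longrightarrow> i < card X \<Longrightarrow> to_nat_on X (from_nat_into X i) = i"
  using bij_betw_from_nat_into_finite[of X] from_nat_into_mem[of X i] to_nat_on_less[of X]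
    from_to_nat_on[of X] unfolding bij_betw_def inj_on_def by (metis lessThan_iff)

lemma sum_from_nat_into: "finite X \<Longrightarrow> (\<Sum>i<card X. F (from_nat_into X i)) = sum F X"
  using sum.reindex_bij_betw[OF bij_betw_from_nat_into_finite] .

lemma entry_eqI:
  assumes "finite X" "finite Y" "A \<in> carrier_mat (card X) (card Y)" "B \<in> carrier_mat (card X) (card Y)"
    and "\<And>x y. x \<in> X \<Longrightarrow> y \<in> Y \<Longrightarrow> entry X Y A x y = entry X Y B x y"
  shows "A = B"
proof (rule eq_matI)
  fix i j assume "i < dim_row B" "j < dim_col B"
  then have ij: "i < card X" "j < card Y" using assms by auto
  show "A $$ (i, j) = B $$ (i, j)"
    using assms(5)[OF from_nat_into_mem[OF assms(1) ij(1)] from_nat_into_mem[OF assms(2) ij(2)]]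
      to_from_nat_into[OF assms(1) ij(1)] to_from_nat_into[OF assms(2) ij(2)]
    by (simp add: entry_def)
qed (use assms in auto)

lemma entry_mult:
  fixes A B :: "complex mat"
  assumes "finite X" "finite Y" "finite Z"
    and A: "A \<in> carrier_mat (card X) (card Y)" and B: "B \<in> carrier_mat (card Y) (card Z)"
    and x: "x \<in> X" and z: "z \<in> Z"
  shows "entry X Z (A * B) x z = (\<Sum>y\<in>Y. entry X Y A x y * entry Y Z B y z)"
proof -
  have "entry X Z (A * B) x z = (\<Sum>i<card Y. A $$ (to_nat_on X x, i) * B $$ (i, to_nat_on Z z))"
    unfolding entry_def
    by (rule mat_mult_index[OF A B to_nat_on_less[OF assms(1) x] to_nat_on_less[OF assms(3) z]])
  also have "\<dots> = (\<Sum>i<card Y. entry X Y A x (from_nat_into Y i) * entry Y Z B (from_nat_into Y i) z)"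
    by (rule sum.cong) (auto simp: entry_def to_from_nat_into[OF assms(2)])
  also have "\<dots> = (\<Sum>y\<in>Y. entry X Y A x y * entry Y Z B y z)"
    by (rule sum_from_nat_into[OF assms(2)])
  finally show ?thesis .
qed

lemma mat_on_carrier [simp]: "mat_on X f \<in> carrier_mat (card X) (card X)"
  by (simp add: mat_on_def)

lemma entry_mat_on [simp]: "finite X \<Longrightarrow> x \<in> X \<Longrightarrow> y \<in> X \<Longrightarrow> entry X X (mat_on X f) x y = f x y"
  by (simp add: entry_def mat_on_def to_nat_on_less from_to_nat_on)

lemma entry_one: "finite X \<Longrightarrow> x \<in> X \<Longrightarrow> y \<in> X \<Longrightarrow>
    entry X X (1\<^sub>m (card X)) x y = (if x = y then 1 else 0)"
  using from_to_nat_on[of X x] from_to_nat_on[of X y] by (auto simp: entry_def to_nat_on_less)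

lemma trace_entry:
  assumes "finite X" "A \<in> carrier_mat (card X) (card X)"
  shows "trace_mat A = (\<Sum>x\<in>X. entry X X A x x)"
proof -
  have "trace_mat A = (\<Sum>i<card X. entry X X A (from_nat_into X i) (from_nat_into X i))"
    unfolding trace_mat_def using assms by (intro sum.cong) (auto simp: entry_def to_from_nat_into)
  then show ?thesis using sum_from_nat_into[OF assms(1), of "\<lambda>x. entry X X A x x"] by simp
qed

lemma trace_mult_entry:
  fixes A B :: "complex mat"
  assumes "finite X" "A \<in> carrier_mat (card X) (card X)" "B \<in> carrier_mat (card X) (card X)"
  shows "trace_mat (A * B) = (\<Sum>x\<in>X. \<Sum>y\<in>X. entry X X A x y * entry X X B y x)"
  using trace_entry[OF assms(1) mult_carrier_mat[OF assms(2,3)]] entry_mult[OF assms(1,1,1,2,3)]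
  by simp

lemma is_repI:
  assumes G: "group G" and c: "\<And>g. g \<in> carrier G \<Longrightarrow> \<rho> g \<in> carrier_mat d d"
    and m: "\<And>g h. g \<in> carrier G \<Longrightarrow> h \<in> carrier G \<Longrightarrow> \<rho> (g \<otimes>\<^bsub>G\<^esub> h) = \<rho> g * \<rho> h"
    and one: "\<rho> \<one>\<^bsub>G\<^esub> = 1\<^sub>m d"
  shows "is_rep G d \<rho>"
proof -
  interpret group G by fact
  have "\<rho> g \<in> carrier (GL d)" if g: "g \<in> carrier G" for g
    unfolding GL_carrier_iff
    using c[OF g] c[OF inv_closed[OF g]] m[OF g inv_closed[OF g]] m[OF inv_closed[OF g] g] one g
    by (intro conjI bexI[of _ "\<rho> (inv\<^bsub>G\<^esub> g)"]) auto
  then show ?thesis using G m by (auto simp: is_rep_def hom_def)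
qed

section \<open>The tensor power\<close>

lemma finite_tensor_basis [simp]: "finite (tensor_basis m n)"
  by (simp add: tensor_basis_def finite_PiE)

abbreviation tensor_dim :: "nat \<Rightarrow> nat \<Rightarrow> nat" where
  "tensor_dim m n \<equiv> card (tensor_basis m n)"

abbreviation tentry :: "nat \<Rightarrow> nat \<Rightarrow> complex mat \<Rightarrow> (nat \<Rightarrow> nat) \<Rightarrow> (nat \<Rightarrow> nat) \<Rightarrow> complex" where
  "tentry m n \<equiv> entry (tensor_basis m n) (tensor_basis m n)"

lemma tensor_basis_comp_perm:
  assumes "s permutes {1..m}" "J \<in> tensor_basis m n"
  shows "J \<circ> s \<in> tensor_basis m n"
  using assms permutes_in_image[OF assms(1)] permutes_not_in[OF assms(1)]
  by (auto simp: tensor_basis_def PiE_def Pi_def extensional_def)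

lemma tensor_power_sym_carrier [simp]: "tensor_power_sym m n s \<in> carrier_mat (tensor_dim m n) (tensor_dim m n)"
  and tensor_power_GL_carrier [simp]: "tensor_power_GL m n g \<in> carrier_mat (tensor_dim m n) (tensor_dim m n)"
  by (simp_all add: tensor_power_sym_def perm_rep_def tensor_power_GL_def)

lemma tentry_sym:
  "I \<in> tensor_basis m n \<Longrightarrow> J \<in> tensor_basis m n \<Longrightarrow>
    tentry m n (tensor_power_sym m n s) I J = (if J \<circ> inv' s = I then 1 else 0)"
  by (simp add: tensor_power_sym_def perm_rep_def)

lemma tentry_GL:
  "I \<in> tensor_basis m n \<Longrightarrow> J \<in> tensor_basis m n \<Longrightarrow>
    tentry m n (tensor_power_GL m n g) I J = (\<Prod>k\<in>{1..m}. g $$ (I k, J k))"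
  by (simp add: tensor_power_GL_def)

lemma tentry_mult_sym:
  assumes A: "A \<in> carrier_mat r (tensor_dim m n)" and s: "s permutes {1..m}"
    and J: "J \<in> tensor_basis m n" and X: "finite X" "r = card X" "x \<in> X"
  shows "entry X (tensor_basis m n) (A * tensor_power_sym m n s) x J = entry X (tensor_basis m n) A x (J \<circ> inv' s)"
proof -
  let ?B = "tensor_basis m n"
  have J': "J \<circ> inv' s \<in> ?B" by (rule tensor_basis_comp_perm[OF permutes_inv[OF s] J])
  have "entry X ?B (A * tensor_power_sym m n s) x J
    = (\<Sum>I\<in>?B. entry X ?B A x I * tentry m n (tensor_power_sym m n s) I J)"
    by (rule entry_mult) (use assms in auto)
  also have "\<dots> = (\<Sum>I\<in>?B. if I = J \<circ> inv' s then entry X ?B A x I else 0)"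
    using J by (intro sum.cong) (auto simp: tentry_sym)
  also have "\<dots> = entry X ?B A x (J \<circ> inv' s)" using J' by simp
  finally show ?thesis .
qed

lemma tentry_sym_mult:
  assumes A: "A \<in> carrier_mat (tensor_dim m n) r" and s: "s permutes {1..m}"
    and I: "I \<in> tensor_basis m n" and X: "finite X" "r = card X" "x \<in> X"
  shows "entry (tensor_basis m n) X (tensor_power_sym m n s * A) I x = entry (tensor_basis m n) X A (I \<circ> s) x"
proof -
  let ?B = "tensor_basis m n"
  have I': "I \<circ> s \<in> ?B" by (rule tensor_basis_comp_perm[OF s I])
  have iff: "J \<circ> inv' s = I \<longleftrightarrow> J = I \<circ> s" for J
    using permutes_inv_o[OF s] by (metis comp_assoc comp_id)
  have "entry ?B X (tensor_power_sym m n s * A) I x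
    = (\<Sum>J\<in>?B. tentry m n (tensor_power_sym m n s) I J * entry ?B X A J x)"
    by (rule entry_mult) (use assms in auto)
  also have "\<dots> = (\<Sum>J\<in>?B. if J = I \<circ> s then entry ?B X A J x else 0)"
    using I by (intro sum.cong) (auto simp: tentry_sym iff)
  also have "\<dots> = entry ?B X A (I \<circ> s) x" using I' by simp
  finally show ?thesis .
qed

lemma tensor_power_sym_rep: "is_rep (sym_group m) (tensor_dim m n) (tensor_power_sym m n)"
proof (rule is_repI)
  show "group (sym_group m)" by (rule sym_group_is_group)
  show "tensor_power_sym m n \<one>\<^bsub>sym_group m\<^esub> = 1\<^sub>m (tensor_dim m n)"
    by (rule entry_eqI[OF finite_tensor_basis finite_tensor_basis])
      (auto simp: sym_group_one tentry_sym entry_one)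
  fix s t assume "s \<in> carrier (sym_group m)" "t \<in> carrier (sym_group m)"
  then have st: "s permutes {1..m}" "t permutes {1..m}" by (auto simp: sym_group_carrier)
  show "tensor_power_sym m n (s \<otimes>\<^bsub>sym_group m\<^esub> t) = tensor_power_sym m n s * tensor_power_sym m n t"
  proof (rule entry_eqI[OF finite_tensor_basis finite_tensor_basis])
    fix I J assume IJ: "I \<in> tensor_basis m n" "J \<in> tensor_basis m n"
    have eq: "J \<circ> inv' (s \<circ> t) = J \<circ> inv' t \<circ> inv' s"
      unfolding o_inv_distrib[OF permutes_bij[OF st(1)] permutes_bij[OF st(2)]] by (rule comp_assoc[symmetric])
    have "tentry m n (tensor_power_sym m n s * tensor_power_sym m n t) I J
      = tentry m n (tensor_power_sym m n s) I (J \<circ> inv' t)"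
      by (rule tentry_mult_sym[OF _ st(2) IJ(2) finite_tensor_basis _ IJ(1)]) auto
    also have "\<dots> = (if J \<circ> inv' t \<circ> inv' s = I then 1 else 0)"
      using tentry_sym[OF IJ(1) tensor_basis_comp_perm[OF permutes_inv[OF st(2)] IJ(2)]] .
    finally show "tentry m n (tensor_power_sym m n (s \<otimes>\<^bsub>sym_group m\<^esub> t)) I J
      = tentry m n (tensor_power_sym m n s * tensor_power_sym m n t) I J"
      unfolding sym_group_mult tentry_sym[OF IJ] eq by (rule sym)
  qed (auto intro: mult_carrier_mat[OF tensor_power_sym_carrier tensor_power_sym_carrier])
qed simp

text \<open>Expanding a product of \<open>m\<close> sums means choosing one summation index per
  position; such a choice is a map \<open>K\<close>, that is, again a basis vector.\<close>

lemma tensor_power_GL_mult: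
  assumes g: "g \<in> carrier_mat n n" and h: "h \<in> carrier_mat n n"
  shows "tensor_power_GL m n (g * h) = tensor_power_GL m n g * tensor_power_GL m n h"
proof (rule entry_eqI[OF finite_tensor_basis finite_tensor_basis])
  fix I J assume IJ: "I \<in> tensor_basis m n" "J \<in> tensor_basis m n"
  have mem: "K k < n" if "K \<in> tensor_basis m n" "k \<in> {1..m}" for K k
    using that by (auto simp: tensor_basis_def)
  have "tentry m n (tensor_power_GL m n (g * h)) I J = (\<Prod>k\<in>{1..m}. \<Sum>r<n. g $$ (I k, r) * h $$ (r, J k))"
    unfolding tentry_GL[OF IJ]
    by (rule prod.cong[OF refl]) (rule mat_mult_index[OF g h mem[OF IJ(1)] mem[OF IJ(2)]])
  also have "\<dots> = (\<Sum>K\<in>tensor_basis m n. \<Prod>k\<in>{1..m}. g $$ (I k, K k) * h $$ (K k, J k))"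
    unfolding tensor_basis_def by (rule prod_sum_PiE) auto
  also have "\<dots> = (\<Sum>K\<in>tensor_basis m n. tentry m n (tensor_power_GL m n g) I K * tentry m n (tensor_power_GL m n h) K J)"
    using IJ by (intro sum.cong) (auto simp: tentry_GL prod.distrib)
  also have "\<dots> = tentry m n (tensor_power_GL m n g * tensor_power_GL m n h) I J"
    by (rule entry_mult[symmetric]) (use IJ in auto)
  finally show "tentry m n (tensor_power_GL m n (g * h)) I J
    = tentry m n (tensor_power_GL m n g * tensor_power_GL m n h) I J" .
qed (auto intro: mult_carrier_mat[OF tensor_power_GL_carrier tensor_power_GL_carrier])

lemma tensor_basis_eq_iff:
  "I \<in> tensor_basis m n \<Longrightarrow> J \<in> tensor_basis m n \<Longrightarrow> I = J \<longleftrightarrow> (\<forall>k\<in>{1..m}. I k = J k)"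
  unfolding tensor_basis_def by (metis PiE_ext)

lemma tensor_power_GL_diag:
  assumes "\<And>i j. i < n \<Longrightarrow> j < n \<Longrightarrow> g $$ (i, j) = (if i = j then u j else 0)"
    and IJ: "I \<in> tensor_basis m n" "J \<in> tensor_basis m n"
  shows "tentry m n (tensor_power_GL m n g) I J = (if I = J then \<Prod>k\<in>{1..m}. u (J k) else 0)"
proof -
  have mem: "K k < n" if "K \<in> tensor_basis m n" "k \<in> {1..m}" for K k
    using that by (auto simp: tensor_basis_def)
  have "tentry m n (tensor_power_GL m n g) I J = (\<Prod>k\<in>{1..m}. if I k = J k then u (J k) else 0)"
    unfolding tentry_GL[OF IJ] by (rule prod.cong[OF refl]) (use assms(1) mem IJ in auto)
  also have "\<dots> = (if I = J then \<Prod>k\<in>{1..m}. u (J k) else 0)"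
    unfolding tensor_basis_eq_iff[OF IJ] by (auto intro: prod_zero)
  finally show ?thesis .
qed

lemma tensor_power_GL_one: "tensor_power_GL m n (1\<^sub>m n) = 1\<^sub>m (tensor_dim m n)"
proof (rule entry_eqI[OF finite_tensor_basis finite_tensor_basis])
  fix I J assume IJ: "I \<in> tensor_basis m n" "J \<in> tensor_basis m n"
  have "tentry m n (tensor_power_GL m n (1\<^sub>m n)) I J = (if I = J then \<Prod>k\<in>{1..m}. 1 else 0)"
    by (rule tensor_power_GL_diag[OF _ IJ]) auto
  then show "tentry m n (tensor_power_GL m n (1\<^sub>m n)) I J = tentry m n (1\<^sub>m (tensor_dim m n)) I J"
    using IJ by (simp add: entry_one)
qed auto

text \<open>Membership in the commutant of the symmetric group.\<close>

abbreviation equivariant :: "nat \<Rightarrow> nat \<Rightarrow> complex mat \<Rightarrow> bool" where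
  "equivariant m n \<equiv> intertwiner (sym_group m) (tensor_dim m n) (tensor_power_sym m n)
    (tensor_dim m n) (tensor_power_sym m n)"

lemma sym_intertwinerI:
  assumes A: "A \<in> carrier_mat (tensor_dim m n) (tensor_dim m n)"
    and inv: "\<And>s I J. s permutes {1..m} \<Longrightarrow> I \<in> tensor_basis m n \<Longrightarrow> J \<in> tensor_basis m n \<Longrightarrow>
      tentry m n A (I \<circ> s) (J \<circ> s) = tentry m n A I J"
  shows "equivariant m n A"
  unfolding intertwiner_def
proof (intro conjI ballI A)
  fix s assume "s \<in> carrier (sym_group m)"
  then have s: "s permutes {1..m}" by (simp add: sym_group_carrier)
  show "A * tensor_power_sym m n s = tensor_power_sym m n s * A"
  proof (rule entry_eqI[OF finite_tensor_basis finite_tensor_basis])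
    fix I J assume IJ: "I \<in> tensor_basis m n" "J \<in> tensor_basis m n"
    have J': "J \<circ> inv' s \<in> tensor_basis m n" by (rule tensor_basis_comp_perm[OF permutes_inv[OF s] IJ(2)])
    have eq: "J \<circ> inv' s \<circ> s = J" using permutes_inv_o[OF s] by (simp add: comp_assoc)
    have "tentry m n A I (J \<circ> inv' s) = tentry m n A (I \<circ> s) J"
      using inv[OF s IJ(1) J'] unfolding eq by (rule sym)
    then show "tentry m n (A * tensor_power_sym m n s) I J = tentry m n (tensor_power_sym m n s * A) I J"
      using tentry_mult_sym[OF A s IJ(2) finite_tensor_basis refl IJ(1)]
        tentry_sym_mult[OF A s IJ(1) finite_tensor_basis refl IJ(2)] by (simp only:)
  qed (use A in \<open>auto intro: mult_carrier_mat[OF A tensor_power_sym_carrier] mult_carrier_mat[OF tensor_power_sym_carrier A]\<close>)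
qed

lemma sym_intertwinerD:
  assumes A: "equivariant m n A"
    and s: "s permutes {1..m}" and IJ: "I \<in> tensor_basis m n" "J \<in> tensor_basis m n"
  shows "tentry m n A (I \<circ> s) (J \<circ> s) = tentry m n A I J"
proof -
  note Ac = intertwinerD(1)[OF A]
  have Js: "J \<circ> s \<in> tensor_basis m n" by (rule tensor_basis_comp_perm[OF s IJ(2)])
  have "A * tensor_power_sym m n s = tensor_power_sym m n s * A"
    by (rule intertwinerD(2)[OF A]) (use s in \<open>simp add: sym_group_carrier\<close>)
  then have "tentry m n A I (J \<circ> s \<circ> inv' s) = tentry m n A (I \<circ> s) (J \<circ> s)"
    using tentry_mult_sym[OF Ac s Js finite_tensor_basis refl IJ(1)]
      tentry_sym_mult[OF Ac s IJ(1) finite_tensor_basis refl Js] by simp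
  moreover have "J \<circ> s \<circ> inv' s = J" using permutes_inv_o[OF s] by (simp add: comp_assoc)
  ultimately show ?thesis by simp
qed

lemma tensor_power_GL_intertwiner:
  "equivariant m n
    (tensor_power_GL m n g)"
proof (rule sym_intertwinerI)
  fix s I J assume s: "s permutes {1..m}" and IJ: "I \<in> tensor_basis m n" "J \<in> tensor_basis m n"
  have "(\<Prod>k\<in>{1..m}. g $$ (I (s k), J (s k))) = (\<Prod>k\<in>{1..m}. g $$ (I k, J k))"
    using prod.reindex_bij_betw[OF permutes_imp_bij[OF s], of "\<lambda>k. g $$ (I k, J k)"] by simp
  then show "tentry m n (tensor_power_GL m n g) (I \<circ> s) (J \<circ> s) = tentry m n (tensor_power_GL m n g) I J"
    using IJ tensor_basis_comp_perm[OF s] by (simp add: tentry_GL)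
qed simp

section \<open>Polarization and class functions\<close>

text \<open>Different terms \<open>p\<close> may carry the same monomial \<open>M p\<close>; they
  are collected before comparing coefficients, and a monomial that does not occur has an empty
  fibre.\<close>

lemma family_coeffs_zero:
  fixes b :: "'p \<Rightarrow> complex" and M :: "'p \<Rightarrow> 'a multiset"
  assumes S: "finite S" and Y: "finite Y" and M: "\<And>p. p \<in> S \<Longrightarrow> set_mset (M p) \<subseteq> Y"
    and z: "\<And>x. (\<And>y. y \<in> Y \<Longrightarrow> x y \<noteq> 0) \<Longrightarrow> (\<Sum>p\<in>S. b p * (\<Prod>y\<in>#M p. x y)) = 0"
  shows "(\<Sum>p\<in>{p \<in> S. M p = N}. b p) = 0"
proof (cases "N \<in> M ` S")
  case True
  let ?c = "\<lambda>N. \<Sum>p\<in>{p \<in> S. M p = N}. b p"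
  show ?thesis
  proof (rule multivariate_coeffs_zero[of Y "M ` S" ?c, OF Y _ _ _ True])
    fix x :: "'a \<Rightarrow> complex" assume x: "\<And>y. y \<in> Y \<Longrightarrow> x y \<noteq> 0"
    have "(\<Sum>N\<in>M ` S. ?c N * (\<Prod>y\<in>#N. x y)) = (\<Sum>N\<in>M ` S. \<Sum>p\<in>{p \<in> S. M p = N}. b p * (\<Prod>y\<in>#M p. x y))"
      by (simp add: sum_distrib_right)
    also have "\<dots> = (\<Sum>p\<in>S. b p * (\<Prod>y\<in>#M p. x y))" by (rule sum.image_gen[OF S, symmetric])
    finally show "(\<Sum>N\<in>M ` S. ?c N * (\<Prod>y\<in>#N. x y)) = 0" using z[OF x] by simp
  qed (use S M in auto)
next
  case False
  then have "{p \<in> S. M p = N} = {}" by auto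
  then show ?thesis by (simp only: sum.empty)
qed

lemma det_nonzero_GL: "g \<in> carrier_mat n n \<Longrightarrow> det g \<noteq> 0 \<Longrightarrow> g \<in> carrier (GL n)"
  unfolding GL_def units_of_def using det_non_zero_imp_unit[of g n "()"] by simp

text \<open>Only the finitely many eigenvalues of \<open>A\<close> are bad values of
  \<open>t\<close>. This is the density of invertible matrices in the form in which it is used
  below.\<close>

lemma eventually_shift_GL:
  assumes A: "A \<in> carrier_mat n n"
  shows "eventually (\<lambda>t. A - t \<cdot>\<^sub>m 1\<^sub>m n \<in> carrier (GL n)) (at 0)"
proof -
  let ?S = "{t. poly (char_poly A) t = 0}"
  have "char_poly A \<noteq> 0" using degree_monic_char_poly[OF A] by auto
  then have "finite (?S - {0})" using poly_roots_finite by blast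
  then have "open (- (?S - {0}))" by (intro open_Compl finite_imp_closed)
  moreover have "A - t \<cdot>\<^sub>m 1\<^sub>m n \<in> carrier (GL n)" if "t \<in> - (?S - {0})" "t \<noteq> 0" for t
  proof (rule det_nonzero_GL)
    have c: "t \<cdot>\<^sub>m 1\<^sub>m n \<in> carrier_mat n n" by simp
    show "A - t \<cdot>\<^sub>m 1\<^sub>m n \<in> carrier_mat n n" using c by (rule minus_carrier_mat)
    have "det (char_matrix A t) \<noteq> 0"
      using that eigenvalue_det[OF A] eigenvalue_root_char_poly[OF A] by auto
    moreover have "char_matrix A t = A - t \<cdot>\<^sub>m 1\<^sub>m n"
      using A by (intro eq_matI) (auto simp: char_matrix_def)
    ultimately show "det (A - t \<cdot>\<^sub>m 1\<^sub>m n) \<noteq> 0" by simp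
  qed
  ultimately show ?thesis unfolding eventually_at_topological by blast
qed

lemma isCont_zero_if_eventually_zero:
  fixes \<phi> :: "complex \<Rightarrow> complex"
  assumes "isCont \<phi> 0" "eventually (\<lambda>t. \<phi> t = c) (at 0)"
  shows "\<phi> 0 = c"
proof -
  have "(\<phi> \<longlongrightarrow> \<phi> 0) (at 0)" using assms(1) by (simp add: isCont_def)
  moreover have "(\<phi> \<longlongrightarrow> c) (at 0)" using assms(2) by (rule tendsto_eventually)
  ultimately show ?thesis by (rule tendsto_unique[OF at_neq_bot])
qed

text \<open>The entries of an equivariant matrix only depend on the multiset of index pairs, that is, on the
  monomial which the corresponding entry of \<open>tensor_power_GL\<close> is.\<close>

lemma polarization:
  assumes A: "equivariant m n A"
    and z: "\<And>g. g \<in> carrier (GL n) \<Longrightarrow>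
      (\<Sum>I\<in>tensor_basis m n. \<Sum>J\<in>tensor_basis m n. C I J * tentry m n (tensor_power_GL m n g) I J) = 0"
  shows "(\<Sum>I\<in>tensor_basis m n. \<Sum>J\<in>tensor_basis m n. C I J * tentry m n A I J) = 0"
proof -
  let ?B = "tensor_basis m n"
  define M where "M = (\<lambda>(I :: nat \<Rightarrow> nat, J :: nat \<Rightarrow> nat). image_mset (\<lambda>k. (I k, J k)) (mset_set {1..m}))"
  define S where "S = ?B \<times> ?B"
  have S: "finite S" by (simp add: S_def)
  have mem: "K k < n" if "K \<in> ?B" "k \<in> {1..m}" for K k
    using that by (auto simp: tensor_basis_def)
  have coeff: "(\<Sum>p\<in>{p \<in> S. M p = N}. C (fst p) (snd p)) = 0" for N
  proof (rule family_coeffs_zero[OF S, of "{..<n} \<times> {..<n}"])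
    show "finite ({..<n} \<times> {..<n})" by simp
    show "set_mset (M p) \<subseteq> {..<n} \<times> {..<n}" if "p \<in> S" for p
      using that mem by (auto simp: M_def S_def)
    fix x :: "nat \<times> nat \<Rightarrow> complex"
    define X where "X = mat n n x"
    have X: "X \<in> carrier_mat n n" by (simp add: X_def)
    \<comment> \<open>The hypothesis concerns invertible matrices only. The arbitrary matrix
      \<open>X\<close> is reached as the limit of its shifts for \<open>t \<rightarrow> 0\<close>,
      along which the sum is continuous.\<close>
    define \<phi> where "\<phi> = (\<lambda>t. \<Sum>I\<in>?B. \<Sum>J\<in>?B. C I J * (\<Prod>k\<in>{1..m}. x (I k, J k) - (if I k = J k then 1 else 0) * t))"
    have eq: "\<phi> t = (\<Sum>I\<in>?B. \<Sum>J\<in>?B. C I J * tentry m n (tensor_power_GL m n (X - t \<cdot>\<^sub>m 1\<^sub>m n)) I J)" for t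
      unfolding \<phi>_def
      by (intro sum.cong refl arg_cong2[of _ _ _ _ "(*)"])
        (auto simp: tentry_GL X_def mem intro!: prod.cong)
    have "eventually (\<lambda>t. \<phi> t = 0) (at 0)"
      using eventually_shift_GL[OF X] by eventually_elim (simp add: eq z)
    moreover have "isCont \<phi> 0" unfolding \<phi>_def
      by (intro continuous_intros)
    ultimately have "\<phi> 0 = 0" by (intro isCont_zero_if_eventually_zero)
    moreover have "(\<Sum>p\<in>S. C (fst p) (snd p) * (\<Prod>y\<in>#M p. x y)) = \<phi> 0"
      unfolding \<phi>_def S_def sum.cartesian_product
      by (intro sum.cong) (auto simp: M_def image_mset.compositionality comp_def prod_unfold_prod_mset)
    ultimately show "(\<Sum>p\<in>S. C (fst p) (snd p) * (\<Prod>y\<in>#M p. x y)) = 0" by simp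
  qed
  have const: "tentry m n A I J = tentry m n A I' J'"
    if IJ: "I \<in> ?B" "J \<in> ?B" "I' \<in> ?B" "J' \<in> ?B" and eq: "M (I, J) = M (I', J')" for I J I' J'
  proof -
    have "image_mset (\<lambda>k. (I k, J k)) (mset_set {1..m}) = image_mset (\<lambda>k. (I' k, J' k)) (mset_set {1..m})"
      using eq by (simp add: M_def)
    then obtain s where s: "s permutes {1..m}" "\<forall>k\<in>{1..m}. (I k, J k) = (I' (s k), J' (s k))"
      using image_mset_eq_implies_permutes[OF finite_atLeastAtMost] by blast
    have "I = I' \<circ> s" "J = J' \<circ> s"
      using s(2) tensor_basis_eq_iff[OF IJ(1) tensor_basis_comp_perm[OF s(1) IJ(3)]]
        tensor_basis_eq_iff[OF IJ(2) tensor_basis_comp_perm[OF s(1) IJ(4)]] by auto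
    then show ?thesis using sym_intertwinerD[OF A s(1) IJ(3,4)] by simp
  qed
  have "(\<Sum>I\<in>?B. \<Sum>J\<in>?B. C I J * tentry m n A I J) = (\<Sum>p\<in>S. C (fst p) (snd p) * tentry m n A (fst p) (snd p))"
    unfolding S_def sum.cartesian_product by (simp add: case_prod_unfold)
  also have "\<dots> = (\<Sum>N\<in>M ` S. \<Sum>p\<in>{p \<in> S. M p = N}. C (fst p) (snd p) * tentry m n A (fst p) (snd p))"
    by (rule sum.image_gen[OF S])
  also have "\<dots> = 0"
  proof (rule sum.neutral, rule ballI)
    fix N assume "N \<in> M ` S"
    then obtain p0 where p0: "p0 \<in> S" "N = M p0" by blast
    have "(\<Sum>p\<in>{p \<in> S. M p = N}. C (fst p) (snd p) * tentry m n A (fst p) (snd p))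
      = (\<Sum>p\<in>{p \<in> S. M p = N}. C (fst p) (snd p) * tentry m n A (fst p0) (snd p0))"
    proof (rule sum.cong[OF refl])
      fix p assume "p \<in> {p \<in> S. M p = N}"
      then have "tentry m n A (fst p) (snd p) = tentry m n A (fst p0) (snd p0)"
        by (intro const) (use p0 in \<open>auto simp: S_def\<close>)
      then show "C (fst p) (snd p) * tentry m n A (fst p) (snd p)
        = C (fst p) (snd p) * tentry m n A (fst p0) (snd p0)" by simp
    qed
    also have "\<dots> = (\<Sum>p\<in>{p \<in> S. M p = N}. C (fst p) (snd p)) * tentry m n A (fst p0) (snd p0)"
      by (simp add: sum_distrib_right)
    finally show "(\<Sum>p\<in>{p \<in> S. M p = N}. C (fst p) (snd p) * tentry m n A (fst p) (snd p)) = 0"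
      by (simp add: coeff)
  qed
  finally show ?thesis .
qed

text \<open>The trace against \<open>B\<close> is a linear form whose coefficients are the
  transposed entries of \<open>B\<close>, so \<open>polarization\<close> applies to it.\<close>

lemma polarization_trace:
  assumes A: "equivariant m n A" and B: "B \<in> carrier_mat (tensor_dim m n) (tensor_dim m n)"
    and z: "\<And>g. g \<in> carrier (GL n) \<Longrightarrow> trace_mat (tensor_power_GL m n g * B) = 0"
  shows "trace_mat (A * B) = 0"
proof -
  have tr: "trace_mat (A' * B) = (\<Sum>I\<in>tensor_basis m n. \<Sum>J\<in>tensor_basis m n. tentry m n B J I * tentry m n A' I J)"
    if "A' \<in> carrier_mat (tensor_dim m n) (tensor_dim m n)" for A'
    unfolding trace_mult_entry[OF finite_tensor_basis that B] by (simp add: mult.commute)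
  show ?thesis unfolding tr[OF intertwinerD(1)[OF A]]
    by (rule polarization[OF A]) (use z tr[OF tensor_power_GL_carrier] in simp)
qed

section \<open>Weights\<close>

text \<open>As a multiset of letters a weight is at the same time a monomial in the diagonal entries
  of a matrix.\<close>

definition weight :: "nat \<Rightarrow> (nat \<Rightarrow> nat) \<Rightarrow> nat multiset" where
  "weight m J = image_mset J (mset_set {1..m})"

text \<open>The content of the tableau of shape \<open>\<mu>\<close> whose \<open>i\<close>-th row is constantly \<open>i\<close>, rows numbered from 0.\<close>

definition shape_weight :: "nat list \<Rightarrow> nat multiset" where
  "shape_weight \<mu> = image_mset fst (mset_set (young_diagram \<mu>))"

lemma finite_young_diagram [simp]: "finite (young_diagram \<mu>)"
proof -
  have "young_diagram \<mu> = (SIGMA i:{..<length \<mu>}. {..<\<mu> ! i})"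
    by (auto simp: young_diagram_def)
  then show ?thesis by simp
qed

lemma count_image_mset_set:
  "finite A \<Longrightarrow> count (image_mset f (mset_set A)) y = card {x \<in> A. f x = y}"
  by (simp add: count_image_mset' card_eq_sum[symmetric] conj_commute eq_commute cong: conj_cong)

lemma count_weight: "count (weight m J) i = card {k \<in> {1..m}. J k = i}"
  unfolding weight_def by (rule count_image_mset_set) simp

lemma count_shape_weight: "count (shape_weight \<mu>) i = (if i < length \<mu> then \<mu> ! i else 0)"
proof -
  have "count (shape_weight \<mu>) i = card {x \<in> young_diagram \<mu>. fst x = i}"
    unfolding shape_weight_def by (rule count_image_mset_set) simp
  also have "{x \<in> young_diagram \<mu>. fst x = i} = (if i < length \<mu> then Pair i ` {..<\<mu> ! i} else {})"
    by (auto simp: young_diagram_def)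
  also have "card \<dots> = (if i < length \<mu> then \<mu> ! i else 0)"
    by (simp add: card_image inj_on_def)
  finally show ?thesis .
qed

lemma size_weight [simp]: "size (weight m J) = m"
  by (simp add: weight_def)

lemma tensor_basis_mem: "J \<in> tensor_basis m n \<Longrightarrow> k \<in> {1..m} \<Longrightarrow> J k < n"
  by (auto simp: tensor_basis_def)

lemma weight_subset: "J \<in> tensor_basis m n \<Longrightarrow> set_mset (weight m J) \<subseteq> {..<n}"
  using tensor_basis_mem[of J m n] by (auto simp: weight_def)

text \<open>The multiplicity of \<open>i\<close> is the part in row \<open>i\<close>. A zero part
  could not be told from a missing row, hence the condition on both lists.\<close>

lemma shape_weight_inj:
  assumes "0 \<notin> set \<mu>" "0 \<notin> set \<nu>" "shape_weight \<mu> = shape_weight \<nu>"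
  shows "\<mu> = \<nu>"
proof -
  have c: "(if i < length \<mu> then \<mu> ! i else 0) = (if i < length \<nu> then \<nu> ! i else 0)" for i
    using assms(3) count_shape_weight by metis
  have pos: "\<mu> ! i \<noteq> 0" if "i < length \<mu>" for i using assms(1) nth_mem[OF that] by metis
  have pos': "\<nu> ! i \<noteq> 0" if "i < length \<nu>" for i using assms(2) nth_mem[OF that] by metis
  have "i < length \<mu> \<longleftrightarrow> i < length \<nu>" for i using c[of i] pos[of i] pos'[of i] by (auto split: if_splits)
  then have "length \<mu> = length \<nu>" by (metis linorder_neqE_nat less_irrefl)
  then show ?thesis
  proof (rule nth_equalityI)
    fix i assume "i < length \<mu>"
    then show "\<mu> ! i = \<nu> ! i" using c[of i] \<open>length \<mu> = length \<nu>\<close> by simp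
  qed
qed

text \<open>In a decreasing list the zeros form a tail, so removing them shifts no index.\<close>

lemma nth_filter_nonzero:
  "sorted_wrt (\<ge>) xs \<Longrightarrow> i < length xs \<Longrightarrow>
    xs ! i = (if i < length (filter (\<lambda>z. z \<noteq> 0) xs) then filter (\<lambda>z. z \<noteq> 0) xs ! i else (0 :: nat))"
proof (induction xs arbitrary: i)
  case (Cons x xs)
  show ?case
  proof (cases "x = 0")
    case True
    then have all0: "\<forall>y\<in>set (x # xs). y = 0" using Cons.prems(1) by auto
    then have "filter (\<lambda>z. z \<noteq> 0) (x # xs) = []" by (simp add: filter_empty_conv)
    moreover have "(x # xs) ! i = 0" using all0 nth_mem[OF Cons.prems(2)] by blast
    ultimately show ?thesis by simp
  next
    case False
    then show ?thesis using Cons by (cases i) auto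
  qed
qed simp

text \<open>Every weight is conjugate to a dominant one: a permutation of the letters sorts the
  multiplicities in decreasing order, and the sorted list without its zeros is the
  partition.\<close>

lemma partition_of_weight:
  assumes J: "J \<in> tensor_basis m n"
  obtains \<mu> \<pi> where "\<mu> \<in> partitions_at_most m n" "\<pi> permutes {..<n}"
    "image_mset \<pi> (weight m J) = shape_weight \<mu>"
proof -
  let ?a = "count (weight m J)"
  define xs where "xs = rev (sort (map ?a [0..<n]))"
  define \<mu> where "\<mu> = filter (\<lambda>z. z \<noteq> 0) xs"
  have len: "length xs = n" by (simp add: xs_def)
  have srt: "sorted_wrt (\<ge>) xs" by (simp add: xs_def sorted_wrt_rev)
  have mset_xs: "mset xs = image_mset ?a (mset_set {..<n})"
    by (simp add: xs_def lessThan_atLeast0 mset_set_upto_eq_mset_upto[symmetric])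
  have "image_mset (\<lambda>i. xs ! i) (mset_set {..<n}) = mset (map (\<lambda>i. xs ! i) [0..<n])"
    by (simp add: lessThan_atLeast0 mset_set_upto_eq_mset_upto[symmetric])
  also have "map (\<lambda>i. xs ! i) [0..<n] = xs" using map_nth[of xs] len by simp
  finally have "image_mset ?a (mset_set {..<n}) = image_mset (\<lambda>i. xs ! i) (mset_set {..<n})"
    using mset_xs by simp
  then obtain \<pi> where \<pi>: "\<pi> permutes {..<n}" "\<forall>x\<in>{..<n}. ?a x = xs ! \<pi> x"
    using image_mset_eq_implies_permutes[OF finite_lessThan] by blast
  have nth: "xs ! i = (if i < length \<mu> then \<mu> ! i else 0)" if "i < n" for i
    unfolding \<mu>_def by (rule nth_filter_nonzero[OF srt]) (use that len in simp)
  have len\<mu>: "length \<mu> \<le> n" using len length_filter_le[of "\<lambda>z. z \<noteq> 0" xs] by (simp add: \<mu>_def)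
  have "sum_list \<mu> = sum_list xs" unfolding \<mu>_def by (induction xs) auto
  also have "\<dots> = (\<Sum>i<n. ?a i)"
    using mset_xs by (simp flip: sum_mset_sum_list add: sum_unfold_sum_mset)
  also have "\<dots> = (\<Sum>i\<in>set_mset (weight m J). ?a i)"
    using weight_subset[OF J] by (intro sum.mono_neutral_right) (auto simp: not_in_iff)
  also have "\<dots> = m" using size_multiset_overloaded_eq[of "weight m J"] by simp
  finally have sum: "sum_list \<mu> = m" .
  have "\<mu> \<in> partitions_at_most m n"
    using srt len\<mu> sum by (auto simp: partitions_at_most_def partitions_def \<mu>_def sorted_wrt_filter)
  moreover have "image_mset \<pi> (weight m J) = shape_weight \<mu>"
  proof (rule multiset_eqI)
    fix i
    obtain x where x: "i = \<pi> x" using permutes_surj[OF \<pi>(1)] by (meson surj_def)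
    have "count (image_mset \<pi> W) (\<pi> x) = count W x" for W
      using permutes_inj[OF \<pi>(1)] by (induction W) (auto dest: injD)
    then have cnt: "count (image_mset \<pi> (weight m J)) i = ?a x" by (simp add: x)
    show "count (image_mset \<pi> (weight m J)) i = count (shape_weight \<mu>) i"
    proof (cases "x < n")
      case True
      then have "i < n" using permutes_in_image[OF \<pi>(1), of x] x by simp
      moreover have "?a x = xs ! i" using \<pi>(2) True x by simp
      ultimately show ?thesis unfolding cnt count_shape_weight using nth by simp
    next
      case False
      then have "i = x" using permutes_not_in[OF \<pi>(1), of x] x by simp
      moreover have "?a x = 0" using False weight_subset[OF J] by (auto simp: not_in_iff[symmetric])
      ultimately show ?thesis unfolding cnt count_shape_weight using False len\<mu> by simp
    qed
  qed
  ultimately show thesis using \<pi>(1) that by blast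
qed

text \<open>\<open>B\<close> commutes with the image of \<open>S\<close>, so cyclicity of the trace
  cancels the conjugation.\<close>

lemma conjugate_trace:
  assumes B: "B \<in> carrier_mat (tensor_dim m n) (tensor_dim m n)"
    and comm: "\<And>g. g \<in> carrier (GL n) \<Longrightarrow> tensor_power_GL m n g * B = B * tensor_power_GL m n g"
    and S: "S \<in> carrier_mat n n" "S' \<in> carrier_mat n n" "S * S' = 1\<^sub>m n" "S' * S = 1\<^sub>m n"
    and U: "U \<in> carrier_mat n n"
  shows "trace_mat (tensor_power_GL m n (S * U * S') * B) = trace_mat (tensor_power_GL m n U * B)"
proof -
  let ?T = "tensor_power_GL m n" and ?N = "tensor_dim m n"
  have c: "?T g \<in> carrier_mat ?N ?N" for g by simp
  note [simp] = carrier_matD[OF c] carrier_matD[OF B]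
  have SG: "S \<in> carrier (GL n)" using S by (auto simp: GL_carrier_iff)
  have "?T (S * U * S') * B = ?T S * (?T U * (?T S' * B))"
    using tensor_power_GL_mult[OF mult_carrier_mat[OF S(1) U] S(2)] tensor_power_GL_mult[OF S(1) U]
    by (simp add: mat_assoc)
  then have "trace_mat (?T (S * U * S') * B) = trace_mat (?T U * (?T S' * B) * ?T S)"
    using trace_mat_mult_comm[OF c[of S] mult_carrier_mat[OF c[of U] mult_carrier_mat[OF c[of S'] B]]] by simp
  also have "?T U * (?T S' * B) * ?T S = ?T U * (?T S' * (?T S * B))"
    by (simp add: mat_assoc comm[OF SG])
  also have "\<dots> = ?T U * (?T S' * ?T S * B)" by (simp add: mat_assoc)
  also have "?T S' * ?T S = 1\<^sub>m ?N"
    using tensor_power_GL_mult[OF S(2,1)] S(4) tensor_power_GL_one by simp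
  finally show ?thesis using left_mult_one_mat[OF B] by simp
qed

text \<open>The permutation matrix of \<open>\<pi>\<close> is invertible and relabels the letters of
  basis vectors. Commuting with its image makes the entries of \<open>B\<close> invariant under
  relabelling, which acts on weights by \<open>\<pi>\<close>.\<close>

lemma weight_sum_permute:
  assumes B: "B \<in> carrier_mat (tensor_dim m n) (tensor_dim m n)"
    and comm: "\<And>g. g \<in> carrier (GL n) \<Longrightarrow> tensor_power_GL m n g * B = B * tensor_power_GL m n g"
    and \<pi>: "\<pi> permutes {..<n}"
  shows "(\<Sum>J\<in>{J \<in> tensor_basis m n. weight m J = image_mset \<pi> M}. tentry m n B J J)
    = (\<Sum>J\<in>{J \<in> tensor_basis m n. weight m J = M}. tentry m n B J J)"
proof -
  let ?B = "tensor_basis m n" and ?N = "tensor_dim m n"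
  define P :: "complex mat" where "P = mat n n (\<lambda>(i, j). if i = \<pi> j then 1 else 0)"
  define P' :: "complex mat" where "P' = mat n n (\<lambda>(i, j). if j = \<pi> i then 1 else 0)"
  have P: "P \<in> carrier_mat n n" "P' \<in> carrier_mat n n" by (auto simp: P_def P'_def)
  have inj: "\<pi> x = \<pi> y \<longleftrightarrow> x = y" for x y using permutes_inj[OF \<pi>] by (auto dest: injD)
  have "P' * P = 1\<^sub>m n"
  proof (rule eq_matI)
    fix i j assume "i < dim_row (1\<^sub>m n)" "j < dim_col (1\<^sub>m n)"
    then have ij: "i < n" "j < n" by auto
    have \<pi>i: "\<pi> i < n" using ij permutes_in_image[OF \<pi>, of i] by simp
    have "(P' * P) $$ (i, j) = (\<Sum>r<n. if r = \<pi> i then (if r = \<pi> j then 1 else 0) else 0)"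
      unfolding mat_mult_index[OF P(2,1) ij] by (rule sum.cong) (use ij in \<open>auto simp: P_def P'_def\<close>)
    also have "\<dots> = (if i = j then 1 else 0)" using \<pi>i by (simp add: inj)
    finally show "(P' * P) $$ (i, j) = 1\<^sub>m n $$ (i, j)" using ij by simp
  qed (use P in auto)
  moreover from this have "P * P' = 1\<^sub>m n" by (rule mat_mult_left_right_inverse[OF P(2,1)])
  ultimately have PG: "P \<in> carrier (GL n)" using P by (auto simp: GL_carrier_iff)
  \<comment> \<open>Restriction to the positions keeps the relabelled map in the extensional
    function space that serves as basis.\<close>
  define a where "a = (\<lambda>J. restrict (\<lambda>k. \<pi> (J k)) {1..m})"
  define a' where "a' = (\<lambda>J. restrict (\<lambda>k. inv' \<pi> (J k)) {1..m})"
  have aB: "a J \<in> ?B" and a'B: "a' J \<in> ?B" if "J \<in> ?B" for J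
    using tensor_basis_mem[OF that] permutes_in_image[OF \<pi>] permutes_in_image[OF permutes_inv[OF \<pi>]]
    by (auto simp: a_def a'_def tensor_basis_def)
  have aa': "a (a' J) = J" "a' (a J) = J" if "J \<in> ?B" for J
    using that permutes_inverses[OF \<pi>]
    by (auto simp: a_def a'_def tensor_basis_def fun_eq_iff PiE_def extensional_def)
  have TP: "tentry m n (tensor_power_GL m n P) I J = (if I = a J then 1 else 0)"
    if IJ: "I \<in> ?B" "J \<in> ?B" for I J
  proof -
    have "tentry m n (tensor_power_GL m n P) I J = (\<Prod>k\<in>{1..m}. if I k = a J k then 1 else 0)"
      unfolding tentry_GL[OF IJ]
      by (rule prod.cong) (use tensor_basis_mem[OF IJ(1)] tensor_basis_mem[OF IJ(2)] in \<open>auto simp: P_def a_def\<close>)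
    also have "\<dots> = (if I = a J then 1 else 0)"
      unfolding tensor_basis_eq_iff[OF IJ(1) aB[OF IJ(2)]] by (auto intro: prod_zero)
    finally show ?thesis .
  qed
  have entries: "tentry m n B (a I) (a J) = tentry m n B I J" if IJ: "I \<in> ?B" "J \<in> ?B" for I J
  proof -
    have "tentry m n (tensor_power_GL m n P * B) (a I) J
      = (\<Sum>K\<in>?B. tentry m n (tensor_power_GL m n P) (a I) K * tentry m n B K J)"
      by (rule entry_mult) (use IJ B aB in auto)
    also have "\<dots> = (\<Sum>K\<in>?B. if K = I then tentry m n B K J else 0)"
      using TP[OF aB[OF IJ(1)]] aa'(2) IJ by (intro sum.cong refl) (auto, metis)
    also have "\<dots> = tentry m n B I J" using IJ by simp
    finally have 1: "tentry m n (tensor_power_GL m n P * B) (a I) J = tentry m n B I J" .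
    have "tentry m n (B * tensor_power_GL m n P) (a I) J
      = (\<Sum>K\<in>?B. tentry m n B (a I) K * tentry m n (tensor_power_GL m n P) K J)"
      by (rule entry_mult) (use IJ B aB in auto)
    also have "\<dots> = (\<Sum>K\<in>?B. if K = a J then tentry m n B (a I) K else 0)"
      by (rule sum.cong) (use TP IJ in auto)
    also have "\<dots> = tentry m n B (a I) (a J)" using IJ aB by simp
    finally show ?thesis using 1 comm[OF PG] by simp
  qed
  have wa: "weight m (a J) = image_mset \<pi> (weight m J)" for J
    unfolding weight_def image_mset.compositionality by (rule image_mset_cong) (simp add: a_def)
  have inj_im: "image_mset \<pi> A = image_mset \<pi> A' \<Longrightarrow> A = A'" for A A' :: "nat multiset"
    using permutes_inj[OF \<pi>] by (metis inj_def multiset.inj_map)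
  show ?thesis
  proof (rule sum.reindex_bij_witness[of _ a a'])
    fix J assume J: "J \<in> {J \<in> ?B. weight m J = image_mset \<pi> M}"
    then show "a (a' J) = J" using aa' by simp
    have "image_mset \<pi> (weight m (a' J)) = image_mset \<pi> M" using wa[of "a' J"] aa' J by simp
    then show "a' J \<in> {J \<in> ?B. weight m J = M}" using inj_im a'B J by simp
    show "tentry m n B (a' J) (a' J) = tentry m n B J J"
      using entries[OF a'B a'B, of J J] aa' J by simp
  qed (use aa' aB wa in auto)
qed

text \<open>Every matrix is conjugate to an upper triangular one, and conjugation with
  \<open>diag(1, t, t\<^sup>2, \<dots>)\<close> for \<open>t \<rightarrow> 0\<close> moves an upper triangular matrix to its diagonal part.
  So a class function which is polynomial in the matrix entries is determined on diagonal matrices, where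
  it is a symmetric polynomial and hence given by its coefficients at the dominant weights.\<close>

lemma class_function_zero:
  assumes B: "B \<in> carrier_mat (tensor_dim m n) (tensor_dim m n)"
    and comm: "\<And>g. g \<in> carrier (GL n) \<Longrightarrow> tensor_power_GL m n g * B = B * tensor_power_GL m n g"
    and zero: "\<And>\<mu>. \<mu> \<in> partitions_at_most m n \<Longrightarrow>
      (\<Sum>J\<in>{J \<in> tensor_basis m n. weight m J = shape_weight \<mu>}. tentry m n B J J) = 0"
    and g: "g \<in> carrier (GL n)"
  shows "trace_mat (tensor_power_GL m n g * B) = 0"
proof -
  let ?B = "tensor_basis m n" and ?T = "tensor_power_GL m n"
  note gc = GL_carrierD[OF g]
  obtain es where es: "char_poly g = (\<Prod>a\<leftarrow>es. [:- a, 1:])"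
    using char_poly_factorized[OF gc] by blast
  obtain U where U: "U \<in> carrier_mat n n" "upper_triangular U" "similar_mat g U"
    using schur_decomposition_exists[OF gc es] by blast
  obtain S S' where wit: "similar_mat_wit g U S S'" using U(3) unfolding similar_mat_def by blast
  then have S: "S \<in> carrier_mat n n" "S' \<in> carrier_mat n n" "S * S' = 1\<^sub>m n" "S' * S = 1\<^sub>m n"
      "g = S * U * S'"
    using gc unfolding similar_mat_wit_def Let_def by auto
  have low: "U $$ (i, j) = 0" if "j < i" "i < n" for i j
    using U(1,2) that by (auto simp: upper_triangular_def)
  \<comment> \<open>For \<open>t = 0\<close> the convention \<open>0 ^ 0 = 1\<close> leaves exactly
    the diagonal of \<open>U\<close>; for other \<open>t\<close> this is the conjugate of
    \<open>U\<close> by a diagonal matrix.\<close>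
  define Ut where "Ut = (\<lambda>t. mat n n (\<lambda>(i, j). if j < i then 0 else t ^ (j - i) * U $$ (i, j)))"
  have Ut: "Ut t \<in> carrier_mat n n" for t by (simp add: Ut_def)
  define \<phi> where "\<phi> = (\<lambda>t. \<Sum>I\<in>?B. \<Sum>J\<in>?B.
    (\<Prod>k\<in>{1..m}. if J k < I k then 0 else t ^ (J k - I k) * U $$ (I k, J k)) * tentry m n B J I)"
  have \<phi>: "trace_mat (?T (Ut t) * B) = \<phi> t" for t
    unfolding trace_mult_entry[OF finite_tensor_basis tensor_power_GL_carrier B] \<phi>_def
    by (intro sum.cong refl arg_cong2[of _ _ _ _ "(*)"])
      (auto simp: tentry_GL Ut_def tensor_basis_mem intro!: prod.cong)
  have conj: "\<phi> t = trace_mat (?T U * B)" if t: "t \<noteq> 0" for t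
  proof -
    define D where "D = mat_diag n (\<lambda>i. t ^ i)"
    define D' where "D' = mat_diag n (\<lambda>i. inverse (t ^ i))"
    have D: "D \<in> carrier_mat n n" "D' \<in> carrier_mat n n" by (auto simp: D_def D'_def)
    have DD': "D * D' = 1\<^sub>m n" "D' * D = 1\<^sub>m n"
      unfolding D_def D'_def using t by (auto simp: mat_diag_diag intro!: eq_matI)
    have "D' * U * D = Ut t"
    proof (rule eq_matI)
      fix i j assume "i < dim_row (Ut t)" "j < dim_col (Ut t)"
      then have ij: "i < n" "j < n" using Ut[of t] by auto
      have "D' * U * D = mat n n (\<lambda>(i, j). (D' * U) $$ (i, j) * t ^ j)"
        unfolding D_def by (rule mat_diag_mult_right[OF mult_carrier_mat[OF D(2) U(1)]])
      moreover have "D' * U = mat n n (\<lambda>(i, j). inverse (t ^ i) * U $$ (i, j))"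
        unfolding D'_def by (rule mat_diag_mult_left[OF U(1)])
      ultimately have eq: "(D' * U * D) $$ (i, j) = inverse (t ^ i) * U $$ (i, j) * t ^ j"
        using ij by simp
      show "(D' * U * D) $$ (i, j) = Ut t $$ (i, j)"
      proof (cases "j < i")
        case True
        then show ?thesis using eq low[of j i] ij by (simp add: Ut_def)
      next
        case False
        then have "t ^ j = t ^ i * t ^ (j - i)" by (simp flip: power_add)
        then show ?thesis using eq False ij t by (simp add: Ut_def field_simps)
      qed
    qed (use D carrier_matD[OF Ut[of t]] in auto)
    then show ?thesis using conjugate_trace[OF B comm D(2,1) DD'(2,1) U(1)] \<phi>[of t] by simp
  qed
  have "isCont (\<lambda>t. if J k < I k then 0 else t ^ (J k - I k) * U $$ (I k, J k)) 0" for I J :: "nat \<Rightarrow> nat" and k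
    by (cases "J k < I k") (auto intro!: continuous_intros)
  then have "isCont \<phi> 0" unfolding \<phi>_def by (intro continuous_intros)
  moreover have "eventually (\<lambda>t. \<phi> t = trace_mat (?T U * B)) (at 0)"
    unfolding eventually_at_filter by (simp add: conj)
  ultimately have "\<phi> 0 = trace_mat (?T U * B)" by (rule isCont_zero_if_eventually_zero)
  moreover have "\<phi> 0 = 0"
  proof -
    have "\<phi> 0 = (\<Sum>I\<in>?B. \<Sum>J\<in>?B. tentry m n (?T (Ut 0)) I J * tentry m n B J I)"
      using \<phi>[of 0] unfolding trace_mult_entry[OF finite_tensor_basis tensor_power_GL_carrier B] by simp
    also have "\<dots> = (\<Sum>I\<in>?B. \<Sum>J\<in>?B. if J = I then (\<Prod>k\<in>{1..m}. U $$ (J k, J k)) * tentry m n B J I else 0)"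
      by (intro sum.cong refl, subst tensor_power_GL_diag[where u = "\<lambda>j. U $$ (j, j)"])
        (auto simp: Ut_def)
    also have "\<dots> = (\<Sum>J\<in>?B. (\<Prod>i\<in>#weight m J. U $$ (i, i)) * tentry m n B J J)"
      by (intro sum.cong refl)
        (simp add: weight_def image_mset.compositionality comp_def prod_unfold_prod_mset)
    also have "\<dots> = (\<Sum>M\<in>weight m ` ?B. \<Sum>J\<in>{J \<in> ?B. weight m J = M}.
        (\<Prod>i\<in>#weight m J. U $$ (i, i)) * tentry m n B J J)"
      by (rule sum.image_gen) simp
    also have "\<dots> = (\<Sum>M\<in>weight m ` ?B. (\<Prod>i\<in>#M. U $$ (i, i)) *
        (\<Sum>J\<in>{J \<in> ?B. weight m J = M}. tentry m n B J J))"
      by (simp add: sum_distrib_left)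
    also have "\<dots> = 0"
    proof (rule sum.neutral, rule ballI)
      fix M assume "M \<in> weight m ` ?B"
      then obtain J where J: "J \<in> ?B" "M = weight m J" by blast
      obtain \<mu> \<pi> where \<mu>: "\<mu> \<in> partitions_at_most m n" "\<pi> permutes {..<n}"
          "image_mset \<pi> (weight m J) = shape_weight \<mu>"
        using partition_of_weight[OF J(1)] .
      show "(\<Prod>i\<in>#M. U $$ (i, i)) * (\<Sum>J\<in>{J \<in> ?B. weight m J = M}. tentry m n B J J) = 0"
        using weight_sum_permute[OF B comm \<mu>(2), of M] zero[OF \<mu>(1)] \<mu>(3) J(2) by simp
    qed
    finally show ?thesis .
  qed
  ultimately show ?thesis using conjugate_trace[OF B comm S(1-4) U(1)] S(5) by simp
qed

section \<open>Dominance\<close>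

text \<open>The dominance order, read off multisets: the sizes are the partial sums of the
  multiplicities. Weights that are not decreasing are compared as well.\<close>

definition dominated :: "nat multiset \<Rightarrow> nat multiset \<Rightarrow> bool" where
  "dominated A M \<longleftrightarrow> (\<forall>k. size (filter_mset (\<lambda>i. i < k) A) \<le> size (filter_mset (\<lambda>i. i < k) M))"

text \<open>The sum of all partial sums increases strictly along dominance; it supplies the
  numerical rank for \<open>triangular_system\<close>.\<close>

definition dominance_rank :: "nat \<Rightarrow> nat multiset \<Rightarrow> nat" where
  "dominance_rank n A = (\<Sum>k\<le>n. size (filter_mset (\<lambda>i. i < k) A))"

lemma size_filter_less_Suc:
  "size (filter_mset (\<lambda>i. i < Suc k) A) = size (filter_mset (\<lambda>i. i < k) A) + count A k"
  by (induction A) auto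

text \<open>Multiplicities are differences of consecutive partial sums.\<close>

lemma dominated_antisym: "dominated A M \<Longrightarrow> dominated M A \<Longrightarrow> A = M"
  by (rule multiset_eqI) (metis add_left_cancel dominated_def le_antisym size_filter_less_Suc)

text \<open>The letters lie below \<open>n\<close>, so the partial sums up to \<open>n\<close>
  determine the multiset; if all of them agreed, so would the multisets.\<close>

lemma dominated_rank_less:
  assumes dom: "dominated A M" and neq: "A \<noteq> M" and sub: "set_mset A \<subseteq> {..<n}" "set_mset M \<subseteq> {..<n}"
  shows "dominance_rank n A < dominance_rank n M"
  unfolding dominance_rank_def
proof (rule sum_strict_mono_ex1)
  let ?s = "\<lambda>A k. size (filter_mset (\<lambda>i. i < k) (A :: nat multiset))"
  show "\<forall>k\<in>{..n}. ?s A k \<le> ?s M k" using dom by (auto simp: dominated_def)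
  show "\<exists>k\<in>{..n}. ?s A k < ?s M k"
  proof (rule ccontr)
    assume "\<not> ?thesis"
    then have eq: "?s A k = ?s M k" if "k \<le> n" for k
      using dom that unfolding dominated_def by (metis atMost_iff le_neq_implies_less)
    have "count A i = count M i" for i
    proof (cases "i < n")
      case True
      then show ?thesis using eq[of i] eq[of "Suc i"] size_filter_less_Suc[of i] by simp
    next
      case False
      then show ?thesis using sub by (metis lessThan_iff not_in_iff subsetD)
    qed
    with neq show False by (simp add: multiset_eq_iff)
  qed
qed simp

lemma size_filter_image_mset_set:
  assumes "finite A"
  shows "size (filter_mset P (image_mset f (mset_set A))) = card {x \<in> A. P (f x)}"
  using assms
proof (induction rule: finite_induct)
  case (insert a A)
  have "{x \<in> insert a A. P (f x)} = (if P (f a) then insert a {x \<in> A. P (f x)} else {x \<in> A. P (f x)})"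
    by auto
  then show ?case using insert by simp
qed simp

section \<open>Young diagrams, conjugate partitions and tableaux\<close>

lemma size_filter_shape_weight:
  "size (filter_mset (\<lambda>i. i < k) (shape_weight \<mu>)) = card {c \<in> young_diagram \<mu>. fst c < k}"
  unfolding shape_weight_def by (rule size_filter_image_mset_set) simp

lemma partitions_nth_mono:
  assumes "\<mu> \<in> partitions m" "i \<le> j" "j < length \<mu>"
  shows "\<mu> ! j \<le> \<mu> ! i"
proof (cases "i = j")
  case False
  then show ?thesis using assms unfolding partitions_def
    by (auto simp: sorted_wrt_iff_nth_less)
qed simp

text \<open>The boxes in the first \<open>k\<close> rows are counted column by column. The parts
  decrease, so a column is an initial segment of rows, and the minimum of its length and
  \<open>k\<close> is the number of its boxes among the first \<open>k\<close> rows.\<close>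

lemma conjugate_sum_bound:
  assumes \<mu>: "\<mu> \<in> partitions m"
  shows "(\<Sum>i<length (conjugate_partition \<mu>). min (conjugate_partition \<mu> ! i) k)
    \<le> size (filter_mset (\<lambda>i. i < k) (shape_weight \<mu>))"
proof -
  define L where "L = length (conjugate_partition \<mu>)"
  \<comment> \<open>\<open>C i\<close> is the set of rows that meet column \<open>i\<close>. Columns
    are numbered from 0 here, whereas \<open>conjugate_partition\<close> runs over thresholds
    starting at 1.\<close>
  define C where "C = (\<lambda>i. {j. j < length \<mu> \<and> \<mu> ! j \<ge> Suc i})"
  have finC: "finite (C i)" for i by (simp add: C_def)
  have nth: "conjugate_partition \<mu> ! i = card (C i)" if "i < L" for i
    using that by (simp add: L_def conjugate_partition_def C_def del: upt_Suc)
  have "min (card (C i)) k \<le> card (C i \<inter> {..<k})" for i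
  proof -
    have down: "j' \<in> C i" if "j \<in> C i" "j' \<le> j" for j j'
      using partitions_nth_mono[OF \<mu> that(2)] that by (auto simp: C_def)
    show ?thesis
    proof (cases "C i \<subseteq> {..<k}")
      case True
      then show ?thesis by (simp add: Int_absorb2)
    next
      case False
      then obtain j where "j \<in> C i" "k \<le> j" by (metis lessThan_iff not_le subsetI)
      then have "{..<k} \<subseteq> C i" using down[of j] by auto
      then have "C i \<inter> {..<k} = {..<k}" by blast
      then show ?thesis by simp
    qed
  qed
  then have "(\<Sum>i<L. min (conjugate_partition \<mu> ! i) k) \<le> (\<Sum>i<L. card (C i \<inter> {..<k}))"
    by (intro sum_mono) (simp add: nth)
  also have "\<dots> = card (SIGMA i:{..<L}. C i \<inter> {..<k})" using finC by (simp add: card_SigmaI)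
  also have "\<dots> \<le> card {c \<in> young_diagram \<mu>. fst c < k}"
  proof (rule card_inj_on_le[where f = prod.swap])
    show "finite {c \<in> young_diagram \<mu>. fst c < k}" by simp
  qed (auto simp: C_def young_diagram_def)
  finally show ?thesis unfolding L_def size_filter_shape_weight .
qed

text \<open>Column entries start at 1 or higher and increase strictly. Rows are numbered from 0 and
  letters from 1, hence the \<open>Suc\<close>.\<close>

lemma tableau_lower_bound:
  assumes \<mu>: "\<mu> \<in> partitions m" and T: "T \<in> ssyt \<mu> n" and ij: "(i, j) \<in> young_diagram \<mu>"
  shows "Suc i \<le> T (i, j)"
  using ij
proof (induction i)
  case 0
  then have "T (0, j) \<in> {1..n}" using T unfolding ssyt_def by blast
  then show ?case by simp
next
  case (Suc i)
  then have d: "(i, j) \<in> young_diagram \<mu>"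
    using partitions_nth_mono[OF \<mu>, of i "Suc i"] by (auto simp: young_diagram_def)
  have "\<forall>i i' j. (i, j) \<in> young_diagram \<mu> \<and> (i', j) \<in> young_diagram \<mu> \<and> i < i' \<longrightarrow> T (i, j) < T (i', j)"
    using T unfolding ssyt_def by blast
  then have "T (i, j) < T (Suc i, j)" using d Suc.prems by blast
  then show ?case using Suc.IH[OF d] by simp
qed

text \<open>By \<open>tableau_lower_bound\<close>, a letter that is at most \<open>k\<close> can
  only stand in the first \<open>k\<close> rows.\<close>

lemma tableau_content_dominated:
  assumes \<mu>: "\<mu> \<in> partitions m" and T: "T \<in> ssyt \<mu> n"
    and content: "image_mset T (mset_set (young_diagram \<mu>)) = image_mset Suc A"
  shows "dominated A (shape_weight \<mu>)"
  unfolding dominated_def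
proof
  fix k
  have "size (filter_mset (\<lambda>i. i < k) A) = size (filter_mset (\<lambda>i. i < Suc k) (image_mset Suc A))"
    by (induction A) auto
  also have "\<dots> = card {c \<in> young_diagram \<mu>. T c < Suc k}"
    unfolding content[symmetric] by (rule size_filter_image_mset_set) simp
  also have "\<dots> \<le> card {c \<in> young_diagram \<mu>. fst c < k}"
  proof (rule card_mono)
    show "{c \<in> young_diagram \<mu>. T c < Suc k} \<subseteq> {c \<in> young_diagram \<mu>. fst c < k}"
      using tableau_lower_bound[OF \<mu> T] by fastforce
  qed simp
  finally show "size (filter_mset (\<lambda>i. i < k) A) \<le> size (filter_mset (\<lambda>i. i < k) (shape_weight \<mu>))"
    unfolding size_filter_shape_weight .
qed

text \<open>Writing its own number into each row gives the extreme case of the dominance bound; its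
  existence is the nonzero diagonal of the Kostka matrix.\<close>

lemma superstandard_tableau:
  assumes \<mu>: "\<mu> \<in> partitions_at_most m n"
  obtains T where "T \<in> ssyt \<mu> n" "image_mset T (mset_set (young_diagram \<mu>)) = image_mset Suc (shape_weight \<mu>)"
proof
  let ?T = "restrict (\<lambda>(i, j). Suc i) (young_diagram \<mu>)"
  show "?T \<in> ssyt \<mu> n"
    using \<mu> by (auto simp: ssyt_def partitions_at_most_def young_diagram_def)
  show "image_mset ?T (mset_set (young_diagram \<mu>)) = image_mset Suc (shape_weight \<mu>)"
    unfolding shape_weight_def image_mset.compositionality
    by (rule image_mset_cong) auto
qed

lemma shape_weight_subset: "\<mu> \<in> partitions_at_most m n \<Longrightarrow> set_mset (shape_weight \<mu>) \<subseteq> {..<n}"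
proof -
  have "set_mset (shape_weight \<mu>) = fst ` young_diagram \<mu>" by (simp add: shape_weight_def)
  moreover assume "\<mu> \<in> partitions_at_most m n"
  ultimately show ?thesis by (auto simp: partitions_at_most_def young_diagram_def)
qed

lemma finite_partitions_at_most: "finite (partitions_at_most m n)"
proof (rule finite_subset)
  show "partitions_at_most m n \<subseteq> {xs. set xs \<subseteq> {..m} \<and> length xs \<le> n}"
    by (auto simp: partitions_at_most_def partitions_def intro: member_le_sum_list)
  show "finite {xs. set xs \<subseteq> {..m} \<and> length xs \<le> n}" by (rule finite_lists_length_le) simp
qed

section \<open>Weight spaces and Young permutation modules\<close>

definition weight_proj :: "nat \<Rightarrow> nat \<Rightarrow> nat multiset \<Rightarrow> complex mat" where
  "weight_proj m n M = mat_on (tensor_basis m n) (\<lambda>I J. if I = J \<and> weight m J = M then 1 else 0)"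

lemma weight_proj_carrier [simp]: "weight_proj m n M \<in> carrier_mat (tensor_dim m n) (tensor_dim m n)"
  by (simp add: weight_proj_def)

lemma tentry_weight_proj:
  "I \<in> tensor_basis m n \<Longrightarrow> J \<in> tensor_basis m n \<Longrightarrow>
    tentry m n (weight_proj m n M) I J = (if I = J \<and> weight m J = M then 1 else 0)"
  by (simp add: weight_proj_def)

lemma entry_weight_proj_mult:
  assumes A: "A \<in> carrier_mat (tensor_dim m n) (card X)" and X: "finite X" "x \<in> X" and J: "J \<in> tensor_basis m n"
  shows "entry (tensor_basis m n) X (weight_proj m n M * A) J x
    = (if weight m J = M then entry (tensor_basis m n) X A J x else 0)"
proof -
  let ?B = "tensor_basis m n"
  have "entry ?B X (weight_proj m n M * A) J x = (\<Sum>K\<in>?B. tentry m n (weight_proj m n M) J K * entry ?B X A K x)"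
    by (rule entry_mult) (use assms in auto)
  also have "\<dots> = (\<Sum>K\<in>?B. if K = J then (if weight m J = M then entry ?B X A J x else 0) else 0)"
    using J by (intro sum.cong) (auto simp: tentry_weight_proj)
  finally show ?thesis using J by simp
qed

lemma entry_mult_weight_proj:
  assumes A: "A \<in> carrier_mat (card X) (tensor_dim m n)" and X: "finite X" "x \<in> X" and J: "J \<in> tensor_basis m n"
  shows "entry X (tensor_basis m n) (A * weight_proj m n M) x J
    = (if weight m J = M then entry X (tensor_basis m n) A x J else 0)"
proof -
  let ?B = "tensor_basis m n"
  have "entry X ?B (A * weight_proj m n M) x J = (\<Sum>K\<in>?B. entry X ?B A x K * tentry m n (weight_proj m n M) K J)"
    by (rule entry_mult) (use assms in auto)
  also have "\<dots> = (\<Sum>K\<in>?B. if K = J then (if weight m J = M then entry X ?B A x J else 0) else 0)"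
    using J by (intro sum.cong) (auto simp: tentry_weight_proj)
  finally show ?thesis using J by simp
qed

lemma weight_proj_idem: "weight_proj m n M * weight_proj m n M = weight_proj m n M"
  by (rule entry_eqI[of "tensor_basis m n" "tensor_basis m n"])
    (auto simp: entry_weight_proj_mult tentry_weight_proj intro: mult_carrier_mat[OF weight_proj_carrier weight_proj_carrier])

lemma weight_comp_perm: "s permutes {1..m} \<Longrightarrow> weight m (J \<circ> s) = weight m J"
  unfolding weight_def
  by (simp flip: image_mset.compositionality) (metis permutes_image_mset image_mset.compositionality)

lemma weight_proj_intertwiner:
  "equivariant m n
    (weight_proj m n M)"
proof (rule sym_intertwinerI)
  fix s I J assume s: "s permutes {1..m}" and IJ: "I \<in> tensor_basis m n" "J \<in> tensor_basis m n"
  have "I \<circ> s = J \<circ> s \<longleftrightarrow> I = J"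
    using permutes_surj[OF s] by (auto simp: fun_eq_iff surj_def) metis
  then show "tentry m n (weight_proj m n M) (I \<circ> s) (J \<circ> s) = tentry m n (weight_proj m n M) I J"
    using IJ tensor_basis_comp_perm[OF s] weight_comp_perm[OF s] by (simp add: tentry_weight_proj)
qed simp

lemma trace_weight_proj_mult:
  assumes A: "A \<in> carrier_mat (tensor_dim m n) (tensor_dim m n)"
  shows "trace_mat (weight_proj m n M * A) = (\<Sum>J\<in>{J \<in> tensor_basis m n. weight m J = M}. tentry m n A J J)"
proof -
  have "trace_mat (weight_proj m n M * A) = (\<Sum>J\<in>tensor_basis m n. if weight m J = M then tentry m n A J J else 0)"
    unfolding trace_entry[OF finite_tensor_basis mult_carrier_mat[OF weight_proj_carrier A]]
    by (rule sum.cong) (auto simp: entry_weight_proj_mult[OF A])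
  then show ?thesis by (simp add: sum.inter_filter)
qed

text \<open>The list of fibres of \<open>J\<close>. On basis vectors of weight \<open>\<mu>\<close>
  it is the bijection with ordered set partitions that identifies the weight space with the
  permutation module.\<close>

definition blocks :: "nat \<Rightarrow> nat \<Rightarrow> (nat \<Rightarrow> nat) \<Rightarrow> nat set list" where
  "blocks m l J = map (\<lambda>i. {k \<in> {1..m}. J k = i}) [0..<l]"

lemma blocks_length [simp]: "length (blocks m l J) = l"
  and blocks_nth: "i < l \<Longrightarrow> blocks m l J ! i = {k \<in> {1..m}. J k = i}"
  by (auto simp: blocks_def)

lemma finite_ordered_set_partitions [simp]: "finite (ordered_set_partitions m \<mu>)"
proof (rule finite_subset)
  show "ordered_set_partitions m \<mu> \<subseteq> {S. set S \<subseteq> Pow {1..m} \<and> length S = length \<mu>}"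
    by (auto simp: ordered_set_partitions_def)
  show "finite {S. set S \<subseteq> Pow {1..m} \<and> length S = length \<mu>}" by (rule finite_lists_length_eq) simp
qed

lemma blocks_mem:
  assumes w: "weight m J = shape_weight \<mu>"
  shows "blocks m (length \<mu>) J \<in> ordered_set_partitions m \<mu>"
proof -
  have card: "card {k \<in> {1..m}. J k = i} = \<mu> ! i" if "i < length \<mu>" for i
    using count_weight[of m J i] count_shape_weight[of \<mu> i] w that by simp
  have "J k < length \<mu>" if k: "k \<in> {1..m}" for k
  proof (rule ccontr)
    assume "\<not> J k < length \<mu>"
    then have "card {k' \<in> {1..m}. J k' = J k} = 0"
      using count_weight[of m J "J k"] count_shape_weight[of \<mu> "J k"] w by simp
    then show False using k by auto
  qed
  then have "(\<Union>i<length \<mu>. {k \<in> {1..m}. J k = i}) = {1..m}" by blast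
  moreover have "set (blocks m (length \<mu>) J) = (\<lambda>i. {k \<in> {1..m}. J k = i}) ` {..<length \<mu>}"
    unfolding blocks_def by (simp add: lessThan_atLeast0)
  ultimately have "\<Union> (set (blocks m (length \<mu>) J)) = {1..m}" by simp
  then show ?thesis
    using card by (auto simp: ordered_set_partitions_def blocks_nth disjoint_family_on_def)
qed

text \<open>The preimage sends each position to the index of the block containing it; at most
  \<open>n\<close> blocks means that these indices are letters.\<close>

lemma blocks_surj:
  assumes S: "S \<in> ordered_set_partitions m \<mu>" and len: "length \<mu> \<le> n"
  obtains J where "J \<in> tensor_basis m n" "weight m J = shape_weight \<mu>" "blocks m (length \<mu>) J = S"
proof -
  have l: "length S = length \<mu>" and card: "\<And>i. i < length \<mu> \<Longrightarrow> card (S ! i) = \<mu> ! i"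
    and disj: "\<And>i j. i < length \<mu> \<Longrightarrow> j < length \<mu> \<Longrightarrow> i \<noteq> j \<Longrightarrow> S ! i \<inter> S ! j = {}"
    and un: "\<Union> (set S) = {1..m}"
    using S by (auto simp: ordered_set_partitions_def disjoint_family_on_def)
  have "\<exists>i<length \<mu>. k \<in> S ! i" if "k \<in> {1..m}" for k
    using that un l by (metis UnionE in_set_conv_nth)
  then obtain J0 where J0: "\<And>k. k \<in> {1..m} \<Longrightarrow> J0 k < length \<mu> \<and> k \<in> S ! J0 k" by metis
  define J where "J = restrict J0 {1..m}"
  have J: "J k < length \<mu>" "k \<in> S ! J k" if "k \<in> {1..m}" for k
    using J0[OF that] that by (auto simp: J_def)
  have Si: "{k \<in> {1..m}. J k = i} = S ! i" if i: "i < length \<mu>" for i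
  proof
    show "{k \<in> {1..m}. J k = i} \<subseteq> S ! i" using J by auto
    show "S ! i \<subseteq> {k \<in> {1..m}. J k = i}"
    proof
      fix k assume k: "k \<in> S ! i"
      then have "k \<in> {1..m}" using un l i nth_mem[of i S] by auto
      moreover from this have "J k = i" using J[of k] disj[of "J k" i] k i by blast
      ultimately show "k \<in> {k \<in> {1..m}. J k = i}" by simp
    qed
  qed
  show thesis
  proof (rule that)
    show "J \<in> tensor_basis m n"
      using J(1) len by (fastforce simp: tensor_basis_def J_def)
    show "blocks m (length \<mu>) J = S" by (rule nth_equalityI) (simp_all only: l blocks_nth blocks_length Si)
    show "weight m J = shape_weight \<mu>"
    proof (rule multiset_eqI)
      fix i
      show "count (weight m J) i = count (shape_weight \<mu>) i"
      proof (cases "i < length \<mu>")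
        case True
        then show ?thesis using Si[OF True] card by (simp add: count_weight count_shape_weight)
      next
        case False
        then have none: "{k \<in> {1..m}. J k = i} = {}" using J(1) by auto
        show ?thesis unfolding count_weight none count_shape_weight using False by simp
      qed
    qed
  qed
qed

text \<open>The fibres of \<open>J \<circ> s\<close> are the preimages under \<open>s\<close> of
  those of \<open>J\<close>. Thus permuting positions of the tensor basis matches the action on
  ordered set partitions.\<close>

lemma blocks_comp_perm:
  assumes s: "s permutes {1..m}"
  shows "blocks m l (J \<circ> s) = S \<longleftrightarrow> blocks m l J = map ((`) s) S"
proof -
  have "map ((`) s) (blocks m l (J \<circ> s)) = blocks m l J"
  proof (rule nth_equalityI)
    fix i assume "i < length (map ((`) s) (blocks m l (J \<circ> s)))"
    then have i: "i < l" by simp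
    have "s ` {k \<in> {1..m}. J (s k) = i} = {k \<in> {1..m}. J k = i}"
      using permutes_image[OF s] by (auto simp: set_eq_iff image_iff) (metis atLeastAtMost_iff image_iff permutes_image[OF s])+
    then show "map ((`) s) (blocks m l (J \<circ> s)) ! i = blocks m l J ! i" using i by (simp add: blocks_nth)
  qed simp
  moreover have "inj (map ((`) s))"
    using permutes_inj[OF s] by (intro list.inj_map injI) (simp add: inj_image_eq_iff)
  ultimately show ?thesis by (metis injD)
qed

lemma entry_young_perm_rep:
  "S \<in> ordered_set_partitions m \<mu> \<Longrightarrow> S' \<in> ordered_set_partitions m \<mu> \<Longrightarrow>
    entry (ordered_set_partitions m \<mu>) (ordered_set_partitions m \<mu>) (young_perm_rep m \<mu> s) S S'
      = (if map ((`) s) S' = S then 1 else 0)"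
  by (simp add: young_perm_rep_def perm_rep_def)

lemma young_perm_rep_carrier [simp]:
  "young_perm_rep m \<mu> s \<in> carrier_mat (card (ordered_set_partitions m \<mu>)) (card (ordered_set_partitions m \<mu>))"
  by (simp add: young_perm_rep_def perm_rep_def)

text \<open>The image of the identity element is an identity matrix, whose size is the
  degree.\<close>

lemma is_rep_dim_unique: "is_rep G d \<rho> \<Longrightarrow> is_rep G e \<rho> \<Longrightarrow> d = e"
  by (metis is_rep_one index_one_mat(2))

text \<open>The weight space of weight \<open>\<mu>\<close> is isomorphic to the permutation representation on \<open>X\<^sub>\<mu>\<close>.\<close>

lemma occurs_in_weight_space:
  assumes \<mu>: "\<mu> \<in> partitions_at_most m n" and V: "irrep (sym_group m) d \<rho>"
    and occ: "occurs_in (sym_group m) \<rho> (young_perm_rep m \<mu>)"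
  obtains f where "intertwiner (sym_group m) d \<rho> (tensor_dim m n) (tensor_power_sym m n) f"
    "f \<noteq> 0\<^sub>m (tensor_dim m n) d" "weight_proj m n (shape_weight \<mu>) * f = f"
proof -
  let ?X = "ordered_set_partitions m \<mu>" and ?B = "tensor_basis m n"
  obtain d' e A where A: "is_rep (sym_group m) d' \<rho>" "is_rep (sym_group m) e (young_perm_rep m \<mu>)"
      "A \<in> carrier_mat e d'" "inj_on ((*\<^sub>v) A) (carrier_vec d')"
      "\<forall>g\<in>carrier (sym_group m). A * \<rho> g = young_perm_rep m \<mu> g * A"
    using occ unfolding occurs_in_def by blast
  have d': "d' = d" using is_rep_dim_unique[OF A(1) irrep_rep[OF V]] .
  have id: "id \<in> carrier (sym_group m)" by (simp add: sym_group_carrier permutes_id)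
  have e: "e = card ?X"
    using is_rep_carrier[OF A(2) id] young_perm_rep_carrier[of m \<mu> id] by (metis carrier_matD(1))
  have Ac: "A \<in> carrier_mat (card ?X) d" using A(3) d' e by simp
  have Aint: "intertwiner (sym_group m) d \<rho> (card ?X) (young_perm_rep m \<mu>) A"
    using Ac A(5) by (simp add: intertwiner_def)
  have A0: "A \<noteq> 0\<^sub>m (card ?X) d"
  proof
    assume "A = 0\<^sub>m (card ?X) d"
    then have "A *\<^sub>v unit_vec d 0 = A *\<^sub>v 0\<^sub>v d" by auto
    then have "unit_vec d 0 = (0\<^sub>v d :: complex vec)" using A(4) d' by (auto dest: inj_onD)
    then have "unit_vec d 0 $ 0 = (0\<^sub>v d :: complex vec) $ 0" by simp
    then show False using irrep_pos[OF V] by simp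
  qed
  define w where "w = (\<lambda>J. weight m J = shape_weight \<mu>)"
  \<comment> \<open>The matrix of the map sending an ordered set partition to the basis vector that
    has it as list of fibres; rows outside the weight are zero.\<close>
  define \<iota> :: "complex mat" where "\<iota> = mat (tensor_dim m n) (card ?X)
    (\<lambda>(p, q). if w (from_nat_into ?B p) \<and> blocks m (length \<mu>) (from_nat_into ?B p) = from_nat_into ?X q then 1 else 0)"
  have \<iota>: "\<iota> \<in> carrier_mat (tensor_dim m n) (card ?X)" by (simp add: \<iota>_def)
  have e\<iota>: "entry ?B ?X \<iota> J S = (if w J \<and> blocks m (length \<mu>) J = S then 1 else 0)"
    if "J \<in> ?B" "S \<in> ?X" for J S
    using that by (simp add: entry_def \<iota>_def to_nat_on_less from_to_nat_on)
  have bm: "blocks m (length \<mu>) J \<in> ?X" if "w J" for J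
    using blocks_mem that by (simp add: w_def)
  have \<iota>int: "intertwiner (sym_group m) (card ?X) (young_perm_rep m \<mu>) (tensor_dim m n) (tensor_power_sym m n) \<iota>"
    unfolding intertwiner_def
  proof (intro conjI ballI \<iota>)
    fix s assume "s \<in> carrier (sym_group m)"
    then have s: "s permutes {1..m}" by (simp add: sym_group_carrier)
    show "\<iota> * young_perm_rep m \<mu> s = tensor_power_sym m n s * \<iota>"
    proof (rule entry_eqI[of ?B ?X])
      fix J S assume JS: "J \<in> ?B" "S \<in> ?X"
      have "entry ?B ?X (\<iota> * young_perm_rep m \<mu> s) J S
        = (\<Sum>S'\<in>?X. entry ?B ?X \<iota> J S' * entry ?X ?X (young_perm_rep m \<mu> s) S' S)"
        by (rule entry_mult) (use JS \<iota> in auto)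
      also have "\<dots> = (\<Sum>S'\<in>?X. if S' = blocks m (length \<mu>) J then
          (if w J \<and> map ((`) s) S = blocks m (length \<mu>) J then 1 else 0) else 0)"
        using JS by (intro sum.cong) (auto simp: e\<iota> entry_young_perm_rep)
      also have "\<dots> = (if w J \<and> blocks m (length \<mu>) J = map ((`) s) S then 1 else 0)"
        using bm by auto
      also have "\<dots> = (if w (J \<circ> s) \<and> blocks m (length \<mu>) (J \<circ> s) = S then 1 else 0)"
        using blocks_comp_perm[OF s] weight_comp_perm[OF s] by (simp add: w_def)
      also have "\<dots> = entry ?B ?X \<iota> (J \<circ> s) S"
        using e\<iota>[OF tensor_basis_comp_perm[OF s JS(1)] JS(2)] by simp
      also have "\<dots> = entry ?B ?X (tensor_power_sym m n s * \<iota>) J S"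
        by (rule tentry_sym_mult[symmetric]) (use \<iota> s JS in auto)
      finally show "entry ?B ?X (\<iota> * young_perm_rep m \<mu> s) J S = entry ?B ?X (tensor_power_sym m n s * \<iota>) J S" .
    qed (auto intro: mult_carrier_mat[OF \<iota> young_perm_rep_carrier] mult_carrier_mat[OF tensor_power_sym_carrier \<iota>])
  qed
  have w\<iota>: "weight_proj m n (shape_weight \<mu>) * \<iota> = \<iota>"
    by (rule entry_eqI[of ?B ?X])
      (auto simp: entry_weight_proj_mult[OF \<iota>] e\<iota> w_def \<iota> intro: mult_carrier_mat[OF weight_proj_carrier \<iota>])
  show thesis
  proof (rule that)
    show "intertwiner (sym_group m) d \<rho> (tensor_dim m n) (tensor_power_sym m n) (\<iota> * A)"
      by (rule intertwiner_mult[OF Aint \<iota>int])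
        (auto intro: is_rep_carrier[OF irrep_rep[OF V]] is_rep_carrier[OF tensor_power_sym_rep])
    show "weight_proj m n (shape_weight \<mu>) * (\<iota> * A) = \<iota> * A"
    proof -
      have "weight_proj m n (shape_weight \<mu>) * (\<iota> * A) = weight_proj m n (shape_weight \<mu>) * \<iota> * A"
        using carrier_matD[OF \<iota>] carrier_matD[OF Ac] carrier_matD[OF weight_proj_carrier[of m n "shape_weight \<mu>"]]
        by (simp add: mat_assoc)
      then show ?thesis using w\<iota> by simp
    qed
    show "\<iota> * A \<noteq> 0\<^sub>m (tensor_dim m n) d"
    proof
      assume zero: "\<iota> * A = 0\<^sub>m (tensor_dim m n) d"
      obtain q v where qv: "q < card ?X" "v < d" "A $$ (q, v) \<noteq> 0" using nonzero_matE[OF Ac A0] .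
      define S where "S = from_nat_into ?X q"
      have S: "S \<in> ?X" using from_nat_into_mem[OF finite_ordered_set_partitions qv(1)] by (simp add: S_def)
      have "length \<mu> \<le> n" using \<mu> by (simp add: partitions_at_most_def)
      \<comment> \<open>The row of \<open>\<iota>\<close> at this \<open>J\<close> is the unit row
        at \<open>S\<close>, so it carries the nonzero entry of \<open>A\<close> over to
        \<open>\<iota> * A\<close>.\<close>
      then obtain J where J: "J \<in> ?B" "w J" "blocks m (length \<mu>) J = S"
        using blocks_surj[OF S] unfolding w_def by blast
      have p: "to_nat_on ?B J < tensor_dim m n" using to_nat_on_less[OF finite_tensor_basis J(1)] .
      have "(\<iota> * A) $$ (to_nat_on ?B J, v) = (\<Sum>r<card ?X. \<iota> $$ (to_nat_on ?B J, r) * A $$ (r, v))"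
        by (rule mat_mult_index[OF \<iota> Ac p qv(2)])
      also have "\<dots> = (\<Sum>r<card ?X. if r = q then A $$ (r, v) else 0)"
      proof (rule sum.cong[OF refl])
        fix r assume "r \<in> {..<card ?X}"
        then have r: "r < card ?X" by simp
        have "S = from_nat_into ?X r \<longleftrightarrow> r = q"
          unfolding S_def using to_from_nat_into[OF finite_ordered_set_partitions r]
            to_from_nat_into[OF finite_ordered_set_partitions qv(1)] by metis
        then show "\<iota> $$ (to_nat_on ?B J, r) * A $$ (r, v) = (if r = q then A $$ (r, v) else 0)"
          using p r J by (simp add: \<iota>_def from_to_nat_on)
      qed
      also have "\<dots> = A $$ (q, v)" using qv by simp
      finally show False using zero p qv by simp
    qed
  qed
qed

lemma kronecker_sign: "kronecker A (sign_rep s) = of_int (sign s) \<cdot>\<^sub>m A"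
  by (rule eq_matI) (auto simp: kronecker_def sign_rep_def)

text \<open>A nonzero equivariant map into the twisted module has a nonzero entry; since a transposition acts
  on the entry by a sign, the corresponding index sets meet each other in at most one point.\<close>

lemma occurs_dominated:
  assumes \<mu>: "\<mu> \<in> partitions m" and V: "irrep (sym_group m) d \<rho>"
    and occ: "occurs_in (sym_group m) \<rho> (tensor_rep (young_perm_rep m (conjugate_partition \<mu>)) sign_rep)"
    and \<psi>: "intertwiner (sym_group m) (tensor_dim m n) (tensor_power_sym m n) d \<rho> \<psi>"
    and \<psi>0: "\<psi> \<noteq> 0\<^sub>m d (tensor_dim m n)" and \<psi>w: "\<psi> * weight_proj m n M = \<psi>"
  shows "dominated M (shape_weight \<mu>)"
proof -
  let ?\<mu> = "conjugate_partition \<mu>"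
  let ?X = "ordered_set_partitions m ?\<mu>" and ?B = "tensor_basis m n" and ?N = "tensor_dim m n"
  let ?Y = "tensor_rep (young_perm_rep m ?\<mu>) sign_rep"
  obtain d' e A where A: "is_rep (sym_group m) d' \<rho>" "is_rep (sym_group m) e ?Y"
      "A \<in> carrier_mat e d'" "inj_on ((*\<^sub>v) A) (carrier_vec d')"
      "\<forall>g\<in>carrier (sym_group m). A * \<rho> g = ?Y g * A"
    using occ unfolding occurs_in_def by blast
  have Yeq: "?Y s = of_int (sign s) \<cdot>\<^sub>m young_perm_rep m ?\<mu> s" for s
    by (simp add: tensor_rep_def kronecker_sign)
  have Yc: "?Y s \<in> carrier_mat (card ?X) (card ?X)" for s unfolding Yeq by simp
  have d': "d' = d" using is_rep_dim_unique[OF A(1) irrep_rep[OF V]] .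
  have id: "id \<in> carrier (sym_group m)" by (simp add: sym_group_carrier permutes_id)
  have e: "e = card ?X" using is_rep_carrier[OF A(2) id] Yc[of id] by (metis carrier_matD(1))
  have Ac: "A \<in> carrier_mat (card ?X) d" using A(3) d' e by simp
  have Aint: "intertwiner (sym_group m) d \<rho> (card ?X) ?Y A"
    using Ac A(5) by (simp add: intertwiner_def)
  note \<psi>c = intertwinerD(1)[OF \<psi>]
  define Z where "Z = A * \<psi>"
  have Zint: "intertwiner (sym_group m) ?N (tensor_power_sym m n) (card ?X) ?Y Z"
    unfolding Z_def
    by (rule intertwiner_mult[OF \<psi> Aint])
      (auto intro: is_rep_carrier[OF irrep_rep[OF V]] is_rep_carrier[OF tensor_power_sym_rep] Yc)
  note Zc = intertwinerD(1)[OF Zint]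
  have Z0: "Z \<noteq> 0\<^sub>m (card ?X) ?N"
  proof
    assume Z: "Z = 0\<^sub>m (card ?X) ?N"
    have "\<psi> *\<^sub>v v = 0\<^sub>v d" if v: "v \<in> carrier_vec ?N" for v
    proof -
      have "A *\<^sub>v (\<psi> *\<^sub>v v) = Z *\<^sub>v v" unfolding Z_def using assoc_mult_mat_vec[OF Ac \<psi>c v] by simp
      also have "\<dots> = 0\<^sub>v (card ?X)" unfolding Z using v by auto
      also have "\<dots> = A *\<^sub>v 0\<^sub>v d" using Ac by auto
      finally have "A *\<^sub>v (\<psi> *\<^sub>v v) = A *\<^sub>v 0\<^sub>v d" .
      moreover have "\<psi> *\<^sub>v v \<in> carrier_vec d" using \<psi>c v by auto
      ultimately show ?thesis using A(4) d' by (auto dest: inj_onD)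
    qed
    then have "\<psi> = 0\<^sub>m d ?N" by (rule mat_eq_zero_if_vanishes[OF \<psi>c])
    with \<psi>0 show False by simp
  qed
  have Zw: "Z * weight_proj m n M = Z"
    unfolding Z_def using \<psi>w carrier_matD[OF Ac] carrier_matD[OF \<psi>c] carrier_matD[OF weight_proj_carrier[of m n M]]
    by (simp add: mat_assoc)
  have "\<exists>S\<in>?X. \<exists>J\<in>?B. entry ?X ?B Z S J \<noteq> 0"
  proof (rule ccontr)
    assume none: "\<not> ?thesis"
    have "Z = 0\<^sub>m (card ?X) ?N"
    proof (rule entry_eqI[of ?X ?B])
      fix S J assume "S \<in> ?X" "J \<in> ?B"
      then show "entry ?X ?B Z S J = entry ?X ?B (0\<^sub>m (card ?X) ?N) S J"
        using none by (auto simp: entry_def to_nat_on_less)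
    qed (use Zc in auto)
    with Z0 show False by simp
  qed
  then obtain S J where SJ: "S \<in> ?X" "J \<in> ?B" "entry ?X ?B Z S J \<noteq> 0" by blast
  have wJ: "weight m J = M"
    using entry_mult_weight_proj[OF Zc finite_ordered_set_partitions SJ(1,2), of M] Zw SJ(3) by (auto split: if_splits)
  have lenS: "length S = length ?\<mu>" and cardS: "\<And>i. i < length ?\<mu> \<Longrightarrow> card (S ! i) = ?\<mu> ! i"
    and disj: "disjoint_family_on ((!) S) {..<length ?\<mu>}" and un: "\<Union> (set S) = {1..m}"
    using SJ(1) by (auto simp: ordered_set_partitions_def)
  have inj: "inj_on J (S ! i)" if i: "i < length ?\<mu>" for i
  proof (rule inj_onI, rule ccontr)
    fix p q assume pq: "p \<in> S ! i" "q \<in> S ! i" "J p = J q" "p \<noteq> q"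
    have mem: "p \<in> {1..m}" "q \<in> {1..m}" using pq un nth_mem[of i S] i lenS by auto
    define s where "s = transpose p q"
    have s: "s permutes {1..m}" unfolding s_def using mem by (rule permutes_swap_id)
    have inv: "inv' s = s" by (simp add: s_def)
    have ss: "s ` (s ` C) = C" for C by (simp add: s_def image_image)
    have fixS: "s ` (S ! j) = S ! j" if j: "j < length ?\<mu>" for j
    proof (cases "j = i")
      case True
      then show ?thesis using pq by (auto simp: s_def transpose_def image_iff)
    next
      case False
      then have "S ! j \<inter> S ! i = {}" using disj i j by (auto simp: disjoint_family_on_def)
      then have "p \<notin> S ! j" "q \<notin> S ! j" using pq by auto
      then show ?thesis by (auto simp: s_def transpose_def image_iff)
    qed
    have mS: "map ((`) s) S = S" by (rule nth_equalityI) (auto simp: lenS fixS)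
    have JJ: "J \<circ> s = J" using pq by (auto simp: fun_eq_iff s_def transpose_def)
    have "entry ?X ?B Z S J = entry ?X ?B (Z * tensor_power_sym m n s) S J"
      using tentry_mult_sym[OF Zc s SJ(2) finite_ordered_set_partitions refl SJ(1)] inv JJ by simp
    also have "Z * tensor_power_sym m n s = ?Y s * Z"
      by (rule intertwinerD(2)[OF Zint]) (use s in \<open>simp add: sym_group_carrier\<close>)
    also have "entry ?X ?B (?Y s * Z) S J = (\<Sum>S'\<in>?X. entry ?X ?X (?Y s) S S' * entry ?X ?B Z S' J)"
      by (rule entry_mult) (use SJ Zc Yc in auto)
    also have "\<dots> = (\<Sum>S'\<in>?X. if S' = S then - entry ?X ?B Z S J else 0)"
    proof (rule sum.cong[OF refl])
      fix S' assume S': "S' \<in> ?X"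
      have eY: "entry ?X ?X (?Y s) S S' = of_int (sign s) * (if map ((`) s) S' = S then 1 else 0)"
        using entry_young_perm_rep[OF SJ(1) S', of s] SJ(1) S' carrier_matD[OF young_perm_rep_carrier[of m ?\<mu> s]]
        by (simp add: Yeq entry_def to_nat_on_less)
      have sgn: "sign s = -1" using pq(4) by (simp add: s_def sign_swap_id)
      have "map ((`) s) S' = S \<longleftrightarrow> S' = S"
      proof
        assume eq: "map ((`) s) S' = S"
        have "map ((`) s) (map ((`) s) S') = S'" by (simp add: ss comp_def)
        then show "S' = S" using eq mS by simp
      qed (use mS in simp)
      then show "entry ?X ?X (?Y s) S S' * entry ?X ?B Z S' J = (if S' = S then - entry ?X ?B Z S J else 0)"
        by (simp add: eY sgn)
    qed
    also have "\<dots> = - entry ?X ?B Z S J" using SJ(1) by simp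
    finally have "entry ?X ?B Z S J = 0" by simp
    with SJ(3) show False by simp
  qed
  show ?thesis unfolding dominated_def
  proof
    fix k
    have finS: "finite (S ! i)" if "i < length ?\<mu>" for i
      using un nth_mem[of i S] that lenS by (metis Union_upper finite_atLeastAtMost finite_subset)
    have "size (filter_mset (\<lambda>i. i < k) M) = card {p \<in> {1..m}. J p < k}"
      unfolding wJ[symmetric] weight_def by (rule size_filter_image_mset_set) simp
    also have "{p \<in> {1..m}. J p < k} = (\<Union>i\<in>{..<length ?\<mu>}. {p \<in> S ! i. J p < k})"
      using lenS unfolding un[symmetric] set_conv_nth by auto
    also have "card \<dots> \<le> (\<Sum>i<length ?\<mu>. card {p \<in> S ! i. J p < k})"
      by (rule card_UN_le) simp
    \<comment> \<open>\<open>J\<close> is injective on each block, so at most \<open>k\<close>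
      elements of a block have a letter below \<open>k\<close>.\<close>
    also have "\<dots> \<le> (\<Sum>i<length ?\<mu>. min (?\<mu> ! i) k)"
    proof (rule sum_mono)
      fix i assume "i \<in> {..<length ?\<mu>}"
      then have i: "i < length ?\<mu>" by simp
      have "card {p \<in> S ! i. J p < k} \<le> card (S ! i)" using finS[OF i] by (intro card_mono) auto
      moreover have "card {p \<in> S ! i. J p < k} \<le> card {..<k}"
        by (rule card_inj_on_le[where f = J]) (use inj[OF i] in \<open>auto simp: inj_on_def\<close>)
      ultimately show "card {p \<in> S ! i. J p < k} \<le> min (?\<mu> ! i) k" using cardS[OF i] by simp
    qed
    also have "\<dots> \<le> size (filter_mset (\<lambda>i. i < k) (shape_weight \<mu>))"
      by (rule conjugate_sum_bound[OF \<mu>])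
    finally show "size (filter_mset (\<lambda>i. i < k) M) \<le> size (filter_mset (\<lambda>i. i < k) (shape_weight \<mu>))" .
  qed
qed

section \<open>The isotypic decomposition of the tensor power\<close>

text \<open>Neither that the \<open>V \<mu>\<close> are pairwise non-isomorphic nor that their
  components fill the tensor power is assumed; these facts are derived in
  \<open>intertwiner_zero\<close> and \<open>sum_Q\<close>.\<close>

locale specht_family =
  fixes m n :: nat and V :: "nat list \<Rightarrow> (nat \<Rightarrow> nat) \<Rightarrow> complex mat"
    and d k :: "nat list \<Rightarrow> nat" and f h :: "nat list \<Rightarrow> nat \<Rightarrow> complex mat"
  assumes irr: "\<mu> \<in> partitions_at_most m n \<Longrightarrow> irrep (sym_group m) (d \<mu>) (V \<mu>)"
    and occ: "\<mu> \<in> partitions_at_most m n \<Longrightarrow> occurs_in (sym_group m) (V \<mu>) (young_perm_rep m \<mu>)"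
    and occ_sign: "\<mu> \<in> partitions_at_most m n \<Longrightarrow>
      occurs_in (sym_group m) (V \<mu>) (tensor_rep (young_perm_rep m (conjugate_partition \<mu>)) sign_rep)"
    and iso: "\<mu> \<in> partitions_at_most m n \<Longrightarrow>
      isotypic (sym_group m) (d \<mu>) (V \<mu>) (tensor_dim m n) (tensor_power_sym m n) (k \<mu>) (f \<mu>) (h \<mu>)"
begin

abbreviation "\<Lambda> \<equiv> partitions_at_most m n"
abbreviation "N \<equiv> tensor_dim m n"
abbreviation "TS \<equiv> tensor_power_sym m n"
abbreviation "Q \<mu> \<equiv> isotypic_proj N (k \<mu>) (f \<mu>) (h \<mu>)"

lemma component:
  "\<mu> \<in> \<Lambda> \<Longrightarrow> isotypic_component (sym_group m) (d \<mu>) (V \<mu>) N TS (k \<mu>) (f \<mu>) (h \<mu>)"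
  using irr iso tensor_power_sym_rep by unfold_locales

lemmas TS_carrier = is_rep_carrier[OF tensor_power_sym_rep]
lemmas V_carrier = is_rep_carrier[OF irrep_rep[OF irr]]

lemma partition: "\<mu> \<in> \<Lambda> \<Longrightarrow> \<mu> \<in> partitions m"
  by (simp add: partitions_at_most_def)

text \<open>The two projections commute, so their product is an idempotent and would vanish together
  with its trace; but the copy of \<open>V \<mu>\<close> inside the weight space is fixed by
  both.\<close>

lemma trace_weight_proj_Q:
  assumes \<mu>: "\<mu> \<in> \<Lambda>"
  shows "trace_mat (weight_proj m n (shape_weight \<mu>) * Q \<mu>) \<noteq> 0"
proof
  assume tr: "trace_mat (weight_proj m n (shape_weight \<mu>) * Q \<mu>) = 0"
  interpret isotypic_component "sym_group m" "d \<mu>" "V \<mu>" N TS "k \<mu>" "f \<mu>" "h \<mu>"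
    by (rule component[OF \<mu>])
  let ?w = "weight_proj m n (shape_weight \<mu>)"
  have wc: "?w \<in> carrier_mat N N" by simp
  note [simp] = carrier_matD[OF wc]
  have comm: "Q \<mu> * ?w = ?w * Q \<mu>" by (rule proj_commutes[OF weight_proj_intertwiner])
  have c: "?w * Q \<mu> \<in> carrier_mat N N" by (rule mult_carrier_mat[OF wc isotypic_proj_carrier])
  have "?w * Q \<mu> * (?w * Q \<mu>) = ?w * (Q \<mu> * ?w) * Q \<mu>" by (simp add: mat_assoc)
  also have "\<dots> = (?w * ?w) * (Q \<mu> * Q \<mu>)" unfolding comm by (simp add: mat_assoc)
  finally have idem: "?w * Q \<mu> * (?w * Q \<mu>) = ?w * Q \<mu>"
    unfolding proj_idem weight_proj_idem .
  have zero: "?w * Q \<mu> = 0\<^sub>m N N" by (rule idempotent_trace_zero[OF c idem tr])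
  obtain \<phi> where \<phi>: "intertwiner (sym_group m) (d \<mu>) (V \<mu>) N TS \<phi>" "\<phi> \<noteq> 0\<^sub>m N (d \<mu>)" "?w * \<phi> = \<phi>"
    using occurs_in_weight_space[OF \<mu> irr[OF \<mu>] occ[OF \<mu>]] .
  note \<phi>c = intertwinerD(1)[OF \<phi>(1)]
  have "\<phi> = ?w * Q \<mu> * \<phi>" using proj_left[OF \<phi>(1)] \<phi>(3) carrier_matD[OF \<phi>c] by (simp add: mat_assoc)
  also have "\<dots> = 0\<^sub>m N (d \<mu>)" unfolding zero by (rule left_mult_zero_mat[OF \<phi>c])
  finally show False using \<phi>(2) by simp
qed

text \<open>A nonzero trace leaves some coordinate map \<open>h \<mu> i\<close> nonzero on the
  weight space, and \<open>occurs_dominated\<close> applies to that restriction.\<close>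

lemma trace_weight_proj_Q_dominated:
  assumes \<mu>: "\<mu> \<in> \<Lambda>" and tr: "trace_mat (weight_proj m n M * Q \<mu>) \<noteq> 0"
  shows "dominated M (shape_weight \<mu>)"
proof -
  interpret isotypic_component "sym_group m" "d \<mu>" "V \<mu>" N TS "k \<mu>" "f \<mu>" "h \<mu>"
    by (rule component[OF \<mu>])
  let ?w = "weight_proj m n M"
  have wc: "?w \<in> carrier_mat N N" by simp
  note [simp] = carrier_matD[OF wc]
  have "\<exists>i<k \<mu>. h \<mu> i * ?w \<noteq> 0\<^sub>m (d \<mu>) N"
  proof (rule ccontr)
    assume none: "\<not> ?thesis"
    have "Q \<mu> * ?w = mat_sum N N {..<k \<mu>} (\<lambda>i. f \<mu> i * h \<mu> i * ?w)"
      unfolding isotypic_proj_def by (rule mat_sum_mult[OF wc fh_carrier]) auto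
    also have "\<dots> = mat_sum N N {..<k \<mu>} (\<lambda>i. 0\<^sub>m N N)"
    proof (rule mat_sum_cong[OF refl])
      fix i assume "i \<in> {..<k \<mu>}"
      then have i: "i < k \<mu>" by simp
      have "f \<mu> i * h \<mu> i * ?w = f \<mu> i * (h \<mu> i * ?w)"
        using carrier_matD[OF f_carrier[OF i]] carrier_matD[OF h_carrier[OF i]] by (simp add: mat_assoc)
      then show "f \<mu> i * h \<mu> i * ?w = 0\<^sub>m N N" using none i right_mult_zero_mat[OF f_carrier[OF i]] by simp
    qed
    also have "\<dots> = 0\<^sub>m N N" by (rule eq_matI) auto
    finally have "?w * Q \<mu> = 0\<^sub>m N N" using proj_commutes[OF weight_proj_intertwiner, of M] by simp
    with tr show False by (simp add: trace_mat_def)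
  qed
  then obtain i where i: "i < k \<mu>" "h \<mu> i * ?w \<noteq> 0\<^sub>m (d \<mu>) N" by blast
  have int: "intertwiner (sym_group m) N TS (d \<mu>) (V \<mu>) (h \<mu> i * ?w)"
    by (rule intertwiner_mult[OF weight_proj_intertwiner h_int[OF i(1)]]) (auto intro: rep_carrier)
  have "h \<mu> i * ?w * ?w = h \<mu> i * ?w"
    using carrier_matD[OF h_carrier[OF i(1)]] weight_proj_idem by (simp add: mat_assoc)
  then show ?thesis
    by (rule occurs_dominated[OF partition[OF \<mu>] irr[OF \<mu>] occ_sign[OF \<mu>] int i(2)])
qed

text \<open>\<open>V \<nu>\<close> is a quotient of the weight space of its own shape, so a nonzero
  map from \<open>V \<nu>\<close> to \<open>V \<mu>\<close> pulls back to a nonzero map on that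
  weight space.\<close>

lemma nonzero_intertwiner_dominated:
  assumes \<mu>: "\<mu> \<in> \<Lambda>" and \<nu>: "\<nu> \<in> \<Lambda>"
    and z: "intertwiner (sym_group m) (d \<nu>) (V \<nu>) (d \<mu>) (V \<mu>) z" and z0: "z \<noteq> 0\<^sub>m (d \<mu>) (d \<nu>)"
  shows "dominated (shape_weight \<nu>) (shape_weight \<mu>)"
proof -
  have fin: "finite (carrier (sym_group m))" by (simp add: sym_group_def finite_permutations)
  let ?w = "weight_proj m n (shape_weight \<nu>)"
  have wc: "?w \<in> carrier_mat N N" by simp
  obtain \<phi> where \<phi>: "intertwiner (sym_group m) (d \<nu>) (V \<nu>) N TS \<phi>" "\<phi> \<noteq> 0\<^sub>m N (d \<nu>)" "?w * \<phi> = \<phi>"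
    using occurs_in_weight_space[OF \<nu> irr[OF \<nu>] occ[OF \<nu>]] .
  obtain \<eta> where \<eta>: "intertwiner (sym_group m) N TS (d \<nu>) (V \<nu>) \<eta>" "\<eta> * \<phi> = 1\<^sub>m (d \<nu>)"
    using irrep_retraction[OF fin irr[OF \<nu>] tensor_power_sym_rep \<phi>(1,2)] .
  note c = intertwinerD(1)[OF \<phi>(1)] intertwinerD(1)[OF \<eta>(1)] intertwinerD(1)[OF z] wc
  note [simp] = c[THEN carrier_matD(1)] c[THEN carrier_matD(2)]
  have 1: "intertwiner (sym_group m) N TS (d \<nu>) (V \<nu>) (\<eta> * ?w)"
    by (rule intertwiner_mult[OF weight_proj_intertwiner \<eta>(1)]) (auto intro: TS_carrier V_carrier[OF \<nu>])
  have 2: "intertwiner (sym_group m) N TS (d \<mu>) (V \<mu>) (z * (\<eta> * ?w))"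
    by (rule intertwiner_mult[OF 1 z]) (auto intro: TS_carrier V_carrier[OF \<nu>] V_carrier[OF \<mu>])
  have 3: "z * (\<eta> * ?w) * ?w = z * (\<eta> * ?w)" using weight_proj_idem by (simp add: mat_assoc)
  have 4: "z * (\<eta> * ?w) \<noteq> 0\<^sub>m (d \<mu>) N"
  proof
    assume zero: "z * (\<eta> * ?w) = 0\<^sub>m (d \<mu>) N"
    have "z * (\<eta> * ?w) * \<phi> = z * (\<eta> * (?w * \<phi>))" by (simp add: mat_assoc)
    also have "\<dots> = z" using \<phi>(3) \<eta>(2) right_mult_one_mat[OF c(3)] by simp
    finally show False using z0 unfolding zero left_mult_zero_mat[OF c(1)] by simp
  qed
  show ?thesis by (rule occurs_dominated[OF partition[OF \<mu>] irr[OF \<mu>] occ_sign[OF \<mu>] 2 4 3])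
qed

lemma shape_weight_eqD: "\<mu> \<in> \<Lambda> \<Longrightarrow> \<nu> \<in> \<Lambda> \<Longrightarrow> shape_weight \<mu> = shape_weight \<nu> \<Longrightarrow> \<mu> = \<nu>"
  by (rule shape_weight_inj) (auto simp: partitions_at_most_def partitions_def)

text \<open>A retraction of a nonzero \<open>z\<close> is a nonzero map in the opposite direction,
  so each of the two shapes would dominate the other.\<close>

lemma intertwiner_zero:
  assumes \<mu>: "\<mu> \<in> \<Lambda>" and \<nu>: "\<nu> \<in> \<Lambda>" and neq: "\<mu> \<noteq> \<nu>"
    and z: "intertwiner (sym_group m) (d \<nu>) (V \<nu>) (d \<mu>) (V \<mu>) z"
  shows "z = 0\<^sub>m (d \<mu>) (d \<nu>)"
proof (rule ccontr)
  assume z0: "z \<noteq> 0\<^sub>m (d \<mu>) (d \<nu>)"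
  have fin: "finite (carrier (sym_group m))" by (simp add: sym_group_def finite_permutations)
  obtain z' where z': "intertwiner (sym_group m) (d \<mu>) (V \<mu>) (d \<nu>) (V \<nu>) z'" "z' * z = 1\<^sub>m (d \<nu>)"
    using irrep_retraction[OF fin irr[OF \<nu>] irrep_rep[OF irr[OF \<mu>]] z z0] .
  have "z' \<noteq> 0\<^sub>m (d \<nu>) (d \<mu>)"
  proof
    assume "z' = 0\<^sub>m (d \<nu>) (d \<mu>)"
    then have "(1\<^sub>m (d \<nu>) :: complex mat) = 0\<^sub>m (d \<nu>) (d \<nu>)"
      using z'(2) left_mult_zero_mat[OF intertwinerD(1)[OF z]] by simp
    then have "(1\<^sub>m (d \<nu>) :: complex mat) $$ (0, 0) = 0\<^sub>m (d \<nu>) (d \<nu>) $$ (0, 0)" by simp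
    then show False using irrep_pos[OF irr[OF \<nu>]] by simp
  qed
  then have "shape_weight \<mu> = shape_weight \<nu>"
    using nonzero_intertwiner_dominated[OF \<mu> \<nu> z z0] nonzero_intertwiner_dominated[OF \<nu> \<mu> z'(1)]
    by (intro dominated_antisym)
  then show False using shape_weight_eqD[OF \<mu> \<nu>] neq by simp
qed

lemma h_f_zero:
  assumes \<mu>: "\<mu> \<in> \<Lambda>" and \<nu>: "\<nu> \<in> \<Lambda>" and neq: "\<mu> \<noteq> \<nu>" and i: "i < k \<mu>" and j: "j < k \<nu>"
  shows "h \<mu> i * f \<nu> j = 0\<^sub>m (d \<mu>) (d \<nu>)"
proof (rule intertwiner_zero[OF \<mu> \<nu> neq])
  show "intertwiner (sym_group m) (d \<nu>) (V \<nu>) (d \<mu>) (V \<mu>) (h \<mu> i * f \<nu> j)"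
    by (rule intertwiner_mult[OF isotypic_component.f_int[OF component[OF \<nu>] j]
          isotypic_component.h_int[OF component[OF \<mu>] i]])
      (auto intro: TS_carrier V_carrier[OF \<nu>] V_carrier[OF \<mu>])
qed

lemma Q_Q_zero:
  assumes \<mu>: "\<mu> \<in> \<Lambda>" and \<nu>: "\<nu> \<in> \<Lambda>" and neq: "\<mu> \<noteq> \<nu>"
  shows "Q \<mu> * Q \<nu> = 0\<^sub>m N N"
proof -
  interpret \<mu>: isotypic_component "sym_group m" "d \<mu>" "V \<mu>" N TS "k \<mu>" "f \<mu>" "h \<mu>"
    by (rule component[OF \<mu>])
  interpret \<nu>: isotypic_component "sym_group m" "d \<nu>" "V \<nu>" N TS "k \<nu>" "f \<nu>" "h \<nu>"
    by (rule component[OF \<nu>])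
  have "Q \<mu> * (f \<nu> j * h \<nu> j) = 0\<^sub>m N N" if j: "j < k \<nu>" for j
  proof -
    have "Q \<mu> * (f \<nu> j * h \<nu> j) = mat_sum N N {..<k \<mu>} (\<lambda>i. f \<mu> i * h \<mu> i * (f \<nu> j * h \<nu> j))"
      unfolding isotypic_proj_def[of N "k \<mu>"] by (rule mat_sum_mult[OF \<nu>.fh_carrier[OF j j] \<mu>.fh_carrier]) auto
    also have "\<dots> = mat_sum N N {..<k \<mu>} (\<lambda>i. 0\<^sub>m N N)"
    proof (rule mat_sum_cong[OF refl])
      fix i assume "i \<in> {..<k \<mu>}"
      then have i: "i < k \<mu>" by simp
      note c = \<mu>.f_carrier[OF i] \<mu>.h_carrier[OF i] \<nu>.f_carrier[OF j] \<nu>.h_carrier[OF j]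
      note [simp] = c[THEN carrier_matD(1)] c[THEN carrier_matD(2)]
      have "f \<mu> i * h \<mu> i * (f \<nu> j * h \<nu> j) = f \<mu> i * (h \<mu> i * f \<nu> j * h \<nu> j)" by (simp add: mat_assoc)
      then show "f \<mu> i * h \<mu> i * (f \<nu> j * h \<nu> j) = 0\<^sub>m N N"
        unfolding h_f_zero[OF \<mu> \<nu> neq i j] left_mult_zero_mat[OF c(4)] right_mult_zero_mat[OF c(1)] .
    qed
    also have "\<dots> = 0\<^sub>m N N" by (rule eq_matI) auto
    finally show ?thesis .
  qed
  then have "mat_sum N N {..<k \<nu>} (\<lambda>j. Q \<mu> * (f \<nu> j * h \<nu> j)) = mat_sum N N {..<k \<nu>} (\<lambda>j. 0\<^sub>m N N)"
    by (intro mat_sum_cong) auto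
  moreover have "Q \<mu> * Q \<nu> = mat_sum N N {..<k \<nu>} (\<lambda>j. Q \<mu> * (f \<nu> j * h \<nu> j))"
    unfolding isotypic_proj_def[of N "k \<nu>"] by (rule mult_mat_sum[OF isotypic_proj_carrier \<nu>.fh_carrier]) auto
  ultimately show ?thesis by (auto intro: eq_matI)
qed

lemma mat_diff_zero_mat: "A \<in> carrier_mat n' k' \<Longrightarrow> A - 0\<^sub>m n' k' = (A :: complex mat)"
  by (rule eq_matI) auto

text \<open>On the complement of all the components, the trace is a class function of \<open>GL\<close>. Its values on the
  weight projections can be matched by a combination of the traces on the components, because these
  form a triangular matrix with respect to dominance. So the two class functions agree; but the
  projection onto the complement acts as zero on the components.\<close>

lemma sum_Q: "mat_sum N N \<Lambda> Q = 1\<^sub>m N"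
proof -
  have fin: "finite \<Lambda>" by (rule finite_partitions_at_most)
  define R where "R = mat_sum N N \<Lambda> Q"
  define P where "P = 1\<^sub>m N - R"
  have Rc: "R \<in> carrier_mat N N" by (simp add: R_def)
  have Pc: "P \<in> carrier_mat N N" unfolding P_def by (rule minus_carrier_mat[OF Rc])
  have Qc: "Q \<mu> \<in> carrier_mat N N" for \<mu> by simp
  note c1 = one_carrier_mat[of N, where 'a = complex]
  have QR: "Q \<mu> * R = Q \<mu>" if \<mu>: "\<mu> \<in> \<Lambda>" for \<mu>
  proof -
    have "Q \<mu> * R = mat_sum N N \<Lambda> (\<lambda>\<nu>. Q \<mu> * Q \<nu>)" unfolding R_def by (rule mult_mat_sum[OF Qc Qc])
    also have "\<dots> = Q \<mu> * Q \<mu>"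
      by (rule mat_sum_single[OF fin \<mu>]) (use Q_Q_zero[OF \<mu>] mult_carrier_mat[OF Qc Qc] in auto)
    finally show ?thesis using isotypic_component.proj_idem[OF component[OF \<mu>]] by simp
  qed
  have RQ: "R * Q \<mu> = Q \<mu>" if \<mu>: "\<mu> \<in> \<Lambda>" for \<mu>
  proof -
    have "R * Q \<mu> = mat_sum N N \<Lambda> (\<lambda>\<nu>. Q \<nu> * Q \<mu>)" unfolding R_def by (rule mat_sum_mult[OF Qc Qc])
    also have "\<dots> = Q \<mu> * Q \<mu>"
      by (rule mat_sum_single[OF fin \<mu>]) (use Q_Q_zero[OF _ \<mu>] mult_carrier_mat[OF Qc Qc] in auto)
    finally show ?thesis using isotypic_component.proj_idem[OF component[OF \<mu>]] by simp
  qed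
  have RR: "R * R = R"
  proof -
    have "R * R = mat_sum N N \<Lambda> (\<lambda>\<nu>. Q \<nu> * R)"
      by (subst (1) R_def) (rule mat_sum_mult[OF Rc Qc])
    also have "\<dots> = R" unfolding R_def[symmetric] using QR unfolding R_def by (intro mat_sum_cong) auto
    finally show ?thesis .
  qed
  have PQ: "P * Q \<mu> = 0\<^sub>m N N" if "\<mu> \<in> \<Lambda>" for \<mu>
    unfolding P_def minus_mult_distrib_mat[OF c1 Rc Qc] RQ[OF that] left_mult_one_mat[OF Qc]
    by (rule minus_r_inv_mat[OF Qc])
  have RP: "R * P = 0\<^sub>m N N"
    unfolding P_def mult_minus_distrib_mat[OF Rc c1 Rc] RR right_mult_one_mat[OF Rc]
    by (rule minus_r_inv_mat[OF Rc])
  have PP: "P * P = P"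
  proof -
    have "P * P = P - R * P"
      by (subst (1) P_def) (simp add: minus_mult_distrib_mat[OF c1 Rc Pc] left_mult_one_mat[OF Pc])
    then show ?thesis unfolding RP using mat_diff_zero_mat[OF Pc] by simp
  qed
  have comm_R: "R * a = a * R" if a: "equivariant m n a" for a
  proof -
    note ac = intertwinerD(1)[OF a]
    have "R * a = mat_sum N N \<Lambda> (\<lambda>\<nu>. Q \<nu> * a)" unfolding R_def by (rule mat_sum_mult[OF ac Qc])
    also have "\<dots> = mat_sum N N \<Lambda> (\<lambda>\<nu>. a * Q \<nu>)"
      by (rule mat_sum_cong[OF refl]) (rule isotypic_component.proj_commutes[OF component a])
    also have "\<dots> = a * R" unfolding R_def by (rule mult_mat_sum[OF ac Qc, symmetric])
    finally show ?thesis .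
  qed
  have comm_P: "P * a = a * P" if a: "equivariant m n a" for a
    using comm_R[OF a] intertwinerD(1)[OF a] unfolding P_def
    by (simp add: minus_mult_distrib_mat[OF c1 Rc] mult_minus_distrib_mat[OF _ c1 Rc])
  have P_int: "equivariant m n P"
  proof -
    have "equivariant m n (1\<^sub>m N)"
      by (auto simp: intertwiner_def left_mult_one_mat[OF TS_carrier] right_mult_one_mat[OF TS_carrier])
    moreover have "equivariant m n R"
      unfolding intertwiner_def
    proof (intro conjI ballI Rc)
      fix s assume s: "s \<in> carrier (sym_group m)"
      have "R * TS s = mat_sum N N \<Lambda> (\<lambda>\<nu>. Q \<nu> * TS s)" unfolding R_def by (rule mat_sum_mult[OF TS_carrier[OF s] Qc])
      also have "\<dots> = mat_sum N N \<Lambda> (\<lambda>\<nu>. TS s * Q \<nu>)"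
        by (rule mat_sum_cong[OF refl])
          (rule intertwinerD(2)[OF isotypic_component.proj_int[OF component] s])
      also have "\<dots> = TS s * R" unfolding R_def by (rule mult_mat_sum[OF TS_carrier[OF s] Qc, symmetric])
      finally show "R * TS s = TS s * R" .
    qed
    ultimately show ?thesis unfolding P_def by (rule intertwiner_minus) (auto intro: TS_carrier)
  qed
  have wc: "weight_proj m n M \<in> carrier_mat N N" for M by simp
  obtain c where c: "\<And>\<alpha>. \<alpha> \<in> \<Lambda> \<Longrightarrow>
      (\<Sum>\<mu>\<in>\<Lambda>. c \<mu> * trace_mat (weight_proj m n (shape_weight \<alpha>) * Q \<mu>))
        = trace_mat (weight_proj m n (shape_weight \<alpha>) * P)"
  proof -
    have "\<exists>c. \<forall>\<alpha>\<in>\<Lambda>. (\<Sum>\<mu>\<in>\<Lambda>. c \<mu> * trace_mat (weight_proj m n (shape_weight \<alpha>) * Q \<mu>))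
        = trace_mat (weight_proj m n (shape_weight \<alpha>) * P)"
    proof (rule triangular_system[where r = "\<lambda>\<mu>. dominance_rank n (shape_weight \<mu>)", OF fin trace_weight_proj_Q])
      fix \<mu> \<alpha> assume "\<mu> \<in> \<Lambda>" "\<alpha> \<in> \<Lambda>" "trace_mat (weight_proj m n (shape_weight \<alpha>) * Q \<mu>) \<noteq> 0"
      then show "\<alpha> = \<mu> \<or> dominance_rank n (shape_weight \<alpha>) < dominance_rank n (shape_weight \<mu>)"
        using trace_weight_proj_Q_dominated[of \<mu> "shape_weight \<alpha>"] shape_weight_eqD[of \<alpha> \<mu>]
          dominated_rank_less[OF _ _ shape_weight_subset shape_weight_subset] by blast
    qed
    then show thesis using that by blast
  qed
  define D where "D = mat_sum N N \<Lambda> (\<lambda>\<mu>. c \<mu> \<cdot>\<^sub>m Q \<mu>)"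
  have Dc: "D \<in> carrier_mat N N" by (simp add: D_def)
  have cQ: "c \<mu> \<cdot>\<^sub>m Q \<mu> \<in> carrier_mat N N" for \<mu> by simp
  define B where "B = P - D"
  have Bc: "B \<in> carrier_mat N N" unfolding B_def by (rule minus_carrier_mat[OF Dc])
  have comm_D: "D * a = a * D" if a: "equivariant m n a" for a
  proof -
    note ac = intertwinerD(1)[OF a]
    have "D * a = mat_sum N N \<Lambda> (\<lambda>\<nu>. c \<nu> \<cdot>\<^sub>m Q \<nu> * a)" unfolding D_def by (rule mat_sum_mult[OF ac cQ])
    also have "\<dots> = mat_sum N N \<Lambda> (\<lambda>\<nu>. a * (c \<nu> \<cdot>\<^sub>m Q \<nu>))"
      by (rule mat_sum_cong[OF refl])
        (simp add: mult_smult_assoc_mat[OF Qc ac] mult_smult_distrib[OF ac Qc]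
          isotypic_component.proj_commutes[OF component a])
    also have "\<dots> = a * D" unfolding D_def by (rule mult_mat_sum[OF ac cQ, symmetric])
    finally show ?thesis .
  qed
  have comm_B: "tensor_power_GL m n g * B = B * tensor_power_GL m n g" for g
    unfolding B_def minus_mult_distrib_mat[OF Pc Dc tensor_power_GL_carrier]
      mult_minus_distrib_mat[OF tensor_power_GL_carrier Pc Dc]
    using comm_P[OF tensor_power_GL_intertwiner] comm_D[OF tensor_power_GL_intertwiner] by simp
  have zero_B: "(\<Sum>J\<in>{J \<in> tensor_basis m n. weight m J = shape_weight \<alpha>}. tentry m n B J J) = 0"
    if \<alpha>: "\<alpha> \<in> \<Lambda>" for \<alpha>
  proof -
    let ?w = "weight_proj m n (shape_weight \<alpha>)"
    have "?w * D = mat_sum N N \<Lambda> (\<lambda>\<mu>. ?w * (c \<mu> \<cdot>\<^sub>m Q \<mu>))"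
      unfolding D_def by (rule mult_mat_sum[OF wc cQ])
    then have "trace_mat (?w * D) = (\<Sum>\<mu>\<in>\<Lambda>. c \<mu> * trace_mat (?w * Q \<mu>))"
      using trace_mat_sum[of \<Lambda> "\<lambda>\<mu>. ?w * (c \<mu> \<cdot>\<^sub>m Q \<mu>)" N] mult_carrier_mat[OF wc cQ]
      by (simp add: mult_smult_distrib[OF wc Qc] trace_mat_smult[OF mult_carrier_mat[OF wc Qc]])
    then have "trace_mat (?w * B) = 0"
      unfolding B_def mult_minus_distrib_mat[OF wc Pc Dc]
        trace_mat_minus[OF mult_carrier_mat[OF wc Pc] mult_carrier_mat[OF wc Dc]]
      using c[OF \<alpha>] by simp
    then show ?thesis unfolding trace_weight_proj_mult[OF Bc] .
  qed
  have trT: "trace_mat (tensor_power_GL m n g * B) = 0" if g: "g \<in> carrier (GL n)" for g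
    by (rule class_function_zero[OF Bc comm_B zero_B g])
  \<comment> \<open>The trace against \<open>B\<close> vanishes on the image of the group;
    polarization extends this to the commutant, to which \<open>P\<close> itself belongs.\<close>
  have "trace_mat (P * B) = 0" by (rule polarization_trace[OF P_int Bc trT])
  moreover have "P * B = P"
  proof -
    have "P * D = mat_sum N N \<Lambda> (\<lambda>\<mu>. P * (c \<mu> \<cdot>\<^sub>m Q \<mu>))" unfolding D_def by (rule mult_mat_sum[OF Pc cQ])
    also have "\<dots> = mat_sum N N \<Lambda> (\<lambda>\<mu>. 0\<^sub>m N N)"
      by (rule mat_sum_cong[OF refl]) (simp add: mult_smult_distrib[OF Pc Qc] PQ)
    also have "\<dots> = 0\<^sub>m N N" by (rule eq_matI) auto
    finally show ?thesis
      unfolding B_def mult_minus_distrib_mat[OF Pc Pc Dc] PP using mat_diff_zero_mat[OF Pc] by simp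
  qed
  ultimately have "trace_mat P = 0" by simp
  then have P0: "P = 0\<^sub>m N N" by (rule idempotent_trace_zero[OF Pc PP])
  have "R = 1\<^sub>m N"
  proof (rule eq_matI)
    fix i j assume ij: "i < dim_row (1\<^sub>m N)" "j < dim_col (1\<^sub>m N)"
    have "P $$ (i, j) = 0" using P0 ij by simp
    then show "R $$ (i, j) = 1\<^sub>m N $$ (i, j)" using ij carrier_matD[OF Rc] by (simp add: P_def)
  qed (use Rc in auto)
  then show ?thesis by (simp add: R_def)
qed

end

section \<open>Polynomial representations of degree \<open>m\<close>\<close>

abbreviation tensor_mats :: "nat \<Rightarrow> nat \<Rightarrow> complex mat set" where
  "tensor_mats m n \<equiv> carrier_mat (tensor_dim m n) (tensor_dim m n)"

text \<open>Linearity is witnessed by a representing matrix for the trace form, which is exactly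
  what \<open>polarization_trace\<close> takes; values at matrices of other sizes are left
  free.\<close>

definition lin_functional :: "nat \<Rightarrow> nat \<Rightarrow> (complex mat \<Rightarrow> complex) \<Rightarrow> bool" where
  "lin_functional m n F \<longleftrightarrow> (\<exists>C\<in>tensor_mats m n. \<forall>a\<in>tensor_mats m n. F a = trace_mat (a * C))"

lemma lin_functionalI:
  "C \<in> tensor_mats m n \<Longrightarrow> (\<And>a. a \<in> tensor_mats m n \<Longrightarrow> F a = trace_mat (a * C)) \<Longrightarrow> lin_functional m n F"
  unfolding lin_functional_def by blast

lemma lin_functionalE:
  assumes "lin_functional m n F"
  obtains C where "C \<in> tensor_mats m n" "\<And>a. a \<in> tensor_mats m n \<Longrightarrow> F a = trace_mat (a * C)"
  using assms unfolding lin_functional_def by blast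

lemma lin_entry:
  assumes "I0 \<in> tensor_basis m n" "J0 \<in> tensor_basis m n"
  shows "lin_functional m n (\<lambda>a. tentry m n a I0 J0)"
proof (rule lin_functionalI)
  let ?C = "mat_on (tensor_basis m n) (\<lambda>J I. if I = I0 \<and> J = J0 then 1 else 0) :: complex mat"
  show C: "?C \<in> tensor_mats m n" by simp
  fix a :: "complex mat" assume a: "a \<in> tensor_mats m n"
  have "x * (if I = I0 \<and> J = J0 then 1 else 0) = (if J = J0 then (if I = I0 then x else 0) else 0)"
    for I J and x :: complex by simp
  then show "tentry m n a I0 J0 = trace_mat (a * ?C)"
    using assms by (simp add: trace_mult_entry[OF finite_tensor_basis a C])
qed

lemma lin_cmult:
  assumes "lin_functional m n F" shows "lin_functional m n (\<lambda>a. c * F a)"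
proof -
  obtain C where C: "C \<in> tensor_mats m n" "\<And>a. a \<in> tensor_mats m n \<Longrightarrow> F a = trace_mat (a * C)"
    using lin_functionalE[OF assms] by blast
  show ?thesis
    by (rule lin_functionalI[of "c \<cdot>\<^sub>m C"])
      (simp_all add: C mult_smult_distrib[OF _ C(1)] trace_mat_smult[OF mult_carrier_mat[OF _ C(1)]])
qed

lemma lin_sum:
  assumes "\<And>s. s \<in> S \<Longrightarrow> lin_functional m n (F s)"
  shows "lin_functional m n (\<lambda>a. \<Sum>s\<in>S. F s a)"
proof -
  have "\<forall>s\<in>S. \<exists>C. C \<in> tensor_mats m n \<and> (\<forall>a\<in>tensor_mats m n. F s a = trace_mat (a * C))"
    using assms unfolding lin_functional_def by blast
  from bchoice[OF this] obtain C where C: "\<And>s. s \<in> S \<Longrightarrow> C s \<in> tensor_mats m n"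
    "\<And>s a. s \<in> S \<Longrightarrow> a \<in> tensor_mats m n \<Longrightarrow> F s a = trace_mat (a * C s)"
    by blast
  show ?thesis
  proof (rule lin_functionalI[OF mat_sum_carrier])
    fix a assume a: "a \<in> tensor_mats m n"
    show "(\<Sum>s\<in>S. F s a) = trace_mat (a * mat_sum (tensor_dim m n) (tensor_dim m n) S C)"
    proof -
      have "a * mat_sum (tensor_dim m n) (tensor_dim m n) S C = mat_sum (tensor_dim m n) (tensor_dim m n) S (\<lambda>s. a * C s)"
        by (rule mult_mat_sum[OF a C(1)])
      moreover have "trace_mat \<dots> = (\<Sum>s\<in>S. trace_mat (a * C s))"
        by (rule trace_mat_sum[OF mult_carrier_mat[OF a C(1)]])
      ultimately show ?thesis using C(2)[OF _ a] by simp
    qed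
  qed
qed

lemma lin_diff:
  assumes "lin_functional m n F" "lin_functional m n G"
  shows "lin_functional m n (\<lambda>a. F a - G a)"
proof -
  obtain C where C: "C \<in> tensor_mats m n" "\<And>a. a \<in> tensor_mats m n \<Longrightarrow> F a = trace_mat (a * C)"
    using lin_functionalE[OF assms(1)] by blast
  obtain D where D: "D \<in> tensor_mats m n" "\<And>a. a \<in> tensor_mats m n \<Longrightarrow> G a = trace_mat (a * D)"
    using lin_functionalE[OF assms(2)] by blast
  show ?thesis
  proof (rule lin_functionalI[OF minus_carrier_mat[OF D(1), of C]])
    fix a assume a: "a \<in> tensor_mats m n"
    show "F a - G a = trace_mat (a * (C - D))"
      unfolding mult_minus_distrib_mat[OF a C(1) D(1)]
        trace_mat_minus[OF mult_carrier_mat[OF a C(1)] mult_carrier_mat[OF a D(1)]] C(2)[OF a] D(2)[OF a] ..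
  qed
qed

lemma lin_mult_right:
  assumes F: "lin_functional m n F" and b: "b \<in> tensor_mats m n"
  shows "lin_functional m n (\<lambda>a. F (a * b))"
proof -
  obtain C where C: "C \<in> tensor_mats m n" "\<And>a. a \<in> tensor_mats m n \<Longrightarrow> F a = trace_mat (a * C)"
    using lin_functionalE[OF F] by blast
  show ?thesis
    by (rule lin_functionalI[OF mult_carrier_mat[OF b C(1)]])
      (simp add: C(2)[OF mult_carrier_mat[OF _ b]] assoc_mult_mat[OF _ b C(1)])
qed

lemma lin_mult_left:
  assumes F: "lin_functional m n F" and b: "b \<in> tensor_mats m n"
  shows "lin_functional m n (\<lambda>a. F (b * a))"
proof -
  obtain C where C: "C \<in> tensor_mats m n" "\<And>a. a \<in> tensor_mats m n \<Longrightarrow> F a = trace_mat (a * C)"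
    using lin_functionalE[OF F] by blast
  show ?thesis
  proof (rule lin_functionalI[OF mult_carrier_mat[OF C(1) b]])
    fix a assume a: "a \<in> tensor_mats m n"
    have "F (b * a) = trace_mat (b * (a * C))"
      unfolding C(2)[OF mult_carrier_mat[OF b a]] assoc_mult_mat[OF b a C(1)] ..
    also have "\<dots> = trace_mat (a * C * b)" by (rule trace_mat_mult_comm[OF b mult_carrier_mat[OF a C(1)]])
    finally show "F (b * a) = trace_mat (a * (C * b))" unfolding assoc_mult_mat[OF a C(1) b] .
  qed
qed

lemma lin_polarization:
  assumes F: "lin_functional m n F" and a: "equivariant m n a"
    and z: "\<And>g. g \<in> carrier (GL n) \<Longrightarrow> F (tensor_power_GL m n g) = 0"
  shows "F a = 0"
proof -
  obtain C where C: "C \<in> tensor_mats m n" "\<And>a. a \<in> tensor_mats m n \<Longrightarrow> F a = trace_mat (a * C)"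
    using lin_functionalE[OF F] by blast
  show ?thesis unfolding C(2)[OF intertwinerD(1)[OF a]]
    by (rule polarization_trace[OF a C(1)]) (use z C(2)[OF tensor_power_GL_carrier] in simp)
qed

lemma lin_mat_sum:
  assumes F: "lin_functional m n F" and G: "\<And>s. s \<in> S \<Longrightarrow> G s \<in> tensor_mats m n"
  shows "F (mat_sum (tensor_dim m n) (tensor_dim m n) S G) = (\<Sum>s\<in>S. F (G s))"
proof -
  obtain C where C: "C \<in> tensor_mats m n" "\<And>a. a \<in> tensor_mats m n \<Longrightarrow> F a = trace_mat (a * C)"
    using lin_functionalE[OF F] by blast
  have "mat_sum (tensor_dim m n) (tensor_dim m n) S G * C = mat_sum (tensor_dim m n) (tensor_dim m n) S (\<lambda>s. G s * C)"
    by (rule mat_sum_mult[OF C(1) G])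
  moreover have "trace_mat \<dots> = (\<Sum>s\<in>S. trace_mat (G s * C))"
    by (rule trace_mat_sum[OF mult_carrier_mat[OF G C(1)]])
  ultimately show ?thesis using C(2)[OF G] by (simp add: C(2))
qed

lemma lin_smult:
  assumes F: "lin_functional m n F" and a: "a \<in> tensor_mats m n"
  shows "F (c \<cdot>\<^sub>m a) = c * F a"
proof -
  obtain C where C: "C \<in> tensor_mats m n" "\<And>a. a \<in> tensor_mats m n \<Longrightarrow> F a = trace_mat (a * C)"
    using lin_functionalE[OF F] by blast
  show ?thesis
    using C(2)[of "c \<cdot>\<^sub>m a"] C(2)[OF a] a
    by (simp add: mult_smult_assoc_mat[OF a C(1)] trace_mat_smult[OF mult_carrier_mat[OF a C(1)]])
qed

lemma lin_zero: "lin_functional m n F \<Longrightarrow> F (0\<^sub>m (tensor_dim m n) (tensor_dim m n)) = 0"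
  using lin_mat_sum[of m n F "{}"] by simp

text \<open>Multiplicativity holds on the image of the group. For a fixed second factor from that
  image both sides are linear in \<open>a\<close>, so polarization frees \<open>a\<close>; then both
  sides are linear in \<open>b\<close>, and polarization frees \<open>b\<close>.\<close>

lemma extension_multiplicative:
  assumes R: "is_rep (GL n) e \<rho>"
    and lin: "\<And>i j. i < e \<Longrightarrow> j < e \<Longrightarrow> lin_functional m n (F i j)"
    and F: "\<And>i j g. i < e \<Longrightarrow> j < e \<Longrightarrow> g \<in> carrier (GL n) \<Longrightarrow> F i j (tensor_power_GL m n g) = \<rho> g $$ (i, j)"
    and a: "equivariant m n a"
    and b: "equivariant m n b"
    and ij: "i < e" "j < e"
  shows "F i j (a * b) = (\<Sum>r<e. F i r a * F r j b)"
proof -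
  let ?T = "tensor_power_GL m n"
  have step: "F i j (a * ?T g) = (\<Sum>r<e. F i r a * F r j (?T g))" if g: "g \<in> carrier (GL n)" for g
  proof -
    have "F i j (a * ?T g) - (\<Sum>r<e. \<rho> g $$ (r, j) * F i r a) = 0"
    proof (rule lin_polarization[where F = "\<lambda>a. F i j (a * ?T g) - (\<Sum>r<e. \<rho> g $$ (r, j) * F i r a)", OF _ a])
      show "lin_functional m n (\<lambda>a. F i j (a * ?T g) - (\<Sum>r<e. \<rho> g $$ (r, j) * F i r a))"
        by (intro lin_diff lin_mult_right lin_sum lin_cmult lin) (use ij in auto)
      fix g' assume g': "g' \<in> carrier (GL n)"
      interpret GL: group "GL n" by (rule GL_group)
      have gg: "g' * g \<in> carrier (GL n)" using GL.m_closed[OF g' g] by simp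
      have "F i j (?T g' * ?T g) = \<rho> (g' * g) $$ (i, j)"
        using F[OF ij gg] tensor_power_GL_mult[OF GL_carrierD[OF g'] GL_carrierD[OF g]] by simp
      also have "\<rho> (g' * g) = \<rho> g' * \<rho> g" using is_rep_mult[OF R g' g] by simp
      also have "(\<rho> g' * \<rho> g) $$ (i, j) = (\<Sum>r<e. \<rho> g' $$ (i, r) * \<rho> g $$ (r, j))"
        by (rule mat_mult_index[OF is_rep_carrier[OF R g'] is_rep_carrier[OF R g] ij])
      also have "\<dots> = (\<Sum>r<e. \<rho> g $$ (r, j) * F i r (?T g'))"
        by (rule sum.cong) (use F ij g' in auto)
      finally show "F i j (?T g' * ?T g) - (\<Sum>r<e. \<rho> g $$ (r, j) * F i r (?T g')) = 0" by simp
    qed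
    moreover have "(\<Sum>r<e. F i r a * F r j (?T g)) = (\<Sum>r<e. \<rho> g $$ (r, j) * F i r a)"
      by (rule sum.cong) (use F ij g in auto)
    ultimately show ?thesis by simp
  qed
  have "F i j (a * b) - (\<Sum>r<e. F i r a * F r j b) = 0"
  proof (rule lin_polarization[where F = "\<lambda>b. F i j (a * b) - (\<Sum>r<e. F i r a * F r j b)", OF _ b])
    show "lin_functional m n (\<lambda>b. F i j (a * b) - (\<Sum>r<e. F i r a * F r j b))"
      by (intro lin_diff lin_mult_left lin_sum lin_cmult lin) (use ij intertwinerD(1)[OF a] in auto)
  qed (use step in simp)
  then show ?thesis by simp
qed

text \<open>The variables are listed with repetition, turning exponents into positions; one list
  works for all points \<open>g\<close>.\<close>

lemma power_product_list:
  assumes "finite Y"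
  shows "\<exists>xs. length xs = (\<Sum>y\<in>Y. e y) \<and> set xs \<subseteq> Y \<and>
    (\<forall>g :: 'a \<Rightarrow> complex. (\<Prod>y\<in>Y. g y ^ e y) = prod_list (map g xs))"
  using assms
proof (induction rule: finite_induct)
  case (insert y Y)
  then obtain xs where xs: "length xs = (\<Sum>y\<in>Y. e y)" "set xs \<subseteq> Y"
      "\<forall>g :: 'a \<Rightarrow> complex. (\<Prod>y\<in>Y. g y ^ e y) = prod_list (map g xs)" by blast
  show ?case
  proof (intro exI[of _ "replicate (e y) y @ xs"] conjI allI)
    fix g :: "'a \<Rightarrow> complex"
    have "prod_list (replicate l z) = z ^ l" for l and z :: complex by (induction l) auto
    then show "(\<Prod>y\<in>insert y Y. g y ^ e y) = prod_list (map g (replicate (e y) y @ xs))"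
      using insert.hyps xs(3) by simp
  qed (use insert.hyps xs in auto)
qed simp

text \<open>A monomial of degree \<open>m\<close> is a list of \<open>m\<close> variables, each a
  pair of a row and a column; the \<open>k\<close>-th pair supplies the two letters at position
  \<open>k\<close>.\<close>

lemma monomial_is_entry:
  assumes deg: "(\<Sum>i<n. \<Sum>j<n. e i j) = m"
  shows "\<exists>I\<in>tensor_basis m n. \<exists>J\<in>tensor_basis m n. \<forall>g.
    (\<Prod>i<n. \<Prod>j<n. g $$ (i, j) ^ e i j) = tentry m n (tensor_power_GL m n g) I J"
proof -
  obtain xs where xs: "length xs = (\<Sum>p\<in>{..<n} \<times> {..<n}. e (fst p) (snd p))" "set xs \<subseteq> {..<n} \<times> {..<n}"
      "\<forall>g :: nat \<times> nat \<Rightarrow> complex. (\<Prod>p\<in>{..<n} \<times> {..<n}. g p ^ e (fst p) (snd p)) = prod_list (map g xs)"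
    using power_product_list[of "{..<n} \<times> {..<n}" "\<lambda>p. e (fst p) (snd p)"] by blast
  have len: "length xs = m" unfolding xs(1) deg[symmetric] by (simp add: sum.cartesian_product case_prod_unfold)
  \<comment> \<open>Tensor positions start at 1 and list positions at 0.\<close>
  define I where "I = restrict (\<lambda>k. fst (xs ! (k - 1))) {1..m}"
  define J where "J = restrict (\<lambda>k. snd (xs ! (k - 1))) {1..m}"
  have mem: "xs ! (k - 1) \<in> {..<n} \<times> {..<n}" if "k \<in> {1..m}" for k
    using xs(2) nth_mem[of "k - 1" xs] len that by auto
  have IJ: "I \<in> tensor_basis m n" "J \<in> tensor_basis m n"
    using mem unfolding I_def J_def tensor_basis_def
    by (auto simp del: atLeastAtMost_iff One_nat_def simp: mem_Times_iff)
  have "(\<Prod>i<n. \<Prod>j<n. g $$ (i, j) ^ e i j) = tentry m n (tensor_power_GL m n g) I J" for g :: "complex mat"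
  proof -
    have "(\<Prod>i<n. \<Prod>j<n. g $$ (i, j) ^ e i j) = (\<Prod>p\<in>{..<n} \<times> {..<n}. (g $$ p) ^ e (fst p) (snd p))"
      by (simp add: prod.cartesian_product case_prod_unfold)
    also have "\<dots> = prod_list (map (\<lambda>p. g $$ p) xs)" by (rule xs(3)[rule_format])
    also have "\<dots> = (\<Prod>k<m. g $$ (xs ! k))"
      by (simp add: prod.list_conv_set_nth len lessThan_atLeast0)
    also have "\<dots> = (\<Prod>k\<in>{1..m}. g $$ (xs ! (k - 1)))"
      by (rule prod.reindex_bij_witness[of _ "\<lambda>k. k - 1" Suc]) auto
    also have "\<dots> = (\<Prod>k\<in>{1..m}. g $$ (I k, J k))"
      by (rule prod.cong) (auto simp: I_def J_def)
    finally show ?thesis using IJ by (simp add: tentry_GL)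
  qed
  then show ?thesis using IJ by blast
qed

text \<open>Comparison of the coefficients of \<open>t ^ m\<close>. The right-hand side is moved to
  the left as one more term of the family, labelled \<open>None\<close>.\<close>

lemma homogeneous_part:
  fixes c :: "'a \<Rightarrow> complex"
  assumes E: "finite E" and eq: "\<And>t. t \<noteq> 0 \<Longrightarrow> (\<Sum>e\<in>E. c e * t ^ deg e) = t ^ m * r"
  shows "(\<Sum>e\<in>{e \<in> E. deg e = m}. c e) = r"
proof -
  let ?A = "insert None (Some ` E)"
  let ?b = "\<lambda>a. case a of None \<Rightarrow> - r | Some e \<Rightarrow> c e"
  let ?n = "\<lambda>a. case a of None \<Rightarrow> m | Some e \<Rightarrow> deg e"
  have "(\<Sum>a\<in>{a \<in> ?A. ?n a = m}. ?b a) = 0"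
  proof (rule univariate_coeffs_zero)
    show "finite ?A" using E by simp
    fix t :: complex assume "t \<noteq> 0"
    then show "(\<Sum>a\<in>?A. ?b a * t ^ ?n a) = 0"
      using E eq by (simp add: sum.reindex mult.commute)
  qed
  moreover have "{a \<in> ?A. ?n a = m} = insert None (Some ` {e \<in> E. deg e = m})" by auto
  ultimately show ?thesis using E by (simp add: sum.reindex)
qed

text \<open>On the group \<open>p\<close> coincides with its part of degree \<open>m\<close>, and by
  \<open>monomial_is_entry\<close> the monomials of that degree are entries of the tensor power, on
  which the extension is linear by construction.\<close>

lemma homogeneous_polynomial_lin:
  assumes p: "polynomial_on_GL n p"
    and hom: "\<And>g t. g \<in> carrier (GL n) \<Longrightarrow> t \<noteq> 0 \<Longrightarrow>
      t \<cdot>\<^sub>m g \<in> carrier (GL n) \<and> p (t \<cdot>\<^sub>m g) = t ^ m * p g"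
  shows "\<exists>F. lin_functional m n F \<and> (\<forall>g\<in>carrier (GL n). F (tensor_power_GL m n g) = p g)"
proof -
  obtain E :: "(nat \<Rightarrow> nat \<Rightarrow> nat) set" and c where E: "finite E"
    "\<And>g. g \<in> carrier (GL n) \<Longrightarrow> p g = (\<Sum>e\<in>E. c e * (\<Prod>i<n. \<Prod>j<n. g $$ (i, j) ^ e i j))"
    using p unfolding polynomial_on_GL_def by blast
  define deg where "deg = (\<lambda>e :: nat \<Rightarrow> nat \<Rightarrow> nat. \<Sum>i<n. \<Sum>j<n. e i j)"
  let ?E = "{e \<in> E. deg e = m}"
  have part: "(\<Sum>e\<in>?E. c e * (\<Prod>i<n. \<Prod>j<n. g $$ (i, j) ^ e i j)) = p g" if g: "g \<in> carrier (GL n)" for g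
  proof (rule homogeneous_part[OF E(1)])
    fix t :: complex assume t: "t \<noteq> 0"
    have "(\<Prod>i<n. \<Prod>j<n. (t \<cdot>\<^sub>m g) $$ (i, j) ^ e i j) = (\<Prod>i<n. \<Prod>j<n. g $$ (i, j) ^ e i j) * t ^ deg e" for e
    proof -
      have "(\<Prod>i<n. \<Prod>j<n. (t \<cdot>\<^sub>m g) $$ (i, j) ^ e i j) = (\<Prod>i<n. \<Prod>j<n. t ^ e i j * g $$ (i, j) ^ e i j)"
        using GL_carrierD[OF g] by (intro prod.cong) (auto simp: power_mult_distrib)
      then show ?thesis by (simp add: prod.distrib deg_def power_sum mult.commute)
    qed
    then have "(\<Sum>e\<in>E. c e * (\<Prod>i<n. \<Prod>j<n. (t \<cdot>\<^sub>m g) $$ (i, j) ^ e i j))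
        = (\<Sum>e\<in>E. c e * (\<Prod>i<n. \<Prod>j<n. g $$ (i, j) ^ e i j) * t ^ deg e)"
      by (intro sum.cong refl) (simp only: mult.assoc)
    then have "p (t \<cdot>\<^sub>m g) = (\<Sum>e\<in>E. c e * (\<Prod>i<n. \<Prod>j<n. g $$ (i, j) ^ e i j) * t ^ deg e)"
      using E(2)[of "t \<cdot>\<^sub>m g"] hom[OF g t] by (simp only:)
    then show "(\<Sum>e\<in>E. c e * (\<Prod>i<n. \<Prod>j<n. g $$ (i, j) ^ e i j) * t ^ deg e) = t ^ m * p g"
      using hom[OF g t] by simp
  qed
  have "\<forall>e\<in>?E. \<exists>p. p \<in> tensor_basis m n \<times> tensor_basis m n \<and> (\<forall>g.
    (\<Prod>i<n. \<Prod>j<n. g $$ (i, j) ^ e i j) = tentry m n (tensor_power_GL m n g) (fst p) (snd p))"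
  proof
    fix e assume "e \<in> ?E"
    then have "(\<Sum>i<n. \<Sum>j<n. e i j) = m" by (simp add: deg_def)
    from monomial_is_entry[OF this] obtain I J where "I \<in> tensor_basis m n" "J \<in> tensor_basis m n"
      "\<forall>g. (\<Prod>i<n. \<Prod>j<n. g $$ (i, j) ^ e i j) = tentry m n (tensor_power_GL m n g) I J" by blast
    then show "\<exists>p. p \<in> tensor_basis m n \<times> tensor_basis m n \<and> (\<forall>g.
      (\<Prod>i<n. \<Prod>j<n. g $$ (i, j) ^ e i j) = tentry m n (tensor_power_GL m n g) (fst p) (snd p))"
      by (intro exI[of _ "(I, J)"]) simp
  qed
  from bchoice[OF this] obtain q where q: "\<And>e. e \<in> ?E \<Longrightarrow> q e \<in> tensor_basis m n \<times> tensor_basis m n"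
    "\<And>e g. e \<in> ?E \<Longrightarrow> (\<Prod>i<n. \<Prod>j<n. g $$ (i, j) ^ e i j)
      = tentry m n (tensor_power_GL m n g) (fst (q e)) (snd (q e))"
    by blast
  let ?F = "\<lambda>a. \<Sum>e\<in>?E. c e * tentry m n a (fst (q e)) (snd (q e))"
  have "lin_functional m n ?F" by (intro lin_sum lin_cmult lin_entry) (use q(1) in \<open>auto simp: mem_Times_iff\<close>)
  moreover have "?F (tensor_power_GL m n g) = p g" if "g \<in> carrier (GL n)" for g
    unfolding part[OF that, symmetric] by (intro sum.cong refl) (simp only: q(2))
  ultimately show ?thesis by blast
qed

section \<open>Schur polynomials as characters of polynomial representations\<close>

definition tableau_content :: "nat list \<Rightarrow> (nat \<times> nat \<Rightarrow> nat) \<Rightarrow> nat multiset" where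
  "tableau_content \<mu> T = image_mset T (mset_set (young_diagram \<mu>))"

lemma finite_ssyt [simp]: "finite (ssyt \<mu> n)"
  by (rule finite_subset[of _ "young_diagram \<mu> \<rightarrow>\<^sub>E {1..n}"]) (auto simp: ssyt_def intro: finite_PiE)

lemma ssyt_range: "T \<in> ssyt \<mu> n \<Longrightarrow> c \<in> young_diagram \<mu> \<Longrightarrow> T c \<in> {1..n}"
  unfolding ssyt_def by blast

text \<open>Grouping boxes by their letter turns powers into a product over boxes; in this form each
  tableau contributes one multiset monomial, as \<open>family_coeffs_zero\<close> expects.\<close>

lemma schur_content: "schur \<mu> n x = (\<Sum>T\<in>ssyt \<mu> n. \<Prod>y\<in>#tableau_content \<mu> T. x y)"
  unfolding schur_def
proof (rule sum.cong[OF refl])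
  fix T assume T: "T \<in> ssyt \<mu> n"
  have "(\<Prod>y\<in>#tableau_content \<mu> T. x y) = (\<Prod>c\<in>young_diagram \<mu>. x (T c))"
    by (simp add: tableau_content_def image_mset.compositionality comp_def prod_unfold_prod_mset)
  also have "\<dots> = (\<Prod>i\<in>{1..n}. \<Prod>c\<in>{c \<in> young_diagram \<mu>. T c = i}. x (T c))"
    by (rule prod.group[symmetric]) (use ssyt_range[OF T] in auto)
  also have "\<dots> = (\<Prod>i\<in>{1..n}. x i ^ card {c \<in> young_diagram \<mu>. T c = i})"
    by (intro prod.cong refl) simp
  finally show "(\<Prod>i\<in>{1..n}. x i ^ card {c \<in> young_diagram \<mu>. T c = i}) = (\<Prod>y\<in>#tableau_content \<mu> T. x y)" by simp
qed

lemma card_young_diagram: "card (young_diagram \<mu>) = sum_list \<mu>"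
proof -
  have "young_diagram \<mu> = (SIGMA i:{..<length \<mu>}. {..<\<mu> ! i})" by (auto simp: young_diagram_def)
  then show ?thesis by (simp add: card_SigmaI sum_list_sum_nth lessThan_atLeast0)
qed

lemma diag_GL:
  assumes "\<And>i. i < n \<Longrightarrow> u i \<noteq> 0"
  shows "mat_diag n u \<in> carrier (GL n)"
  unfolding GL_carrier_iff
proof (intro conjI bexI[of _ "mat_diag n (\<lambda>i. inverse (u i))"])
  show "mat_diag n (\<lambda>i. inverse (u i)) * mat_diag n u = 1\<^sub>m n" "mat_diag n u * mat_diag n (\<lambda>i. inverse (u i)) = 1\<^sub>m n"
    unfolding mat_diag_diag using assms by (auto simp: mat_diag_def intro!: eq_matI)
qed auto

text \<open>A scalar matrix \<open>t\<close> acts by a scalar, which the character identifies as \<open>t\<^sup>m\<close>.\<close>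

lemma schur_character_homogeneous:
  assumes \<mu>: "\<mu> \<in> partitions m" and irr: "irrep (GL n) e \<rho>" and ch: "has_character n \<rho> (schur \<mu> n)"
    and g: "g \<in> carrier (GL n)" and t: "t \<noteq> 0"
  shows "t \<cdot>\<^sub>m g \<in> carrier (GL n)" "\<rho> (t \<cdot>\<^sub>m g) = t ^ m \<cdot>\<^sub>m \<rho> g"
proof -
  note R = irrep_rep[OF irr]
  interpret GL: group "GL n" by (rule GL_group)
  define D where "D = (\<lambda>t. mat_diag n (\<lambda>i. t :: complex))"
  have DG: "D s \<in> carrier (GL n)" if "s \<noteq> 0" for s using diag_GL[of n "\<lambda>i. s"] that by (simp add: D_def)
  have Dmult: "D s * A = s \<cdot>\<^sub>m A" "A * D s = s \<cdot>\<^sub>m A" if "A \<in> carrier_mat n n" for s A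
    unfolding D_def using mat_diag_mult_left[OF that] mat_diag_mult_right[OF that] that by (auto intro!: eq_matI)
  have size: "size (tableau_content \<mu> T) = m" for T
    using \<mu> by (simp add: tableau_content_def card_young_diagram partitions_def)
  have schur_t: "schur \<mu> n (\<lambda>_. s) = of_nat (card (ssyt \<mu> n)) * s ^ m" for s
    by (simp add: schur_content size)
  have tr: "trace_mat (\<rho> (D s)) = of_nat (card (ssyt \<mu> n)) * s ^ m" if "s \<noteq> 0" for s
    using ch[unfolded has_character_def, rule_format, of "\<lambda>_. s"] that by (simp add: D_def schur_t)
  \<comment> \<open>At the identity the character counts tableaux, so their number equals the degree
    and cancels when the traces at \<open>D t\<close> are compared.\<close>
  have "D 1 = 1\<^sub>m n" by (auto simp: D_def mat_diag_def intro!: eq_matI)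
  then have card: "of_nat e = (of_nat (card (ssyt \<mu> n)) :: complex)"
    using tr[of 1] is_rep_one[OF R] by simp
  have "intertwiner (GL n) e \<rho> e \<rho> (\<rho> (D t))"
    unfolding intertwiner_def
  proof (intro conjI ballI)
    show "\<rho> (D t) \<in> carrier_mat e e" by (rule is_rep_carrier[OF R DG[OF t]])
    fix g assume g: "g \<in> carrier (GL n)"
    show "\<rho> (D t) * \<rho> g = \<rho> g * \<rho> (D t)"
      using is_rep_mult[OF R DG[OF t] g] is_rep_mult[OF R g DG[OF t]] Dmult[OF GL_carrierD[OF g]] by simp
  qed
  then obtain s where s: "\<rho> (D t) = s \<cdot>\<^sub>m 1\<^sub>m e" using irrep_self_intertwiner_scalar[OF irr] by blast
  then have "s * of_nat e = of_nat e * t ^ m"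
    using tr[OF t] card by (simp add: trace_mat_smult[OF one_carrier_mat])
  then have st: "s = t ^ m" using irrep_pos[OF irr] by simp
  show "t \<cdot>\<^sub>m g \<in> carrier (GL n)"
    using GL.m_closed[OF DG[OF t] g] Dmult(1)[OF GL_carrierD[OF g]] by simp
  have "\<rho> (t \<cdot>\<^sub>m g) = \<rho> (D t) * \<rho> g"
    using is_rep_mult[OF R DG[OF t] g] Dmult(1)[OF GL_carrierD[OF g]] by simp
  also have "\<dots> = t ^ m \<cdot>\<^sub>m \<rho> g"
    unfolding s st using mult_smult_assoc_mat[OF one_carrier_mat is_rep_carrier[OF R g]] is_rep_carrier[OF R g] by simp
  finally show "\<rho> (t \<cdot>\<^sub>m g) = t ^ m \<cdot>\<^sub>m \<rho> g" .
qed

text \<open>Each matrix entry of \<open>\<rho>\<close> is a polynomial that scales with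
  \<open>t ^ m\<close>, hence a linear functional of the tensor power of \<open>g\<close>. The
  \<open>F i j\<close> are the entries of the extension of \<open>\<rho>\<close> to the
  commutant.\<close>

lemma is_W_extension:
  assumes \<mu>: "\<mu> \<in> partitions m" and W: "is_W n \<mu> \<rho>"
  obtains e F where "irrep (GL n) e \<rho>" "\<And>i j. i < e \<Longrightarrow> j < e \<Longrightarrow> lin_functional m n (F i j)"
    "\<And>i j g. i < e \<Longrightarrow> j < e \<Longrightarrow> g \<in> carrier (GL n) \<Longrightarrow> F i j (tensor_power_GL m n g) = \<rho> g $$ (i, j)"
proof -
  obtain e where irr: "irrep (GL n) e \<rho>" using W unfolding is_W_def irreducible_rep_iff by blast
  note R = irrep_rep[OF irr]
  obtain e' where "is_rep (GL n) e' \<rho>" "\<And>i j. i < e' \<Longrightarrow> j < e' \<Longrightarrow> polynomial_on_GL n (\<lambda>g. \<rho> g $$ (i, j))"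
    using W unfolding is_W_def polynomial_rep_def by blast
  then have poly: "polynomial_on_GL n (\<lambda>g. \<rho> g $$ (i, j))" if "i < e" "j < e" for i j
    using is_rep_dim_unique[OF R] that by blast
  have ch: "has_character n \<rho> (schur \<mu> n)" using W by (simp add: is_W_def)
  have "\<exists>F. lin_functional m n F \<and> (\<forall>g\<in>carrier (GL n). F (tensor_power_GL m n g) = \<rho> g $$ (i, j))"
    if ij: "i < e" "j < e" for i j
  proof (rule homogeneous_polynomial_lin[OF poly[OF ij]])
    fix g and t :: complex assume gt: "g \<in> carrier (GL n)" "t \<noteq> 0"
    note hom = schur_character_homogeneous[OF \<mu> irr ch gt]
    show "t \<cdot>\<^sub>m g \<in> carrier (GL n) \<and> \<rho> (t \<cdot>\<^sub>m g) $$ (i, j) = t ^ m * \<rho> g $$ (i, j)"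
      using hom ij is_rep_carrier[OF R gt(1)] by simp
  qed
  then have "\<forall>p. \<exists>F. fst p < e \<longrightarrow> snd p < e \<longrightarrow> lin_functional m n F \<and>
      (\<forall>g\<in>carrier (GL n). F (tensor_power_GL m n g) = \<rho> g $$ (fst p, snd p))" by blast
  from choice[OF this] obtain F where F: "\<And>p. fst p < e \<Longrightarrow> snd p < e \<Longrightarrow> lin_functional m n (F p) \<and>
      (\<forall>g\<in>carrier (GL n). F p (tensor_power_GL m n g) = \<rho> g $$ (fst p, snd p))" by blast
  show thesis
  proof (rule that[OF irr, of "\<lambda>i j. F (i, j)"])
    fix i j assume "i < e" "j < e"
    then show "lin_functional m n (F (i, j))" using F[of "(i, j)"] by simp
    fix g assume "g \<in> carrier (GL n)"
    with \<open>i < e\<close> \<open>j < e\<close> show "F (i, j) (tensor_power_GL m n g) = \<rho> g $$ (i, j)" using F[of "(i, j)"] by simp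
  qed
qed

section \<open>The action of the general linear group on multiplicity spaces\<close>

context specht_family
begin

abbreviation "mentry \<mu> \<equiv> isotypic_component.mult_entry (f \<mu>) (h \<mu>)"

text \<open>The action of \<open>g\<close> on the multiplicity space of \<open>V \<mu>\<close>, in
  the basis \<open>f \<mu>\<close>; this is the space to be identified with
  \<open>W \<mu>\<close>.\<close>

definition mult_rep :: "nat list \<Rightarrow> complex mat \<Rightarrow> complex mat" where
  "mult_rep \<mu> g = mat (k \<mu>) (k \<mu>) (\<lambda>(i, j). mentry \<mu> (tensor_power_GL m n g) i j)"

lemma mult_rep_carrier [simp]: "mult_rep \<mu> g \<in> carrier_mat (k \<mu>) (k \<mu>)"
  by (simp add: mult_rep_def)

text \<open>The images of the matrix units \<open>f \<nu> i * h \<nu> j\<close> under the extension of an irreducible representation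
  to the commutant sum up to the identity, so they do not all vanish, and map a multiplicity space
  isomorphically onto the representation.\<close>

lemma extension_mult_rep:
  assumes irrW: "irrep (GL n) e \<rho>"
    and lin: "\<And>i j. i < e \<Longrightarrow> j < e \<Longrightarrow> lin_functional m n (F i j)"
    and F: "\<And>i j g. i < e \<Longrightarrow> j < e \<Longrightarrow> g \<in> carrier (GL n) \<Longrightarrow> F i j (tensor_power_GL m n g) = \<rho> g $$ (i, j)"
  obtains \<nu> P L where "\<nu> \<in> \<Lambda>" "P \<in> carrier_mat e (k \<nu>)" "L \<in> carrier_mat (k \<nu>) e"
    "L * P = 1\<^sub>m (k \<nu>)" "P * L = 1\<^sub>m e" "\<And>g. g \<in> carrier (GL n) \<Longrightarrow> \<rho> g * P = P * mult_rep \<nu> g"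
proof -
  note R = irrep_rep[OF irrW]
  let ?T = "tensor_power_GL m n"
  note mult = extension_multiplicative[OF R lin F]
  have oneG: "1\<^sub>m n \<in> carrier (GL n)" by (auto simp: GL_carrier_iff)
  have F1: "F i j (1\<^sub>m N) = 1\<^sub>m e $$ (i, j)" if "i < e" "j < e" for i j
    using F[OF that oneG] is_rep_one[OF R] by (simp add: tensor_power_GL_one)
  have e0: "0 < e" by (rule irrep_pos[OF irrW])
  have "\<exists>\<nu>\<in>\<Lambda>. \<exists>i<k \<nu>. F 0 0 (f \<nu> i * h \<nu> i) \<noteq> 0"
  proof (rule ccontr)
    assume none: "\<not> ?thesis"
    have "F 0 0 (Q \<nu>) = 0" if \<nu>: "\<nu> \<in> \<Lambda>" for \<nu>
    proof -
      have "F 0 0 (Q \<nu>) = (\<Sum>i<k \<nu>. F 0 0 (f \<nu> i * h \<nu> i))"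
        unfolding isotypic_proj_def
        by (rule lin_mat_sum[OF lin[OF e0 e0]]) (use isotypic_component.fh_carrier[OF component[OF \<nu>]] in auto)
      then show ?thesis using none \<nu> by simp
    qed
    then have "F 0 0 (mat_sum N N \<Lambda> Q) = 0" by (subst lin_mat_sum[OF lin[OF e0 e0]]) auto
    then show False unfolding sum_Q using F1[OF e0 e0] e0 by simp
  qed
  then obtain \<nu> i0 where \<nu>: "\<nu> \<in> \<Lambda>" and i0: "i0 < k \<nu>" and nz: "F 0 0 (f \<nu> i0 * h \<nu> i0) \<noteq> 0" by blast
  interpret isotypic_component "sym_group m" "d \<nu>" "V \<nu>" N TS "k \<nu>" "f \<nu>" "h \<nu>"
    by (rule component[OF \<nu>])
  \<comment> \<open>\<open>P\<close> collects the columns 0 of the images of the units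
    \<open>f \<nu> j * h \<nu> i0\<close>, and \<open>L\<close> the rows 0 of the images of the
    units \<open>f \<nu> i0 * h \<nu> j\<close>. By multiplicativity \<open>L * P\<close> is scalar
    with value \<open>\<kappa>\<close> before the division.\<close>
  define \<kappa> where "\<kappa> = F 0 0 (f \<nu> i0 * h \<nu> i0)"
  define P where "P = mat e (k \<nu>) (\<lambda>(p, j). F p 0 (f \<nu> j * h \<nu> i0))"
  define L where "L = mat (k \<nu>) e (\<lambda>(j, q). F 0 q (f \<nu> i0 * h \<nu> j) / \<kappa>)"
  have P: "P \<in> carrier_mat e (k \<nu>)" and L: "L \<in> carrier_mat (k \<nu>) e" by (auto simp: P_def L_def)
  have units: "f \<nu> i0 * h \<nu> j * (f \<nu> l * h \<nu> i0) = (if j = l then f \<nu> i0 * h \<nu> i0 else 0\<^sub>m N N)"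
    if j: "j < k \<nu>" and l: "l < k \<nu>" for j l
  proof -
    note c = f_carrier[OF i0] h_carrier[OF i0] h_carrier[OF j] f_carrier[OF l]
    note [simp] = c[THEN carrier_matD(1)] c[THEN carrier_matD(2)]
    have "f \<nu> i0 * h \<nu> j * (f \<nu> l * h \<nu> i0) = f \<nu> i0 * (h \<nu> j * f \<nu> l * h \<nu> i0)" by (simp add: mat_assoc)
    then show ?thesis using orth[OF j l] left_mult_one_mat[OF c(2)] left_mult_zero_mat[OF c(2)]
      right_mult_zero_mat[OF c(1)] by simp
  qed
  have LP: "L * P = 1\<^sub>m (k \<nu>)"
  proof (rule eq_matI)
    fix j l assume "j < dim_row (1\<^sub>m (k \<nu>))" "l < dim_col (1\<^sub>m (k \<nu>))"
    then have jl: "j < k \<nu>" "l < k \<nu>" by auto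
    have "(L * P) $$ (j, l) = (\<Sum>q<e. F 0 q (f \<nu> i0 * h \<nu> j) * F q 0 (f \<nu> l * h \<nu> i0)) / \<kappa>"
      unfolding mat_mult_index[OF L P jl] sum_divide_distrib using jl by (intro sum.cong) (auto simp: P_def L_def)
    also have "(\<Sum>q<e. F 0 q (f \<nu> i0 * h \<nu> j) * F q 0 (f \<nu> l * h \<nu> i0)) = F 0 0 (f \<nu> i0 * h \<nu> j * (f \<nu> l * h \<nu> i0))"
      by (rule mult[symmetric]) (use fh_int i0 jl e0 in auto)
    finally show "(L * P) $$ (j, l) = 1\<^sub>m (k \<nu>) $$ (j, l)"
      using jl nz lin_zero[OF lin[OF e0 e0]] by (auto simp: units \<kappa>_def)
  qed (use L P in auto)
  have inter: "\<rho> g * P = P * mult_rep \<nu> g" if g: "g \<in> carrier (GL n)" for g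
  proof (rule eq_matI)
    fix p j assume "p < dim_row (P * mult_rep \<nu> g)" "j < dim_col (P * mult_rep \<nu> g)"
    then have pj: "p < e" "j < k \<nu>" using P carrier_matD[OF mult_rep_carrier[of \<nu> g]] by auto
    have fc: "mentry \<nu> (?T g) l j \<cdot>\<^sub>m f \<nu> l \<in> carrier_mat N (d \<nu>)" if "l \<in> {..<k \<nu>}" for l
      using f_carrier that by simp
    have "(\<rho> g * P) $$ (p, j) = (\<Sum>r<e. F p r (?T g) * F r 0 (f \<nu> j * h \<nu> i0))"
      unfolding mat_mult_index[OF is_rep_carrier[OF R g] P pj]
      by (rule sum.cong) (use pj F g in \<open>auto simp: P_def\<close>)
    also have "\<dots> = F p 0 (?T g * (f \<nu> j * h \<nu> i0))"
      by (rule mult[symmetric]) (use tensor_power_GL_intertwiner fh_int i0 pj e0 in auto)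
    also have "?T g * (f \<nu> j * h \<nu> i0) = ?T g * f \<nu> j * h \<nu> i0"
      using carrier_matD[OF f_carrier[OF pj(2)]] carrier_matD[OF h_carrier[OF i0]]
        carrier_matD[OF tensor_power_GL_carrier[of m n g]] by (simp add: mat_assoc)
    also have "\<dots> = mat_sum N N {..<k \<nu>} (\<lambda>l. mentry \<nu> (?T g) l j \<cdot>\<^sub>m f \<nu> l * h \<nu> i0)"
      unfolding act_f[OF tensor_power_GL_intertwiner pj(2)] by (rule mat_sum_mult[OF h_carrier[OF i0] fc])
    also have "\<dots> = mat_sum N N {..<k \<nu>} (\<lambda>l. mentry \<nu> (?T g) l j \<cdot>\<^sub>m (f \<nu> l * h \<nu> i0))"
      by (rule mat_sum_cong[OF refl]) (use mult_smult_assoc_mat[OF f_carrier h_carrier[OF i0]] in auto)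
    also have "F p 0 \<dots> = (\<Sum>l<k \<nu>. F p 0 (mentry \<nu> (?T g) l j \<cdot>\<^sub>m (f \<nu> l * h \<nu> i0)))"
      by (rule lin_mat_sum[OF lin[OF pj(1) e0]]) (use fh_carrier i0 in auto)
    also have "\<dots> = (\<Sum>l<k \<nu>. P $$ (p, l) * mult_rep \<nu> g $$ (l, j))"
    proof (rule sum.cong[OF refl])
      fix l assume "l \<in> {..<k \<nu>}"
      then have l: "l < k \<nu>" by simp
      show "F p 0 (mentry \<nu> (?T g) l j \<cdot>\<^sub>m (f \<nu> l * h \<nu> i0)) = P $$ (p, l) * mult_rep \<nu> g $$ (l, j)"
        using lin_smult[OF lin[OF pj(1) e0] fh_carrier[OF l i0]] pj l by (simp add: P_def mult_rep_def)
    qed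
    also have "\<dots> = (P * mult_rep \<nu> g) $$ (p, j)"
      by (rule mat_mult_index[OF P mult_rep_carrier pj, symmetric])
    finally show "(\<rho> g * P) $$ (p, j) = (P * mult_rep \<nu> g) $$ (p, j)" .
  qed (use P carrier_matD[OF mult_rep_carrier[of \<nu> g]] carrier_matD[OF is_rep_carrier[OF R g]] in auto)
  \<comment> \<open>The image of \<open>P\<close> is invariant and nonzero, hence everything. A
    right inverse \<open>Y\<close> of \<open>P\<close> built from preimages of the unit vectors must
    then agree with the left inverse \<open>L\<close>.\<close>
  define U where "U = (\<lambda>v. P *\<^sub>v v) ` carrier_vec (k \<nu>)"
  have "U = {0\<^sub>v e} \<or> U = carrier_vec e"
  proof (rule irrep_cases[OF irrW])
    show "U \<subseteq> carrier_vec e" using P by (auto simp: U_def)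
    have "P *\<^sub>v 0\<^sub>v (k \<nu>) = 0\<^sub>v e" using P by auto
    then show "0\<^sub>v e \<in> U" unfolding U_def by (intro image_eqI[of _ _ "0\<^sub>v (k \<nu>)"]) auto
    show "u + w \<in> U" if uw: "u \<in> U" "w \<in> U" for u w
    proof -
      obtain u' where u': "u' \<in> carrier_vec (k \<nu>)" "u = P *\<^sub>v u'" using uw(1) unfolding U_def by blast
      obtain w' where w': "w' \<in> carrier_vec (k \<nu>)" "w = P *\<^sub>v w'" using uw(2) unfolding U_def by blast
      show ?thesis unfolding U_def
        by (rule image_eqI[of _ _ "u' + w'"])
          (use u' w' mult_add_distrib_mat_vec[OF P u'(1) w'(1)] in auto)
    qed
    show "c \<cdot>\<^sub>v u \<in> U" if u: "u \<in> U" for c u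
    proof -
      obtain u' where u': "u' \<in> carrier_vec (k \<nu>)" "u = P *\<^sub>v u'" using u unfolding U_def by blast
      show ?thesis unfolding U_def
        by (rule image_eqI[of _ _ "c \<cdot>\<^sub>v u'"]) (use u' mult_mat_vec[OF P u'(1)] in auto)
    qed
    show "\<rho> g *\<^sub>v u \<in> U" if g: "g \<in> carrier (GL n)" and u: "u \<in> U" for g u
    proof -
      obtain u' where u': "u' \<in> carrier_vec (k \<nu>)" "u = P *\<^sub>v u'" using u unfolding U_def by blast
      have "\<rho> g *\<^sub>v u = P *\<^sub>v (mult_rep \<nu> g *\<^sub>v u')"
        using assoc_mult_mat_vec[OF is_rep_carrier[OF R g] P u'(1)] assoc_mult_mat_vec[OF P mult_rep_carrier u'(1)]
          inter[OF g] u'(2) by simp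
      moreover have "mult_rep \<nu> g *\<^sub>v u' \<in> carrier_vec (k \<nu>)"
        using mult_rep_carrier u'(1) by (rule mult_mat_vec_carrier)
      ultimately show ?thesis unfolding U_def by (intro image_eqI)
    qed
  qed
  moreover have "U \<noteq> {0\<^sub>v e}"
  proof
    assume "U = {0\<^sub>v e}"
    then have "P *\<^sub>v unit_vec (k \<nu>) i0 = 0\<^sub>v e" by (auto simp: U_def)
    then have "(P *\<^sub>v unit_vec (k \<nu>) i0) $ 0 = 0" using e0 by simp
    moreover have "(P *\<^sub>v unit_vec (k \<nu>) i0) $ 0 = P $$ (0, i0)" using P e0 i0 by simp
    ultimately show False using nz e0 i0 by (simp add: P_def)
  qed
  ultimately have "U = carrier_vec e" by blast
  then have "\<forall>q<e. \<exists>v\<in>carrier_vec (k \<nu>). P *\<^sub>v v = unit_vec e q"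
    unfolding U_def by (auto simp: set_eq_iff image_iff) (metis unit_vec_carrier)
  then obtain v where v: "\<And>q. q < e \<Longrightarrow> v q \<in> carrier_vec (k \<nu>)" "\<And>q. q < e \<Longrightarrow> P *\<^sub>v v q = unit_vec e q"
    by metis
  define Y where "Y = mat (k \<nu>) e (\<lambda>(i, q). v q $ i)"
  have Y: "Y \<in> carrier_mat (k \<nu>) e" by (simp add: Y_def)
  have PY: "P * Y = 1\<^sub>m e"
  proof (rule eq_matI)
    fix p q assume "p < dim_row (1\<^sub>m e)" "q < dim_col (1\<^sub>m e)"
    then have pq: "p < e" "q < e" by auto
    have "col Y q = v q" using v(1)[OF pq(2)] pq by (intro eq_vecI) (auto simp: Y_def)
    then have "(P * Y) $$ (p, q) = (P *\<^sub>v v q) $ p" using P Y pq by simp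
    then show "(P * Y) $$ (p, q) = 1\<^sub>m e $$ (p, q)" using v(2)[OF pq(2)] pq by simp
  qed (use P Y in auto)
  have "L = L * (P * Y)" using PY L by simp
  also have "\<dots> = L * P * Y" using carrier_matD[OF L] carrier_matD[OF P] carrier_matD[OF Y] by (simp add: mat_assoc)
  also have "\<dots> = Y" using LP left_mult_one_mat[OF Y] by simp
  finally have "P * L = 1\<^sub>m e" using PY by simp
  then show thesis using that[OF \<nu> P L LP _ inter] by blast
qed

end

section \<open>Weight multiplicities, Kostka numbers and the identification of the index\<close>

context specht_family
begin

text \<open>At diagonal matrices the trace on the component of \<open>V \<nu>\<close> is
  \<open>d \<nu>\<close> times the character of the multiplicity space, that is, of
  \<open>\<rho>\<close>. Comparing the coefficients of one monomial makes weight multiplicities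
  equal to Kostka numbers.\<close>

lemma weight_multiplicity:
  assumes \<nu>: "\<nu> \<in> \<Lambda>" and ch: "has_character n \<rho> (schur \<mu> n)"
    and tr: "\<And>g. g \<in> carrier (GL n) \<Longrightarrow> trace_mat (\<rho> g) = trace_mat (mult_rep \<nu> g)"
  shows "trace_mat (weight_proj m n A * Q \<nu>)
    = of_nat (d \<nu>) * of_nat (card {T \<in> ssyt \<mu> n. tableau_content \<mu> T = image_mset Suc A})"
proof -
  let ?B = "tensor_basis m n" and ?T = "tensor_power_GL m n"
  interpret isotypic_component "sym_group m" "d \<nu>" "V \<nu>" N TS "k \<nu>" "f \<nu>" "h \<nu>"
    by (rule component[OF \<nu>])
  \<comment> \<open>Both sides of the character identity go into one family over a disjoint sum,
    tableaux with a negative sign; \<open>Suc\<close> below translates letters into variable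
    numbers.\<close>
  define b where "b = case_sum (\<lambda>J. tentry m n (Q \<nu>) J J) (\<lambda>T :: nat \<times> nat \<Rightarrow> nat. - of_nat (d \<nu>))"
  define M where "M = case_sum (\<lambda>J. image_mset Suc (weight m J)) (tableau_content \<mu>)"
  let ?S = "?B <+> ssyt \<mu> n"
  have "(\<Sum>p\<in>{p \<in> ?S. M p = image_mset Suc A}. b p) = 0"
  proof (rule family_coeffs_zero[where Y = "{1..n}"])
    show "finite ?S" by simp
    show "set_mset (M p) \<subseteq> {1..n}" if p: "p \<in> ?S" for p
    proof (cases p)
      case (Inl J)
      then have "J \<in> ?B" using p by auto
      from weight_subset[OF this] show ?thesis using Inl by (auto simp: M_def)
    next
      case (Inr T)
      then have "T \<in> ssyt \<mu> n" using p by auto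
      from ssyt_range[OF this] show ?thesis using Inr by (auto simp: M_def tableau_content_def)
    qed
    fix x :: "nat \<Rightarrow> complex" assume x: "\<And>y. y \<in> {1..n} \<Longrightarrow> x y \<noteq> 0"
    define g where "g = mat_diag n (\<lambda>i. x (Suc i))"
    have g: "g \<in> carrier (GL n)" unfolding g_def by (rule diag_GL) (use x in auto)
    have "of_nat (d \<nu>) * schur \<mu> n x = of_nat (d \<nu>) * trace_mat (mult_rep \<nu> g)"
      using ch x tr[OF g] unfolding has_character_def g_def by simp
    also have "\<dots> = trace_mat (?T g * Q \<nu>)"
      unfolding trace_proj[OF tensor_power_GL_intertwiner] by (simp add: trace_mat_def mult_rep_def)
    also have "\<dots> = (\<Sum>I\<in>?B. \<Sum>J\<in>?B. tentry m n (?T g) I J * tentry m n (Q \<nu>) J I)"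
      by (rule trace_mult_entry) auto
    also have "\<dots> = (\<Sum>I\<in>?B. \<Sum>J\<in>?B. if J = I then (\<Prod>l\<in>{1..m}. x (Suc (J l))) * tentry m n (Q \<nu>) J I else 0)"
      by (intro sum.cong refl, subst tensor_power_GL_diag[where u = "\<lambda>i. x (Suc i)"])
        (auto simp: g_def mat_diag_def)
    also have "\<dots> = (\<Sum>J\<in>?B. tentry m n (Q \<nu>) J J * (\<Prod>y\<in>#image_mset Suc (weight m J). x y))"
      by (intro sum.cong refl)
        (simp add: weight_def image_mset.compositionality comp_def prod_unfold_prod_mset mult.commute)
    finally have eq: "of_nat (d \<nu>) * schur \<mu> n x
      = (\<Sum>J\<in>?B. tentry m n (Q \<nu>) J J * (\<Prod>y\<in>#image_mset Suc (weight m J). x y))" .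
    have "(\<Sum>p\<in>?S. b p * (\<Prod>y\<in>#M p. x y))
      = (\<Sum>J\<in>?B. tentry m n (Q \<nu>) J J * (\<Prod>y\<in>#image_mset Suc (weight m J). x y))
        + (\<Sum>T\<in>ssyt \<mu> n. - of_nat (d \<nu>) * (\<Prod>y\<in>#tableau_content \<mu> T. x y))"
      by (simp add: sum.Plus comp_def b_def M_def)
    also have "\<dots> = 0" unfolding eq[symmetric] schur_content by (simp add: sum_distrib_left sum_negf)
    finally show "(\<Sum>p\<in>?S. b p * (\<Prod>y\<in>#M p. x y)) = 0" .
  qed auto
  moreover have "{p \<in> ?S. M p = image_mset Suc A}
    = {J \<in> ?B. weight m J = A} <+> {T \<in> ssyt \<mu> n. tableau_content \<mu> T = image_mset Suc A}"
  proof -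
    have "image_mset Suc X = image_mset Suc Y \<longleftrightarrow> X = Y" for X Y :: "nat multiset"
      using multiset.inj_map[of Suc] by (auto dest: injD)
    then show ?thesis by (auto simp: M_def)
  qed
  ultimately have "(\<Sum>J\<in>{J \<in> ?B. weight m J = A}. tentry m n (Q \<nu>) J J)
    = of_nat (d \<nu>) * of_nat (card {T \<in> ssyt \<mu> n. tableau_content \<mu> T = image_mset Suc A})"
    by (simp add: sum.Plus comp_def b_def algebra_simps)
  then show ?thesis unfolding trace_weight_proj_mult[OF isotypic_proj_carrier] .
qed

text \<open>The superstandard tableau of shape \<open>\<mu>\<close> puts the weight
  \<open>\<mu>\<close> into the component of \<open>\<nu>\<close>, so \<open>\<nu>\<close> dominates
  \<open>\<mu>\<close>. Conversely the weight \<open>\<nu>\<close> lives in its own component, which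
  produces a tableau of shape \<open>\<mu>\<close> and content \<open>\<nu>\<close>, so
  \<open>\<mu>\<close> dominates \<open>\<nu>\<close>.\<close>

lemma mult_rep_character_index:
  assumes \<mu>: "\<mu> \<in> \<Lambda>" and \<nu>: "\<nu> \<in> \<Lambda>" and ch: "has_character n \<rho> (schur \<mu> n)"
    and tr: "\<And>g. g \<in> carrier (GL n) \<Longrightarrow> trace_mat (\<rho> g) = trace_mat (mult_rep \<nu> g)"
  shows "\<nu> = \<mu>"
proof -
  have mult: "trace_mat (weight_proj m n A * Q \<nu>)
    = of_nat (d \<nu>) * of_nat (card {T \<in> ssyt \<mu> n. tableau_content \<mu> T = image_mset Suc A})" for A
    by (rule weight_multiplicity[OF \<nu> ch tr])
  obtain T where T: "T \<in> ssyt \<mu> n" "tableau_content \<mu> T = image_mset Suc (shape_weight \<mu>)"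
    using superstandard_tableau[OF \<mu>] unfolding tableau_content_def .
  then have "{T \<in> ssyt \<mu> n. tableau_content \<mu> T = image_mset Suc (shape_weight \<mu>)} \<noteq> {}" by blast
  then have "card {T \<in> ssyt \<mu> n. tableau_content \<mu> T = image_mset Suc (shape_weight \<mu>)} \<noteq> 0"
    by (simp only: card_eq_0_iff) simp
  then have "trace_mat (weight_proj m n (shape_weight \<mu>) * Q \<nu>) \<noteq> 0"
    unfolding mult mult_eq_0_iff of_nat_eq_0_iff using irrep_pos[OF irr[OF \<nu>]] by (metis less_irrefl)
  then have 1: "dominated (shape_weight \<mu>) (shape_weight \<nu>)"
    by (rule trace_weight_proj_Q_dominated[OF \<nu>])
  have "card {T \<in> ssyt \<mu> n. tableau_content \<mu> T = image_mset Suc (shape_weight \<nu>)} \<noteq> 0"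
    using trace_weight_proj_Q[OF \<nu>] unfolding mult mult_eq_0_iff of_nat_eq_0_iff by blast
  then obtain T' where T': "T' \<in> ssyt \<mu> n" "tableau_content \<mu> T' = image_mset Suc (shape_weight \<nu>)"
    by (metis (mono_tags, lifting) Collect_empty_eq card.empty)
  have "dominated (shape_weight \<nu>) (shape_weight \<mu>)"
    by (rule tableau_content_dominated[OF partition[OF \<mu>] T'(1)]) (use T'(2) in \<open>simp add: tableau_content_def\<close>)
  then have "shape_weight \<nu> = shape_weight \<mu>" using 1 by (rule dominated_antisym)
  then show ?thesis by (rule shape_weight_eqD[OF \<nu> \<mu>])
qed

text \<open>\<open>extension_mult_rep\<close> finds some multiplicity space similar to
  \<open>\<rho>\<close>; similarity preserves traces, and the character then singles out the index
  \<open>\<mu>\<close>.\<close>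

lemma is_W_mult_rep:
  assumes \<mu>: "\<mu> \<in> \<Lambda>" and W: "is_W n \<mu> \<rho>"
  obtains P L where "is_rep (GL n) (k \<mu>) \<rho>" "P \<in> carrier_mat (k \<mu>) (k \<mu>)" "L \<in> carrier_mat (k \<mu>) (k \<mu>)"
    "L * P = 1\<^sub>m (k \<mu>)" "P * L = 1\<^sub>m (k \<mu>)" "\<And>g. g \<in> carrier (GL n) \<Longrightarrow> \<rho> g * P = P * mult_rep \<mu> g"
proof -
  obtain e F where irrW: "irrep (GL n) e \<rho>" and lin: "\<And>i j. i < e \<Longrightarrow> j < e \<Longrightarrow> lin_functional m n (F i j)"
    and F: "\<And>i j g. i < e \<Longrightarrow> j < e \<Longrightarrow> g \<in> carrier (GL n) \<Longrightarrow> F i j (tensor_power_GL m n g) = \<rho> g $$ (i, j)"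
    using is_W_extension[OF partition[OF \<mu>] W] by blast
  note R = irrep_rep[OF irrW]
  obtain \<nu> P L where \<nu>: "\<nu> \<in> \<Lambda>" and P: "P \<in> carrier_mat e (k \<nu>)" and L: "L \<in> carrier_mat (k \<nu>) e"
    and LP: "L * P = 1\<^sub>m (k \<nu>)" and PL: "P * L = 1\<^sub>m e"
    and inter: "\<And>g. g \<in> carrier (GL n) \<Longrightarrow> \<rho> g * P = P * mult_rep \<nu> g"
    using extension_mult_rep[OF irrW lin F] by blast
  have "trace_mat (\<rho> g) = trace_mat (mult_rep \<nu> g)" if g: "g \<in> carrier (GL n)" for g
  proof -
    note c = is_rep_carrier[OF R g] P L mult_rep_carrier[of \<nu> g]
    note [simp] = c[THEN carrier_matD(1)] c[THEN carrier_matD(2)]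
    have "\<rho> g = \<rho> g * (P * L)" using PL right_mult_one_mat[OF c(1)] by simp
    also have "\<dots> = \<rho> g * P * L" by (simp add: mat_assoc)
    finally have "trace_mat (\<rho> g) = trace_mat (P * (mult_rep \<nu> g * L))"
      unfolding inter[OF g] by (simp add: mat_assoc)
    also have "\<dots> = trace_mat (mult_rep \<nu> g * L * P)"
      by (rule trace_mat_mult_comm[OF P mult_carrier_mat[OF c(4) L]])
    also have "mult_rep \<nu> g * L * P = mult_rep \<nu> g" using LP right_mult_one_mat[OF c(4)] by (simp add: mat_assoc)
    finally show ?thesis .
  qed
  then have "\<nu> = \<mu>" by (intro mult_rep_character_index[OF \<mu> \<nu>, where \<rho> = \<rho>]) (use W in \<open>auto simp: is_W_def\<close>)
  moreover have "e = k \<nu>"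
  proof -
    have "(of_nat e :: complex) = of_nat (k \<nu>)" using trace_mat_mult_comm[OF P L] LP PL by simp
    then show ?thesis by (simp only: of_nat_eq_iff)
  qed
  ultimately show thesis using that R P L LP PL inter by blast
qed

end

section \<open>Assembling the isomorphism\<close>

text \<open>Unpacks the row-major numbering of index pairs that \<open>kronecker\<close>
  uses.\<close>

lemma sum_div_mod:
  fixes G :: "nat \<Rightarrow> nat \<Rightarrow> 'a :: comm_monoid_add"
  shows "(\<Sum>c<d * e. G (c div e) (c mod e)) = (\<Sum>a<d. \<Sum>b<e. G a b)"
proof -
  have "(\<Sum>c<d * e. G (c div e) (c mod e)) = (\<Sum>p\<in>{..<d} \<times> {..<e}. G (fst p) (snd p))"
  proof (rule sum.reindex_bij_witness[of _ "\<lambda>p. fst p * e + snd p" "\<lambda>c. (c div e, c mod e)"])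
    fix p assume "p \<in> {..<d} \<times> {..<e}"
    then have p: "fst p < d" "snd p < e" by auto
    have "fst p * e + snd p < Suc (fst p) * e" using p by simp
    also have "\<dots> \<le> d * e" using p by (intro mult_right_mono) auto
    finally show "fst p * e + snd p \<in> {..<d * e}" by simp
    show "((fst p * e + snd p) div e, (fst p * e + snd p) mod e) = p" using p by simp
  next
    fix c assume "c \<in> {..<d * e}"
    then have "c < d * e" by simp
    moreover from this have "e > 0" by (cases e) auto
    ultimately show "(c div e, c mod e) \<in> {..<d} \<times> {..<e}" by (simp add: less_mult_imp_div_less)
  qed auto
  then show ?thesis by (simp add: sum.cartesian_product case_prod_unfold)
qed

lemma kronecker_carrier [simp]:
  "A \<in> carrier_mat a b \<Longrightarrow> B \<in> carrier_mat c d \<Longrightarrow> kronecker A B \<in> carrier_mat (a * c) (b * d)"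
  by (auto simp: kronecker_def)

text \<open>\<open>P\<close> places the \<open>F x\<close> side by side and \<open>Q\<close> stacks
  the \<open>H x\<close>, one block at a time. The two annihilation clauses describe the part
  already assembled without its internal offsets; they give \<open>H x * P = 0\<close> and
  \<open>Q * F x = 0\<close> when the next block is joined.\<close>

lemma block_assembly:
  fixes F H :: "'i \<Rightarrow> complex mat" and n :: "'i \<Rightarrow> nat"
  assumes "distinct xs" "\<And>x. x \<in> set xs \<Longrightarrow> F x \<in> carrier_mat N (n x)"
    "\<And>x. x \<in> set xs \<Longrightarrow> H x \<in> carrier_mat (n x) N"
    "\<And>x y. x \<in> set xs \<Longrightarrow> y \<in> set xs \<Longrightarrow> H x * F y = (if x = y then 1\<^sub>m (n x) else 0\<^sub>m (n x) (n y))"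
  shows "\<exists>P Q. P \<in> carrier_mat N (sum_list (map n xs)) \<and> Q \<in> carrier_mat (sum_list (map n xs)) N \<and>
    Q * P = 1\<^sub>m (sum_list (map n xs)) \<and>
    (\<forall>r. \<forall>Y\<in>carrier_mat r N. (\<forall>x\<in>set xs. Y * F x = 0\<^sub>m r (n x)) \<longrightarrow> Y * P = 0\<^sub>m r (sum_list (map n xs))) \<and>
    (\<forall>r. \<forall>Y\<in>carrier_mat N r. (\<forall>x\<in>set xs. H x * Y = 0\<^sub>m (n x) r) \<longrightarrow> Q * Y = 0\<^sub>m (sum_list (map n xs)) r) \<and>
    (\<forall>M\<in>carrier_mat N N. \<forall>B. (\<forall>x\<in>set xs. B x \<in> carrier_mat (n x) (n x) \<and> M * F x = F x * B x) \<longrightarrow>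
       M * P = P * diag_block_mat (map B xs))"
  using assms
proof (induction xs)
  case Nil
  show ?case
    by (rule exI[of _ "0\<^sub>m N 0"], rule exI[of _ "0\<^sub>m 0 N"]) (auto intro!: eq_matI)
next
  case (Cons x xs)
  define s where "s = sum_list (map n xs)"
  let ?R = "\<lambda>P Q. P \<in> carrier_mat N s \<and> Q \<in> carrier_mat s N \<and> Q * P = 1\<^sub>m s \<and>
    (\<forall>r. \<forall>Y\<in>carrier_mat r N. (\<forall>x\<in>set xs. Y * F x = 0\<^sub>m r (n x)) \<longrightarrow> Y * P = 0\<^sub>m r s) \<and>
    (\<forall>r. \<forall>Y\<in>carrier_mat N r. (\<forall>x\<in>set xs. H x * Y = 0\<^sub>m (n x) r) \<longrightarrow> Q * Y = 0\<^sub>m s r) \<and>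
    (\<forall>M\<in>carrier_mat N N. \<forall>B. (\<forall>x\<in>set xs. B x \<in> carrier_mat (n x) (n x) \<and> M * F x = F x * B x) \<longrightarrow>
       M * P = P * diag_block_mat (map B xs))"
  have "\<exists>P Q. ?R P Q"
    unfolding s_def
  proof (rule Cons.IH)
    show "distinct xs" using Cons.prems(1) by simp
    show "F y \<in> carrier_mat N (n y)" "H y \<in> carrier_mat (n y) N" if "y \<in> set xs" for y
      using that by (auto intro: Cons.prems(2,3))
    show "H y * F z = (if y = z then 1\<^sub>m (n y) else 0\<^sub>m (n y) (n z))" if "y \<in> set xs" "z \<in> set xs" for y z
      by (rule Cons.prems(4)) (use that in auto)
  qed
  then obtain P Q where PQ: "?R P Q" by (elim exE) (rule that)
  note PQ' = PQ[THEN conjunct2, THEN conjunct2]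
  have P: "P \<in> carrier_mat N s" by (rule PQ[THEN conjunct1])
  have Q: "Q \<in> carrier_mat s N" by (rule PQ[THEN conjunct2, THEN conjunct1])
  have QP: "Q * P = 1\<^sub>m s" by (rule PQ'[THEN conjunct1])
  note YP = PQ'[THEN conjunct2, THEN conjunct1, THEN spec, THEN bspec, THEN mp]
  note QY = PQ'[THEN conjunct2, THEN conjunct2, THEN conjunct1, THEN spec, THEN bspec, THEN mp]
  note MP = PQ'[THEN conjunct2, THEN conjunct2, THEN conjunct2, THEN bspec, THEN spec, THEN mp]
  have F: "F x \<in> carrier_mat N (n x)" and H: "H x \<in> carrier_mat (n x) N"
    by (auto intro: Cons.prems(2,3))
  have HF: "H x * F x = 1\<^sub>m (n x)" using Cons.prems(4)[of x x] by simp
  have HP: "H x * P = 0\<^sub>m (n x) s"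
  proof (rule YP[OF H], rule ballI)
    fix y assume "y \<in> set xs"
    then show "H x * F y = 0\<^sub>m (n x) (n y)" using Cons.prems(1) Cons.prems(4)[of x y] by auto
  qed
  have QF: "Q * F x = 0\<^sub>m s (n x)"
  proof (rule QY[OF F], rule ballI)
    fix y assume "y \<in> set xs"
    then show "H y * F x = 0\<^sub>m (n y) (n x)" using Cons.prems(1) Cons.prems(4)[of y x] by auto
  qed
  \<comment> \<open>Blocks of height or width 0 let \<open>four_block_mat\<close> express plain
    juxtaposition.\<close>
  define P' where "P' = four_block_mat (F x) P (0\<^sub>m 0 (n x)) (0\<^sub>m 0 s)"
  define Q' where "Q' = four_block_mat (H x) (0\<^sub>m (n x) 0) Q (0\<^sub>m s 0)"
  have P': "P' \<in> carrier_mat N (n x + s)" and Q': "Q' \<in> carrier_mat (n x + s) N"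
    unfolding P'_def Q'_def using F P H Q by auto
  have z: "(0\<^sub>m 0 i :: complex mat) \<in> carrier_mat 0 i" "(0\<^sub>m i 0 :: complex mat) \<in> carrier_mat i 0" for i by auto
  have YP': "Y * P' = four_block_mat (Y * F x) (Y * P) (0\<^sub>m 0 (n x)) (0\<^sub>m 0 s)" if Y: "Y \<in> carrier_mat r N" for Y r
  proof -
    have "Y = four_block_mat Y (0\<^sub>m r 0) (0\<^sub>m 0 N) (0\<^sub>m 0 0)" using Y by (intro eq_matI) auto
    then have "Y * P' = four_block_mat Y (0\<^sub>m r 0) (0\<^sub>m 0 N) (0\<^sub>m 0 0) * P'" by simp
    also have "\<dots> = four_block_mat (Y * F x + 0\<^sub>m r 0 * 0\<^sub>m 0 (n x)) (Y * P + 0\<^sub>m r 0 * 0\<^sub>m 0 s)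
        (0\<^sub>m 0 N * F x + 0\<^sub>m 0 0 * 0\<^sub>m 0 (n x)) (0\<^sub>m 0 N * P + 0\<^sub>m 0 0 * 0\<^sub>m 0 s)"
      unfolding P'_def by (rule mult_four_block_mat[OF Y z(2) z(1) z(1) F P z(1) z(1)])
    also have "\<dots> = four_block_mat (Y * F x) (Y * P) (0\<^sub>m 0 (n x)) (0\<^sub>m 0 s)"
      using Y F P by (intro arg_cong4[of _ _ _ _ _ _ _ _ four_block_mat] eq_matI) auto
    finally show ?thesis .
  qed
  have Q'Y: "Q' * Y = four_block_mat (H x * Y) (0\<^sub>m (n x) 0) (Q * Y) (0\<^sub>m s 0)" if Y: "Y \<in> carrier_mat N r" for Y r
  proof -
    have "Y = four_block_mat Y (0\<^sub>m N 0) (0\<^sub>m 0 r) (0\<^sub>m 0 0)" using Y by (intro eq_matI) auto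
    then have "Q' * Y = Q' * four_block_mat Y (0\<^sub>m N 0) (0\<^sub>m 0 r) (0\<^sub>m 0 0)" by simp
    also have "\<dots> = four_block_mat (H x * Y + 0\<^sub>m (n x) 0 * 0\<^sub>m 0 r) (H x * 0\<^sub>m N 0 + 0\<^sub>m (n x) 0 * 0\<^sub>m 0 0)
        (Q * Y + 0\<^sub>m s 0 * 0\<^sub>m 0 r) (Q * 0\<^sub>m N 0 + 0\<^sub>m s 0 * 0\<^sub>m 0 0)"
      unfolding Q'_def by (rule mult_four_block_mat[OF H z(2) Q z(2) Y z(2) z(1) z(1)])
    also have "\<dots> = four_block_mat (H x * Y) (0\<^sub>m (n x) 0) (Q * Y) (0\<^sub>m s 0)"
      using Y H Q by (intro arg_cong4[of _ _ _ _ _ _ _ _ four_block_mat] eq_matI) auto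
    finally show ?thesis .
  qed
  have "Q' * P' = four_block_mat (H x * F x + 0\<^sub>m (n x) 0 * 0\<^sub>m 0 (n x)) (H x * P + 0\<^sub>m (n x) 0 * 0\<^sub>m 0 s)
      (Q * F x + 0\<^sub>m s 0 * 0\<^sub>m 0 (n x)) (Q * P + 0\<^sub>m s 0 * 0\<^sub>m 0 s)"
    unfolding P'_def Q'_def by (rule mult_four_block_mat[OF H z(2) Q z(2) F P z(1) z(1)])
  also have "\<dots> = 1\<^sub>m (n x + s)"
    unfolding HF HP QF QP by (rule eq_matI) auto
  finally have 1: "Q' * P' = 1\<^sub>m (n x + s)" .
  have 2: "Y * P' = 0\<^sub>m r (n x + s)" if "Y \<in> carrier_mat r N" "\<forall>y\<in>set (x # xs). Y * F y = 0\<^sub>m r (n y)" for r Y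
    unfolding YP'[OF that(1)] using that YP[OF that(1)] by (intro eq_matI) auto
  have 3: "Q' * Y = 0\<^sub>m (n x + s) r" if "Y \<in> carrier_mat N r" "\<forall>y\<in>set (x # xs). H y * Y = 0\<^sub>m (n y) r" for r Y
    unfolding Q'Y[OF that(1)] using that QY[OF that(1)] by (intro eq_matI) auto
  have 4: "M * P' = P' * diag_block_mat (map B (x # xs))"
    if M: "M \<in> carrier_mat N N" and B: "\<forall>y\<in>set (x # xs). B y \<in> carrier_mat (n y) (n y) \<and> M * F y = F y * B y" for M B
  proof -
    define D where "D = diag_block_mat (map B xs)"
    have "map dim_row (map B xs) = map n xs" "map dim_col (map B xs) = map n xs" using B by auto
    then have D: "D \<in> carrier_mat s s" unfolding D_def s_def
      by (intro carrier_matI) (simp_all only: dim_diag_block_mat)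
    have Bx: "B x \<in> carrier_mat (n x) (n x)" using B by simp
    have "diag_block_mat (map B (x # xs)) = four_block_mat (B x) (0\<^sub>m (n x) s) (0\<^sub>m s (n x)) D"
      using Bx D by (simp add: Let_def D_def[symmetric])
    then have "P' * diag_block_mat (map B (x # xs))
      = four_block_mat (F x * B x + P * 0\<^sub>m s (n x)) (F x * 0\<^sub>m (n x) s + P * D)
        (0\<^sub>m 0 (n x) * B x + 0\<^sub>m 0 s * 0\<^sub>m s (n x)) (0\<^sub>m 0 (n x) * 0\<^sub>m (n x) s + 0\<^sub>m 0 s * D)"
      unfolding P'_def using mult_four_block_mat[OF F P z(1) z(1) Bx zero_carrier_mat zero_carrier_mat D] by simp
    also have "\<dots> = four_block_mat (F x * B x) (P * D) (0\<^sub>m 0 (n x)) (0\<^sub>m 0 s)"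
      using F P Bx D by (intro arg_cong4[of _ _ _ _ _ _ _ _ four_block_mat] eq_matI) auto
    also have "\<dots> = M * P'"
      unfolding YP'[OF M] using B MP[OF M, of B] by (simp add: D_def)
    finally show ?thesis by simp
  qed
  have "sum_list (map n (x # xs)) = n x + s" by (simp add: s_def)
  then show ?case using P' Q' 1 2 3 4 by (simp only:) (rule exI[of _ P'], rule exI[of _ Q'], blast)
qed

section \<open>The isomorphism on one component and on the whole tensor power\<close>

context specht_family
begin

text \<open>The bases \<open>f \<mu>\<close> and \<open>h \<mu>\<close> are changed by
  \<open>L\<close> and \<open>P\<close> into \<open>fb\<close> and \<open>hb\<close>, on which the
  group acts through \<open>\<rho>\<close> itself and not only through the similar
  \<open>mult_rep \<mu>\<close>. The columns of the \<open>fb b\<close> are then a basis in which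
  the pair acts by the Kronecker product.\<close>

lemma component_block:
  assumes \<mu>: "\<mu> \<in> \<Lambda>" and W: "is_W n \<mu> \<rho>"
  obtains F H where "F \<in> carrier_mat N (d \<mu> * k \<mu>)" "H \<in> carrier_mat (d \<mu> * k \<mu>) N"
    "H * F = 1\<^sub>m (d \<mu> * k \<mu>)" "Q \<mu> * F = F" "H * Q \<mu> = H"
    "\<And>s g. s \<in> carrier (sym_group m) \<Longrightarrow> g \<in> carrier (GL n) \<Longrightarrow>
      kronecker (V \<mu> s) (\<rho> g) \<in> carrier_mat (d \<mu> * k \<mu>) (d \<mu> * k \<mu>) \<and>
      TS s * tensor_power_GL m n g * F = F * kronecker (V \<mu> s) (\<rho> g)"
proof -
  obtain P L where R: "is_rep (GL n) (k \<mu>) \<rho>" and P: "P \<in> carrier_mat (k \<mu>) (k \<mu>)" and L: "L \<in> carrier_mat (k \<mu>) (k \<mu>)"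
    and LP: "L * P = 1\<^sub>m (k \<mu>)" and PL: "P * L = 1\<^sub>m (k \<mu>)"
    and inter: "\<And>g. g \<in> carrier (GL n) \<Longrightarrow> \<rho> g * P = P * mult_rep \<mu> g"
    using is_W_mult_rep[OF \<mu> W] by blast
  interpret isotypic_component "sym_group m" "d \<mu>" "V \<mu>" N TS "k \<mu>" "f \<mu>" "h \<mu>"
    by (rule component[OF \<mu>])
  let ?T = "tensor_power_GL m n" and ?d = "d \<mu>" and ?k = "k \<mu>"
  define fb where "fb = (\<lambda>b. mat_sum N ?d {..<?k} (\<lambda>c. L $$ (c, b) \<cdot>\<^sub>m f \<mu> c))"
  define hb where "hb = (\<lambda>b. mat_sum ?d N {..<?k} (\<lambda>c. P $$ (b, c) \<cdot>\<^sub>m h \<mu> c))"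
  have fb: "fb b \<in> carrier_mat N ?d" and hb: "hb b \<in> carrier_mat ?d N" for b by (auto simp: fb_def hb_def)
  have Lf: "L $$ (c, b) \<cdot>\<^sub>m f \<mu> c \<in> carrier_mat N ?d" if "c \<in> {..<?k}" for c b using f_carrier that by simp
  have Ph: "P $$ (b, c) \<cdot>\<^sub>m h \<mu> c \<in> carrier_mat ?d N" if "c \<in> {..<?k}" for c b using h_carrier that by simp
  have hb_fb: "hb b * fb b' = (if b = b' then 1\<^sub>m ?d else 0\<^sub>m ?d ?d)" if b: "b < ?k" "b' < ?k" for b b'
  proof -
    have hbf: "hb b * f \<mu> c = P $$ (b, c) \<cdot>\<^sub>m 1\<^sub>m ?d" if c: "c < ?k" for c
    proof -
      have "hb b * f \<mu> c = mat_sum ?d ?d {..<?k} (\<lambda>c'. P $$ (b, c') \<cdot>\<^sub>m h \<mu> c' * f \<mu> c)"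
        unfolding hb_def by (rule mat_sum_mult[OF f_carrier[OF c] Ph])
      also have "\<dots> = P $$ (b, c) \<cdot>\<^sub>m h \<mu> c * f \<mu> c"
      proof (rule mat_sum_single)
        show "c \<in> {..<?k}" using c by simp
        show "P $$ (b, c) \<cdot>\<^sub>m h \<mu> c * f \<mu> c \<in> carrier_mat ?d ?d"
          using mult_carrier_mat[OF Ph f_carrier[OF c]] c by simp
        fix c' assume "c' \<in> {..<?k}" "c' \<noteq> c"
        then show "P $$ (b, c') \<cdot>\<^sub>m h \<mu> c' * f \<mu> c = 0\<^sub>m ?d ?d"
          using mult_smult_assoc_mat[OF h_carrier f_carrier[OF c], of c' "P $$ (b, c')"] orth[of c' c] c by simp
      qed simp
      also have "\<dots> = P $$ (b, c) \<cdot>\<^sub>m 1\<^sub>m ?d"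
        using mult_smult_assoc_mat[OF h_carrier[OF c] f_carrier[OF c]] orth[OF c c] by simp
      finally show ?thesis .
    qed
    have "hb b * fb b' = mat_sum ?d ?d {..<?k} (\<lambda>c. hb b * (L $$ (c, b') \<cdot>\<^sub>m f \<mu> c))"
      unfolding fb_def by (rule mult_mat_sum[OF hb Lf])
    also have "\<dots> = mat_sum ?d ?d {..<?k} (\<lambda>c. (P $$ (b, c) * L $$ (c, b')) \<cdot>\<^sub>m 1\<^sub>m ?d)"
    proof (rule mat_sum_cong[OF refl])
      fix c assume "c \<in> {..<?k}"
      then have c: "c < ?k" by simp
      show "hb b * (L $$ (c, b') \<cdot>\<^sub>m f \<mu> c) = (P $$ (b, c) * L $$ (c, b')) \<cdot>\<^sub>m 1\<^sub>m ?d"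
        unfolding mult_smult_distrib[OF hb f_carrier[OF c]] hbf[OF c] by (rule eq_matI) auto
    qed
    also have "\<dots> = (if b = b' then 1\<^sub>m ?d else 0\<^sub>m ?d ?d)"
    proof (rule eq_matI)
      fix i j assume "i < dim_row (if b = b' then 1\<^sub>m ?d else 0\<^sub>m ?d ?d)" "j < dim_col (if b = b' then 1\<^sub>m ?d else 0\<^sub>m ?d ?d)"
      then have ij: "i < ?d" "j < ?d" by (auto split: if_splits)
      have "(\<Sum>c<?k. P $$ (b, c) * L $$ (c, b')) = 1\<^sub>m ?k $$ (b, b')"
        using mat_mult_index[OF P L b] PL by simp
      then show "mat_sum ?d ?d {..<?k} (\<lambda>c. (P $$ (b, c) * L $$ (c, b')) \<cdot>\<^sub>m 1\<^sub>m ?d) $$ (i, j)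
        = (if b = b' then 1\<^sub>m ?d else 0\<^sub>m ?d ?d) $$ (i, j)"
        using ij b by auto
    qed auto
    finally show ?thesis .
  qed
  have TS_fb: "TS s * fb b = fb b * V \<mu> s" if s: "s \<in> carrier (sym_group m)" for s b
  proof -
    have "TS s * fb b = mat_sum N ?d {..<?k} (\<lambda>c. TS s * (L $$ (c, b) \<cdot>\<^sub>m f \<mu> c))"
      unfolding fb_def by (rule mult_mat_sum[OF TS_carrier[OF s] Lf])
    also have "\<dots> = mat_sum N ?d {..<?k} (\<lambda>c. L $$ (c, b) \<cdot>\<^sub>m f \<mu> c * V \<mu> s)"
    proof (rule mat_sum_cong[OF refl])
      fix c assume "c \<in> {..<?k}"
      then have c: "c < ?k" by simp
      show "TS s * (L $$ (c, b) \<cdot>\<^sub>m f \<mu> c) = L $$ (c, b) \<cdot>\<^sub>m f \<mu> c * V \<mu> s"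
        unfolding mult_smult_distrib[OF TS_carrier[OF s] f_carrier[OF c]]
          mult_smult_assoc_mat[OF f_carrier[OF c] rep_carrier(1)[OF s]]
        using intertwinerD(2)[OF f_int[OF c] s] by simp
    qed
    also have "\<dots> = fb b * V \<mu> s"
      unfolding fb_def by (rule mat_sum_mult[OF rep_carrier(1)[OF s] Lf, symmetric])
    finally show ?thesis .
  qed
  have fb_int: "intertwiner (sym_group m) ?d (V \<mu>) N TS (fb b)" for b
    using fb TS_fb by (simp add: intertwiner_def)
  have hb_int: "intertwiner (sym_group m) N TS ?d (V \<mu>) (hb b)" for b
    unfolding intertwiner_def
  proof (intro conjI ballI hb)
    fix s assume s: "s \<in> carrier (sym_group m)"
    have "hb b * TS s = mat_sum ?d N {..<?k} (\<lambda>c. P $$ (b, c) \<cdot>\<^sub>m h \<mu> c * TS s)"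
      unfolding hb_def by (rule mat_sum_mult[OF TS_carrier[OF s] Ph])
    also have "\<dots> = mat_sum ?d N {..<?k} (\<lambda>c. V \<mu> s * (P $$ (b, c) \<cdot>\<^sub>m h \<mu> c))"
    proof (rule mat_sum_cong[OF refl])
      fix c assume "c \<in> {..<?k}"
      then have c: "c < ?k" by simp
      show "P $$ (b, c) \<cdot>\<^sub>m h \<mu> c * TS s = V \<mu> s * (P $$ (b, c) \<cdot>\<^sub>m h \<mu> c)"
        unfolding mult_smult_distrib[OF rep_carrier(1)[OF s] h_carrier[OF c]]
          mult_smult_assoc_mat[OF h_carrier[OF c] TS_carrier[OF s]]
        using intertwinerD(2)[OF h_int[OF c] s] by simp
    qed
    also have "\<dots> = V \<mu> s * hb b"
      unfolding hb_def by (rule mult_mat_sum[OF rep_carrier(1)[OF s] Ph, symmetric])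
    finally show "hb b * TS s = V \<mu> s * hb b" .
  qed
  have T_fb: "?T g * fb b = mat_sum N ?d {..<?k} (\<lambda>b'. \<rho> g $$ (b', b) \<cdot>\<^sub>m fb b')"
    if g: "g \<in> carrier (GL n)" and b: "b < ?k" for g b
  proof -
    note c = is_rep_carrier[OF R g] P L mult_rep_carrier[of \<mu> g]
    note [simp] = c[THEN carrier_matD(1)] c[THEN carrier_matD(2)]
    have "mult_rep \<mu> g * L = L * P * (mult_rep \<mu> g * L)"
      unfolding LP using left_mult_one_mat[OF mult_carrier_mat[OF c(4) L]] by simp
    also have "\<dots> = L * (P * mult_rep \<mu> g) * L" by (simp add: mat_assoc)
    also have "\<dots> = L * (\<rho> g * (P * L))" unfolding inter[OF g, symmetric] by (simp add: mat_assoc)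
    also have "\<dots> = L * \<rho> g" unfolding PL using right_mult_one_mat[OF c(1)] by simp
    finally have \<sigma>L: "mult_rep \<mu> g * L = L * \<rho> g" .
    have "?T g * fb b = mat_sum N ?d {..<?k} (\<lambda>c. ?T g * (L $$ (c, b) \<cdot>\<^sub>m f \<mu> c))"
      unfolding fb_def by (rule mult_mat_sum[OF tensor_power_GL_carrier Lf])
    also have "\<dots> = mat_sum N ?d {..<?k} (\<lambda>c. L $$ (c, b) \<cdot>\<^sub>m mat_sum N ?d {..<?k} (\<lambda>l. mult_rep \<mu> g $$ (l, c) \<cdot>\<^sub>m f \<mu> l))"
    proof (rule mat_sum_cong[OF refl])
      fix c assume "c \<in> {..<?k}"
      then have c: "c < ?k" by simp
      show "?T g * (L $$ (c, b) \<cdot>\<^sub>m f \<mu> c) = L $$ (c, b) \<cdot>\<^sub>m mat_sum N ?d {..<?k} (\<lambda>l. mult_rep \<mu> g $$ (l, c) \<cdot>\<^sub>m f \<mu> l)"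
        unfolding mult_smult_distrib[OF tensor_power_GL_carrier f_carrier[OF c]] act_f[OF tensor_power_GL_intertwiner c]
        by (rule arg_cong[of _ _ "\<lambda>X. _ \<cdot>\<^sub>m X"], rule mat_sum_cong) (use c in \<open>auto simp: mult_rep_def\<close>)
    qed
    also have "\<dots> = mat_sum N ?d {..<?k} (\<lambda>b'. \<rho> g $$ (b', b) \<cdot>\<^sub>m fb b')"
    proof (rule eq_matI)
      fix p a assume "p < dim_row (mat_sum N ?d {..<?k} (\<lambda>b'. \<rho> g $$ (b', b) \<cdot>\<^sub>m fb b'))"
        "a < dim_col (mat_sum N ?d {..<?k} (\<lambda>b'. \<rho> g $$ (b', b) \<cdot>\<^sub>m fb b'))"
      then have pa: "p < N" "a < ?d" by auto
      have fi: "(x \<cdot>\<^sub>m f \<mu> l) $$ (p, a) = x * f \<mu> l $$ (p, a)" if "l < ?k" for x l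
        using f_carrier[OF that] pa by simp
      have "mat_sum N ?d {..<?k} (\<lambda>c. L $$ (c, b) \<cdot>\<^sub>m mat_sum N ?d {..<?k} (\<lambda>l. mult_rep \<mu> g $$ (l, c) \<cdot>\<^sub>m f \<mu> l)) $$ (p, a)
        = (\<Sum>c<?k. \<Sum>l<?k. mult_rep \<mu> g $$ (l, c) * L $$ (c, b) * f \<mu> l $$ (p, a))"
        using pa by (simp add: fi sum_distrib_left mult_ac)
      also have "\<dots> = (\<Sum>l<?k. \<Sum>c<?k. mult_rep \<mu> g $$ (l, c) * L $$ (c, b) * f \<mu> l $$ (p, a))"
        by (rule sum.swap)
      also have "\<dots> = (\<Sum>l<?k. (mult_rep \<mu> g * L) $$ (l, b) * f \<mu> l $$ (p, a))"
        by (rule sum.cong[OF refl]) (simp only: mat_mult_index[OF c(4) L _ b] lessThan_iff sum_distrib_right)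
      also have "\<dots> = (\<Sum>l<?k. \<Sum>b'<?k. L $$ (l, b') * \<rho> g $$ (b', b) * f \<mu> l $$ (p, a))"
        unfolding \<sigma>L
        by (rule sum.cong[OF refl]) (simp only: mat_mult_index[OF L c(1) _ b] lessThan_iff sum_distrib_right)
      also have "\<dots> = (\<Sum>b'<?k. \<Sum>l<?k. L $$ (l, b') * \<rho> g $$ (b', b) * f \<mu> l $$ (p, a))"
        by (rule sum.swap)
      also have "\<dots> = (\<Sum>b'<?k. \<rho> g $$ (b', b) * fb b' $$ (p, a))"
        using pa by (simp add: fb_def fi sum_distrib_left mult_ac)
      also have "\<dots> = mat_sum N ?d {..<?k} (\<lambda>b'. \<rho> g $$ (b', b) \<cdot>\<^sub>m fb b') $$ (p, a)"
        using pa carrier_matD[OF fb] by simp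
      finally show "mat_sum N ?d {..<?k} (\<lambda>c. L $$ (c, b) \<cdot>\<^sub>m mat_sum N ?d {..<?k} (\<lambda>l. mult_rep \<mu> g $$ (l, c) \<cdot>\<^sub>m f \<mu> l)) $$ (p, a)
        = mat_sum N ?d {..<?k} (\<lambda>b'. \<rho> g $$ (b', b) \<cdot>\<^sub>m fb b') $$ (p, a)" .
    qed auto
    finally show ?thesis .
  qed
  \<comment> \<open>The number \<open>c\<close> stands for the pair
    \<open>(c div ?k, c mod ?k)\<close>: a basis vector of \<open>V \<mu>\<close> first, the copy
    second, in the order fixed by \<open>kronecker\<close>.\<close>
  define F where "F = mat N (?d * ?k) (\<lambda>(p, c). fb (c mod ?k) $$ (p, c div ?k))"
  define H where "H = mat (?d * ?k) N (\<lambda>(c, p). hb (c mod ?k) $$ (c div ?k, p))"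
  have F: "F \<in> carrier_mat N (?d * ?k)" and H: "H \<in> carrier_mat (?d * ?k) N" by (auto simp: F_def H_def)
  have dm: "c div ?k < ?d" "c mod ?k < ?k" if "c < ?d * ?k" for c
    using that by (auto simp: less_mult_imp_div_less intro!: mod_less_divisor) (metis mult_is_0 not_gr_zero not_less0)
  have AF: "(A * F) $$ (p, c) = (A * fb (c mod ?k)) $$ (p, c div ?k)"
    if "A \<in> carrier_mat r N" "p < r" "c < ?d * ?k" for A r p c
    unfolding mat_mult_index[OF that(1) F that(2,3)] mat_mult_index[OF that(1) fb that(2) dm(1)[OF that(3)]]
    using that by (intro sum.cong) (auto simp: F_def)
  have HA: "(H * A) $$ (c, q) = (hb (c mod ?k) * A) $$ (c div ?k, q)"
    if "A \<in> carrier_mat N r" "q < r" "c < ?d * ?k" for A r q c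
    unfolding mat_mult_index[OF H that(1) that(3,2)] mat_mult_index[OF hb that(1) dm(1)[OF that(3)] that(2)]
    using that by (intro sum.cong) (auto simp: H_def)
  have HF: "H * F = 1\<^sub>m (?d * ?k)"
  proof (rule eq_matI)
    fix c c' assume "c < dim_row (1\<^sub>m (?d * ?k))" "c' < dim_col (1\<^sub>m (?d * ?k))"
    then have c: "c < ?d * ?k" "c' < ?d * ?k" by auto
    have "(H * F) $$ (c, c') = (hb (c mod ?k) * F) $$ (c div ?k, c')" by (rule HA[OF F c(2,1)])
    also have "\<dots> = (hb (c mod ?k) * fb (c' mod ?k)) $$ (c div ?k, c' div ?k)"
      by (rule AF[OF hb dm(1)[OF c(1)] c(2)])
    also have "\<dots> = (if c mod ?k = c' mod ?k \<and> c div ?k = c' div ?k then 1 else 0)"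
      unfolding hb_fb[OF dm(2)[OF c(1)] dm(2)[OF c(2)]] using dm(1)[OF c(1)] dm(1)[OF c(2)] by simp
    also have "(c mod ?k = c' mod ?k \<and> c div ?k = c' div ?k) \<longleftrightarrow> c = c'" by (metis div_mult_mod_eq)
    finally show "(H * F) $$ (c, c') = 1\<^sub>m (?d * ?k) $$ (c, c')" using c by simp
  qed (use H F in auto)
  have QF: "Q \<mu> * F = F"
  proof (rule eq_matI)
    fix p c assume "p < dim_row F" "c < dim_col F"
    then have pc: "p < N" "c < ?d * ?k" using F by auto
    show "(Q \<mu> * F) $$ (p, c) = F $$ (p, c)"
      unfolding AF[OF isotypic_proj_carrier pc] proj_left[OF fb_int] using pc by (simp add: F_def)
  qed (use F in auto)
  have HQ: "H * Q \<mu> = H"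
  proof (rule eq_matI)
    fix c q assume "c < dim_row H" "q < dim_col H"
    then have cq: "q < N" "c < ?d * ?k" using H by auto
    show "(H * Q \<mu>) $$ (c, q) = H $$ (c, q)"
      unfolding HA[OF isotypic_proj_carrier cq] proj_right[OF hb_int] using cq by (simp add: H_def)
  qed (use H in auto)
  show thesis
  proof (rule that[OF F H HF QF HQ], intro conjI)
    fix s g assume s: "s \<in> carrier (sym_group m)" and g: "g \<in> carrier (GL n)"
    note Vs = rep_carrier(1)[OF s] and Rg = is_rep_carrier[OF R g] and Ts = TS_carrier[OF s]
    have Tg: "?T g \<in> carrier_mat N N" by simp
    show K: "kronecker (V \<mu> s) (\<rho> g) \<in> carrier_mat (?d * ?k) (?d * ?k)" using Vs Rg by simp
    have M: "TS s * ?T g \<in> carrier_mat N N" by (rule mult_carrier_mat[OF Ts Tg])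
    show "TS s * ?T g * F = F * kronecker (V \<mu> s) (\<rho> g)"
    proof (rule eq_matI)
      fix p c assume "p < dim_row (F * kronecker (V \<mu> s) (\<rho> g))" "c < dim_col (F * kronecker (V \<mu> s) (\<rho> g))"
      then have pc: "p < N" "c < ?d * ?k" using F carrier_matD[OF K] by auto
      define a b where "a = c div ?k" and "b = c mod ?k"
      have a: "a < ?d" and b: "b < ?k" using dm[OF pc(2)] by (auto simp: a_def b_def)
      have rf: "\<rho> g $$ (b', b) \<cdot>\<^sub>m fb b' \<in> carrier_mat N ?d" for b' using fb by simp
      have "(TS s * ?T g * F) $$ (p, c) = (TS s * ?T g * fb b) $$ (p, a)"
        unfolding a_def b_def by (rule AF[OF M pc])
      also have "TS s * ?T g * fb b = TS s * (?T g * fb b)" by (rule assoc_mult_mat[OF Ts Tg fb])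
      also have "\<dots> = mat_sum N ?d {..<?k} (\<lambda>b'. TS s * (\<rho> g $$ (b', b) \<cdot>\<^sub>m fb b'))"
        unfolding T_fb[OF g b] by (rule mult_mat_sum[OF Ts rf])
      also have "\<dots> $$ (p, a) = (\<Sum>b'<?k. \<rho> g $$ (b', b) * (fb b' * V \<mu> s) $$ (p, a))"
        using pc(1) a carrier_matD[OF mult_carrier_mat[OF fb Vs]]
        by (simp add: mult_smult_distrib[OF Ts fb] TS_fb[OF s] del: index_mult_mat(1))
      also have "\<dots> = (\<Sum>b'<?k. \<Sum>a'<?d. fb b' $$ (p, a') * (V \<mu> s $$ (a', a) * \<rho> g $$ (b', b)))"
        unfolding mat_mult_index[OF fb Vs pc(1) a] by (simp add: sum_distrib_left mult_ac)
      also have "\<dots> = (\<Sum>a'<?d. \<Sum>b'<?k. fb b' $$ (p, a') * (V \<mu> s $$ (a', a) * \<rho> g $$ (b', b)))"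
        by (rule sum.swap)
      also have "\<dots> = (\<Sum>c'<?d * ?k. fb (c' mod ?k) $$ (p, c' div ?k) *
          (V \<mu> s $$ (c' div ?k, a) * \<rho> g $$ (c' mod ?k, b)))"
        by (rule sum_div_mod[symmetric])
      also have "\<dots> = (\<Sum>c'<?d * ?k. F $$ (p, c') * kronecker (V \<mu> s) (\<rho> g) $$ (c', c))"
        by (rule sum.cong[OF refl])
          (use pc carrier_matD[OF Vs] carrier_matD[OF Rg] in \<open>simp add: F_def kronecker_def a_def b_def\<close>)
      also have "\<dots> = (F * kronecker (V \<mu> s) (\<rho> g)) $$ (p, c)"
        by (rule mat_mult_index[OF F K pc, symmetric])
      finally show "(TS s * ?T g * F) $$ (p, c) = (F * kronecker (V \<mu> s) (\<rho> g)) $$ (p, c)" .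
    qed (use carrier_matD[OF M] carrier_matD[OF F] carrier_matD[OF K] in auto)
  qed
qed

text \<open>Traces in \<open>sum_Q\<close>: each of the \<open>k \<mu>\<close> copies contributes
  \<open>d \<mu>\<close>.\<close>

lemma dim_sum: "(\<Sum>\<mu>\<in>\<Lambda>. d \<mu> * k \<mu>) = N"
proof -
  have "(of_nat (\<Sum>\<mu>\<in>\<Lambda>. d \<mu> * k \<mu>) :: complex) = (\<Sum>\<mu>\<in>\<Lambda>. trace_mat (Q \<mu>))"
    unfolding of_nat_sum
  proof (rule sum.cong[OF refl])
    fix \<mu> assume \<mu>: "\<mu> \<in> \<Lambda>"
    interpret isotypic_component "sym_group m" "d \<mu>" "V \<mu>" N TS "k \<mu>" "f \<mu>" "h \<mu>"
      by (rule component[OF \<mu>])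
    have "trace_mat (Q \<mu>) = (\<Sum>i<k \<mu>. trace_mat (f \<mu> i * h \<mu> i))"
      unfolding isotypic_proj_def by (rule trace_mat_sum) (use fh_carrier in auto)
    also have "\<dots> = (\<Sum>i<k \<mu>. of_nat (d \<mu>))"
      by (rule sum.cong[OF refl]) (use trace_mat_mult_comm[OF f_carrier h_carrier] orth in simp)
    finally show "of_nat (d \<mu> * k \<mu>) = trace_mat (Q \<mu>)" by (simp add: mult.commute)
  qed
  also have "\<dots> = trace_mat (mat_sum N N \<Lambda> Q)" by (rule trace_mat_sum[symmetric]) simp
  also have "\<dots> = of_nat N" unfolding sum_Q by simp
  finally show ?thesis by (simp only: of_nat_eq_iff)
qed

theorem decomposition:
  assumes W: "\<And>\<mu>. \<mu> \<in> \<Lambda> \<Longrightarrow> is_W n \<mu> (W \<mu>)"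
  shows "rep_iso (sym_group m \<times>\<times> GL n) (tensor_power_rep m n)
           (direct_sum_rep \<Lambda> (\<lambda>\<mu>. ext_tensor_rep (V \<mu>) (W \<mu>)))"
proof -
  let ?T = "tensor_power_GL m n"
  have fin: "finite \<Lambda>" by (rule finite_partitions_at_most)
  have "\<forall>\<mu>. \<exists>p. \<mu> \<in> \<Lambda> \<longrightarrow> fst p \<in> carrier_mat N (d \<mu> * k \<mu>) \<and> snd p \<in> carrier_mat (d \<mu> * k \<mu>) N \<and>
    snd p * fst p = 1\<^sub>m (d \<mu> * k \<mu>) \<and> Q \<mu> * fst p = fst p \<and> snd p * Q \<mu> = snd p \<and>
    (\<forall>s\<in>carrier (sym_group m). \<forall>g\<in>carrier (GL n).
      kronecker (V \<mu> s) (W \<mu> g) \<in> carrier_mat (d \<mu> * k \<mu>) (d \<mu> * k \<mu>) \<and>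
      TS s * ?T g * fst p = fst p * kronecker (V \<mu> s) (W \<mu> g))"
  proof (intro allI)
    fix \<mu>
    show "\<exists>p. \<mu> \<in> \<Lambda> \<longrightarrow> fst p \<in> carrier_mat N (d \<mu> * k \<mu>) \<and> snd p \<in> carrier_mat (d \<mu> * k \<mu>) N \<and>
      snd p * fst p = 1\<^sub>m (d \<mu> * k \<mu>) \<and> Q \<mu> * fst p = fst p \<and> snd p * Q \<mu> = snd p \<and>
      (\<forall>s\<in>carrier (sym_group m). \<forall>g\<in>carrier (GL n).
        kronecker (V \<mu> s) (W \<mu> g) \<in> carrier_mat (d \<mu> * k \<mu>) (d \<mu> * k \<mu>) \<and>
        TS s * ?T g * fst p = fst p * kronecker (V \<mu> s) (W \<mu> g))"
    proof (cases "\<mu> \<in> \<Lambda>")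
      case True
      from component_block[OF True W[OF True]] obtain F H where
        "F \<in> carrier_mat N (d \<mu> * k \<mu>)" "H \<in> carrier_mat (d \<mu> * k \<mu>) N"
        "H * F = 1\<^sub>m (d \<mu> * k \<mu>)" "Q \<mu> * F = F" "H * Q \<mu> = H"
        "\<And>s g. s \<in> carrier (sym_group m) \<Longrightarrow> g \<in> carrier (GL n) \<Longrightarrow>
          kronecker (V \<mu> s) (W \<mu> g) \<in> carrier_mat (d \<mu> * k \<mu>) (d \<mu> * k \<mu>) \<and>
          TS s * ?T g * F = F * kronecker (V \<mu> s) (W \<mu> g)" by blast
      then show ?thesis by (intro exI[of _ "(F, H)"]) simp
    qed simp
  qed
  from choice[OF this] obtain FH where FH: "\<And>\<mu>. \<mu> \<in> \<Lambda> \<Longrightarrow> fst (FH \<mu>) \<in> carrier_mat N (d \<mu> * k \<mu>)"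
    "\<And>\<mu>. \<mu> \<in> \<Lambda> \<Longrightarrow> snd (FH \<mu>) \<in> carrier_mat (d \<mu> * k \<mu>) N"
    "\<And>\<mu>. \<mu> \<in> \<Lambda> \<Longrightarrow> snd (FH \<mu>) * fst (FH \<mu>) = 1\<^sub>m (d \<mu> * k \<mu>)"
    "\<And>\<mu>. \<mu> \<in> \<Lambda> \<Longrightarrow> Q \<mu> * fst (FH \<mu>) = fst (FH \<mu>)" "\<And>\<mu>. \<mu> \<in> \<Lambda> \<Longrightarrow> snd (FH \<mu>) * Q \<mu> = snd (FH \<mu>)"
    "\<And>\<mu> s g. \<mu> \<in> \<Lambda> \<Longrightarrow> s \<in> carrier (sym_group m) \<Longrightarrow> g \<in> carrier (GL n) \<Longrightarrow>
      kronecker (V \<mu> s) (W \<mu> g) \<in> carrier_mat (d \<mu> * k \<mu>) (d \<mu> * k \<mu>) \<and>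
      TS s * ?T g * fst (FH \<mu>) = fst (FH \<mu>) * kronecker (V \<mu> s) (W \<mu> g)"
    by blast
  define xs where "xs = map (from_nat_into \<Lambda>) [0..<card \<Lambda>]"
  have bij: "bij_betw (from_nat_into \<Lambda>) {..<card \<Lambda>} \<Lambda>" by (rule bij_betw_from_nat_into_finite[OF fin])
  have set_xs: "set xs = \<Lambda>" using bij by (simp add: xs_def bij_betw_def lessThan_atLeast0)
  have dist: "distinct xs" using bij by (simp add: xs_def distinct_map bij_betw_def lessThan_atLeast0)
  have orth: "snd (FH \<mu>) * fst (FH \<nu>) = (if \<mu> = \<nu> then 1\<^sub>m (d \<mu> * k \<mu>) else 0\<^sub>m (d \<mu> * k \<mu>) (d \<nu> * k \<nu>))"
    if \<mu>: "\<mu> \<in> \<Lambda>" and \<nu>: "\<nu> \<in> \<Lambda>" for \<mu> \<nu>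
  proof (cases "\<mu> = \<nu>")
    case True
    then show ?thesis using FH(3)[OF \<mu>] by simp
  next
    case False
    note c = FH(1)[OF \<nu>] FH(2)[OF \<mu>]
    note [simp] = c[THEN carrier_matD(1)] c[THEN carrier_matD(2)]
    have "snd (FH \<mu>) * fst (FH \<nu>) = (snd (FH \<mu>) * Q \<mu>) * (Q \<nu> * fst (FH \<nu>))"
      using FH(4)[OF \<nu>] FH(5)[OF \<mu>] by simp
    also have "\<dots> = snd (FH \<mu>) * (Q \<mu> * Q \<nu>) * fst (FH \<nu>)" by (simp add: mat_assoc)
    also have "\<dots> = 0\<^sub>m (d \<mu> * k \<mu>) (d \<nu> * k \<nu>)"
      unfolding Q_Q_zero[OF \<mu> \<nu> False] right_mult_zero_mat[OF c(2)] by (rule left_mult_zero_mat[OF c(1)])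
    finally show ?thesis using False by simp
  qed
  have len: "sum_list (map (\<lambda>\<mu>. d \<mu> * k \<mu>) xs) = N"
    using dim_sum sum_list_distinct_conv_sum_set[OF dist, of "\<lambda>\<mu>. d \<mu> * k \<mu>"] by (simp add: set_xs)
  obtain P L where P: "P \<in> carrier_mat N N" and L: "L \<in> carrier_mat N N" and LP: "L * P = 1\<^sub>m N"
    and MP: "\<And>M B. M \<in> carrier_mat N N \<Longrightarrow>
      (\<forall>\<mu>\<in>set xs. B \<mu> \<in> carrier_mat (d \<mu> * k \<mu>) (d \<mu> * k \<mu>) \<and> M * fst (FH \<mu>) = fst (FH \<mu>) * B \<mu>) \<Longrightarrow>
      M * P = P * diag_block_mat (map B xs)"
    using block_assembly[of xs "\<lambda>\<mu>. fst (FH \<mu>)" N "\<lambda>\<mu>. d \<mu> * k \<mu>" "\<lambda>\<mu>. snd (FH \<mu>)", unfolded set_xs len,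
        OF dist FH(1,2) orth]
    unfolding set_xs by blast
  \<comment> \<open>By \<open>dim_sum\<close> the assembled matrices are square, so the left inverse
    is two-sided. Neither depends on the group element.\<close>
  have PL: "P * L = 1\<^sub>m N" by (rule mat_mult_left_right_inverse[OF L P LP])
  show ?thesis unfolding rep_iso_def
  proof (rule exI[of _ P], rule exI[of _ L], rule ballI)
    fix x assume "x \<in> carrier (sym_group m \<times>\<times> GL n)"
    then obtain s g where x: "x = (s, g)" and s: "s \<in> carrier (sym_group m)" and g: "g \<in> carrier (GL n)"
      by (auto simp: DirProd_def)
    define B where "B = (\<lambda>\<mu>. kronecker (V \<mu> s) (W \<mu> g))"
    define D where "D = diag_block_mat (map B xs)"
    have M: "TS s * ?T g \<in> carrier_mat N N"
      by (rule mult_carrier_mat[OF TS_carrier[OF s] tensor_power_GL_carrier])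
    have Bc: "B \<mu> \<in> carrier_mat (d \<mu> * k \<mu>) (d \<mu> * k \<mu>)" if "\<mu> \<in> \<Lambda>" for \<mu>
      using FH(6)[OF that s g] by (simp add: B_def)
    have "map dim_row (map B xs) = map (\<lambda>\<mu>. d \<mu> * k \<mu>) xs" "map dim_col (map B xs) = map (\<lambda>\<mu>. d \<mu> * k \<mu>) xs"
      using carrier_matD[OF Bc] set_xs by auto
    then have D: "D \<in> carrier_mat N N" unfolding D_def
      by (intro carrier_matI) (simp_all only: dim_diag_block_mat len)
    have MPD: "TS s * ?T g * P = P * D" unfolding D_def
      by (rule MP[OF M]) (use FH(6)[OF _ s g] set_xs in \<open>auto simp: B_def\<close>)
    have eqM: "TS s * ?T g = P * D * L"
    proof -
      have "TS s * ?T g = TS s * ?T g * (P * L)" using PL right_mult_one_mat[OF M] by simp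
      also have "\<dots> = TS s * ?T g * P * L" by (rule assoc_mult_mat[OF M P L, symmetric])
      finally show ?thesis unfolding MPD .
    qed
    have T: "tensor_power_rep m n x = TS s * ?T g" by (simp add: tensor_power_rep_def x)
    have S: "direct_sum_rep \<Lambda> (\<lambda>\<mu>. ext_tensor_rep (V \<mu>) (W \<mu>)) x = D"
      by (simp add: direct_sum_rep_def ext_tensor_rep_def x D_def B_def xs_def comp_def)
    show "similar_mat_wit (tensor_power_rep m n x) (direct_sum_rep \<Lambda> (\<lambda>\<mu>. ext_tensor_rep (V \<mu>) (W \<mu>)) x) P L"
      unfolding T S similar_mat_wit_def Let_def using M D P L PL LP eqM carrier_matD[OF M] by simp
  qed
qed

end

section \<open>Choice of the isotypic data and conclusion\<close>

theorem theorem38: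
  fixes m n :: nat
    and V :: "nat list \<Rightarrow> (nat \<Rightarrow> nat) \<Rightarrow> complex mat"
    and W :: "nat list \<Rightarrow> complex mat \<Rightarrow> complex mat"
  assumes "m \<ge> 1" and "n \<ge> 1"
    and "\<And>\<mu>. \<mu> \<in> partitions_at_most m n \<Longrightarrow> is_V m \<mu> (V \<mu>)"
    and "\<And>\<mu>. \<mu> \<in> partitions_at_most m n \<Longrightarrow> is_W n \<mu> (W \<mu>)"
  shows "rep_iso (sym_group m \<times>\<times> GL n) (tensor_power_rep m n)
           (direct_sum_rep (partitions_at_most m n) (\<lambda>\<mu>. ext_tensor_rep (V \<mu>) (W \<mu>)))"
proof -
  let ?G = "sym_group m" and ?N = "tensor_dim m n" and ?T = "tensor_power_sym m n"
  have fin: "finite (carrier ?G)" by (simp add: sym_group_def finite_permutations)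
  \<comment> \<open>Degree, multiplicity and both dual bases are chosen jointly as one tuple, since
    the bases only make sense for the chosen degree and multiplicity.\<close>
  have "\<forall>\<mu>. \<exists>q :: nat \<times> nat \<times> (nat \<Rightarrow> complex mat) \<times> (nat \<Rightarrow> complex mat). \<mu> \<in> partitions_at_most m n \<longrightarrow>
    irrep ?G (fst q) (V \<mu>) \<and> isotypic ?G (fst q) (V \<mu>) ?N ?T (fst (snd q)) (fst (snd (snd q))) (snd (snd (snd q)))"
  proof (intro allI)
    fix \<mu>
    show "\<exists>q :: nat \<times> nat \<times> (nat \<Rightarrow> complex mat) \<times> (nat \<Rightarrow> complex mat). \<mu> \<in> partitions_at_most m n \<longrightarrow>
      irrep ?G (fst q) (V \<mu>) \<and> isotypic ?G (fst q) (V \<mu>) ?N ?T (fst (snd q)) (fst (snd (snd q))) (snd (snd (snd q)))"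
    proof (cases "\<mu> \<in> partitions_at_most m n")
      case True
      then obtain d where d: "irrep ?G d (V \<mu>)"
        using assms(3) unfolding is_V_def irreducible_rep_iff by blast
      obtain k f h where "isotypic ?G d (V \<mu>) ?N ?T k f h"
        using isotypic_exists[OF fin d tensor_power_sym_rep] by blast
      then show ?thesis using d by (intro exI[of _ "(d, k, f, h)"]) simp
    qed simp
  qed
  from choice[OF this] obtain q :: "nat list \<Rightarrow> nat \<times> nat \<times> (nat \<Rightarrow> complex mat) \<times> (nat \<Rightarrow> complex mat)"
    where q: "\<And>\<mu>. \<mu> \<in> partitions_at_most m n \<Longrightarrow> irrep ?G (fst (q \<mu>)) (V \<mu>)"
    "\<And>\<mu>. \<mu> \<in> partitions_at_most m n \<Longrightarrow>
      isotypic ?G (fst (q \<mu>)) (V \<mu>) ?N ?T (fst (snd (q \<mu>))) (fst (snd (snd (q \<mu>)))) (snd (snd (snd (q \<mu>))))"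
    by blast
  interpret specht_family m n V "\<lambda>\<mu>. fst (q \<mu>)" "\<lambda>\<mu>. fst (snd (q \<mu>))"
    "\<lambda>\<mu>. fst (snd (snd (q \<mu>)))" "\<lambda>\<mu>. snd (snd (snd (q \<mu>)))"
    using q assms(3) by unfold_locales (auto simp: is_V_def)
  show ?thesis by (rule decomposition[OF assms(4)])
qed

end
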